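(* Let $(A_N)_{N\ge2}$ be a sequence of coupling matrices such that $\max_{1\le i\le N}R_i\lesssim1$ and $\lim_{N\to\infty}\lambda_1(A_N)=1$. (a) If $(\beta,B)\in\Theta_1$, then $$\log Z_N(\beta,B)-\mathcal M_N(\beta,B)\lesssim\lVert A_N\rVert_F^2+t^2\sum_{i=1}^N(R_i-1)^2.$$ (b) If $(\beta,B)\in\Theta_2$, then the same conclusion as in part (a) holds under the extra assumption $\limsup_{N\to\infty}\frac{\lambda_2(A_N)}{\lambda_1(A_N)}<1$. (c) If $(\beta,B)\in\Theta_3$, then under the extra assumption $\limsup_{N\to\infty}\frac{\lambda_2(A_N)}{\lambda_1(A_N)}<1$ we have $$\log Z_N(\beta,B)-\mathcal M_N(\beta,B)\lesssim\lVert A_N\rVert_F^2+\frac1N\Big[\sum_{i=1}^N(R_i-1)^2\Big]^2+\frac1N\Big[\sum_{i=1}^N(R_i-1)\Big]^2+\log N.$$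
   Context: A coupling matrix $A_N$ is a symmetric $N\times N$ matrix with non-negative entries and zeros on the diagonal. For $\beta>0$, $B\in\mathbb R$, the partition function of the Ising model is $Z_N(\beta,B)=\sum_{\boldsymbol\sigma\in\{-1,1\}^N}\exp\big(\frac\beta2\boldsymbol\sigma^\top A_N\boldsymbol\sigma+B\sum_{i=1}^N\sigma_i\big)$. Put $R_i=\sum_{j=1}^NA_N(i,j)$, $\lambda_1(A_N)\ge\dots\ge\lambda_N(A_N)$ the eigenvalues, $\lVert\cdot\rVert_F$ the Frobenius norm. Parameter regimes: $\Theta_{11}=\{(\beta,0):0<\beta<1\}$, $\Theta_{12}=\{(\beta,B):\beta>0,B\ne0\}$, $\Theta_1=\Theta_{11}\cup\Theta_{12}$, $\Theta_2=\{(\beta,0):\beta>1\}$, $\Theta_3=\{(1,0)\}$. Define $t$: for $(\beta,B)\in\Theta_{11}\cup\Theta_3$, $t=0$; for $(\beta,B)\in\Theta_{12}$, $t$ is the unique solution of $x=\tanh(\beta x+B)$ with the same sign as $B$; for $(\beta,B)\in\Theta_2$, $t$ is the unique strictly positive solution of $x=\tanh(\beta x)$. Mean-field prediction: $\mathcal M_N(\beta,B):=N\big\{\frac{\beta t^2}2+Bt-I(t)\big\}+\frac{\beta t^2}2\sum_{i=1}^N(R_i-1)$, where $I(x)=\frac{1+x}2\log\frac{1+x}2+\frac{1-x}2\log\frac{1-x}2$. $x_N\lesssim y_N$ means there is a finite constant $C$ free of $N$ (it may depend on $\beta,B$ and on the sequence $(A_N)$) with $x_N\le Cy_N$ for all $N$.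 *)

theory Defs
  imports "Jordan_Normal_Form.Char_Poly" "HOL-Library.Extended_Real" "HOL-Library.FuncSet"
begin

definition coupling_matrix :: "nat \<Rightarrow> real mat \<Rightarrow> bool" where
  "coupling_matrix N A \<longleftrightarrow>
     A \<in> carrier_mat N N \<and> transpose_mat A = A \<and>
     (\<forall>i<N. \<forall>j<N. A $$ (i, j) \<ge> 0) \<and> (\<forall>i<N. A $$ (i, i) = 0)"

definition row_sum :: "real mat \<Rightarrow> nat \<Rightarrow> real" where
  "row_sum A i = (\<Sum>j<dim_col A. A $$ (i, j))"

definition frob_norm :: "real mat \<Rightarrow> real" where
  "frob_norm A = sqrt (\<Sum>i<dim_row A. \<Sum>j<dim_col A. (A $$ (i, j))\<^sup>2)"

(* The k-th largest eigenvalue, k = 1, 2, ..., counted with algebraic multiplicity.  It is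
   meaningful for real symmetric A and k \<le> dim_row A, since then the characteristic polynomial
   splits over the reals and proots has dim_row A elements. *)
definition eigval :: "nat \<Rightarrow> real mat \<Rightarrow> real" where
  "eigval k A = rev (sorted_list_of_multiset (proots (char_poly A))) ! (k - 1)"

definition spin_configs :: "nat \<Rightarrow> real vec set" where
  "spin_configs N = {\<sigma> \<in> carrier_vec N. \<forall>i<N. \<sigma> $ i \<in> {-1, 1}}"

lemma finite_spin_configs: "finite (spin_configs N)"
proof (rule finite_subset)
  show "spin_configs N \<subseteq> vec N ` ({..<N} \<rightarrow>\<^sub>E {-1, 1})"
  proof
    fix \<sigma> assume s: "\<sigma> \<in> spin_configs N"
    have "\<sigma> = vec N (restrict (\<lambda>i. \<sigma> $ i) {..<N})"
      using s by (intro eq_vecI) (auto simp: spin_configs_def)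
    moreover have "restrict (\<lambda>i. \<sigma> $ i) {..<N} \<in> {..<N} \<rightarrow>\<^sub>E {-1, 1}"
      using s by (auto simp: spin_configs_def)
    ultimately show "\<sigma> \<in> vec N ` ({..<N} \<rightarrow>\<^sub>E {-1, 1})" by blast
  qed
  show "finite (vec N ` ({..<N} \<rightarrow>\<^sub>E {-1, 1::real}))"
    by (intro finite_imageI finite_PiE) auto
qed

definition partition_fun :: "real mat \<Rightarrow> real \<Rightarrow> real \<Rightarrow> real" where
  "partition_fun A \<beta> B =
     (\<Sum>\<sigma>\<in>spin_configs (dim_row A).
        exp (\<beta> / 2 * (\<sigma> \<bullet> (A *\<^sub>v \<sigma>)) + B * (\<Sum>i<dim_row A. \<sigma> $ i)))"

definition Theta11 :: "(real \<times> real) set" where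
  "Theta11 = {(\<beta>, B). 0 < \<beta> \<and> \<beta> < 1 \<and> B = 0}"

definition Theta12 :: "(real \<times> real) set" where
  "Theta12 = {(\<beta>, B). \<beta> > 0 \<and> B \<noteq> 0}"

definition Theta1 :: "(real \<times> real) set" where
  "Theta1 = Theta11 \<union> Theta12"

definition Theta2 :: "(real \<times> real) set" where
  "Theta2 = {(\<beta>, B). \<beta> > 1 \<and> B = 0}"

definition Theta3 :: "(real \<times> real) set" where
  "Theta3 = {(1, 0)}"

definition mf_point :: "real \<Rightarrow> real \<Rightarrow> real" where
  "mf_point \<beta> B =
     (if (\<beta>, B) \<in> Theta12 then (THE x. x = tanh (\<beta> * x + B) \<and> sgn x = sgn B)
      else if (\<beta>, B) \<in> Theta2 then (THE x. x > 0 \<and> x = tanh (\<beta> * x))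
      else 0)"

definition entropy_fun :: "real \<Rightarrow> real" where
  "entropy_fun x = (1 + x) / 2 * ln ((1 + x) / 2) + (1 - x) / 2 * ln ((1 - x) / 2)"

definition mf_prediction :: "real mat \<Rightarrow> real \<Rightarrow> real \<Rightarrow> real" where
  "mf_prediction A \<beta> B =
     (let t = mf_point \<beta> B; N = dim_row A in
        real N * (\<beta> * t\<^sup>2 / 2 + B * t - entropy_fun t)
        + \<beta> * t\<^sup>2 / 2 * (\<Sum>i<N. (row_sum A i - 1)))"

(* Sequences are indexed by N \<ge> 2; their values at 0 and 1 are ignored. *)
definition lesssim :: "(nat \<Rightarrow> real) \<Rightarrow> (nat \<Rightarrow> real) \<Rightarrow> bool" where
  "lesssim x y \<longleftrightarrow> (\<exists>C. \<forall>N\<ge>2. x N \<le> C * y N)"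

end

theory Submission
  imports "HOL-Analysis.Analysis" Defs
begin

text \<open>Put \<open>h = \<beta> t + B\<close>, so that \<open>t = tanh h\<close>, and let \<open>Y = \<sigma> - t\<close> where the spins are independent
  with mean \<open>t\<close>. Completing the square gives
  \<open>ln Z - M = ln E exp (\<beta>/2 Y\<^sup>T A Y + \<beta> t \<Sum> (R\<^sub>i - 1) Y\<^sub>i)\<close>, and this expectation is bounded by Hoelder's
  inequality after splitting the spectrum of \<open>A\<close> at a small level \<open>\<eta>\<close>. Eigenvalues below \<open>-\<eta>\<close> are
  dropped. There are at most \<open>\<parallel>A\<parallel>\<^sub>F\<^sup>2 / \<eta>\<^sup>2\<close> eigenvalues above \<open>\<eta>\<close>; their squares are linearised one by one at
  the price of a constant factor each, and the sharp sub-Gaussian constant \<open>tanh h / h\<close> of a spin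
  (Kearns-Saul) makes this subcritical. What remains has operator norm at most \<open>\<eta>\<close>, and there
  an interpolation with integration by parts over single spins costs \<open>O(\<parallel>A\<parallel>\<^sub>F\<^sup>2)\<close>.

  On \<open>\<Theta>\<^sub>1\<close> the sub-Gaussian constant satisfies \<open>\<beta> tanh h / h < 1\<close>, which suffices. On \<open>\<Theta>\<^sub>2\<close> and
  \<open>\<Theta>\<^sub>3\<close> the direction of the constant vector is critical. If \<open>\<Sum> (R\<^sub>i - 1)\<^sup>2\<close> is of order \<open>N\<close>, the claim is
  trivial; otherwise the top eigenvector is close to the constants, so the form compressed to their
  complement is subcritical by the gap assumption, and the magnetisation is treated by tilting the
  product measure. On \<open>\<Theta>\<^sub>2\<close>, by symmetry, one may restrict to nonnegative magnetisation, where the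
  Kearns-Saul inequality is strict away from the centre. On \<open>\<Theta>\<^sub>3\<close> one sums over all values of the
  magnetisation, whence the \<open>log N\<close>, and gains from \<open>ln cosh m \<le> m\<^sup>2/2 - m\<^sup>4/48\<close>.\<close>

section \<open>The log-Laplace transform of a spin\<close>

text \<open>A linearised square costs a constant factor however small its eigenvalue is, so
  linearising the whole spectrum would cost order N in the exponent; integration by parts has no
  such cost but needs a small norm. Hence the cut at a fixed level \<eta>. The constants do not
  depend on the field h, because the same estimate is later applied to all tilted fields h + b.

  The obstacle: on \<open>Theta2\<close> one has h = \<beta> t, so \<beta> tanh h / h is exactly 1,
  and on \<open>Theta3\<close> h = 0 and the sub-Gaussian constant is 1; an eigenvalue near 1 leaves
  no room. Moreover the Kearns-Saul inequality is an equality at x = - 2 h, the shift to the mirror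
  phase, so its constant cannot be improved globally; this forces the restriction to a half space.
  Orthogonally to the constants the gap leaves a margin \<delta> / 4, and this margin is spent: a
  slightly worse sub-Gaussian constant for fields with sum zero buys a gain c b^2 per site for the
  uniform tilt b, and that gain makes the sum over the discretised magnetisation converge.\<close>

definition psi :: "real \<Rightarrow> real \<Rightarrow> real" where
  "psi h x = ln (cosh (h + x)) - ln (cosh h) - x * tanh h"

lemma psi_0 [simp]: "psi h 0 = 0"
  by (simp add: psi_def)

lemma has_real_derivative_ln_cosh [derivative_intros]:
  "(g has_real_derivative d) (at x) \<Longrightarrow>
    ((\<lambda>x. ln (cosh (g x :: real))) has_real_derivative tanh (g x) * d) (at x)"
  by (auto intro!: derivative_eq_intros simp: tanh_def divide_simps)

lemma has_real_derivative_tanh [derivative_intros]: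
  "(g has_real_derivative d) (at x) \<Longrightarrow>
    ((\<lambda>x. tanh (g x :: real)) has_real_derivative (1 - (tanh (g x))\<^sup>2) * d) (at x)"
  by (rule has_field_derivative_tanh) auto

lemma has_real_derivative_psi [derivative_intros]:
  "(psi h has_real_derivative (tanh (h + x) - tanh h)) (at x)"
  unfolding psi_def [abs_def] by (auto intro!: derivative_eq_intros)

lemma min_of_deriv_sign:
  fixes f f' :: "real \<Rightarrow> real"
  assumes "\<And>y. y \<ge> l \<Longrightarrow> (f has_real_derivative f' y) (at y)"
    and "\<And>y. l \<le> y \<Longrightarrow> y \<le> c \<Longrightarrow> f' y \<le> 0"
    and "\<And>y. c \<le> y \<Longrightarrow> f' y \<ge> 0"
    and "l \<le> c" "l \<le> x"
  shows "f c \<le> f x"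
proof (cases "c \<le> x")
  case True
  show ?thesis
    by (rule DERIV_nonneg_imp_nondecreasing[OF True]) (meson assms order_trans)
next
  case False
  then have "x \<le> c" by simp
  then show ?thesis
    by (rule DERIV_nonpos_imp_nonincreasing) (meson assms order_trans)
qed

lemma tanh_diff_le:
  fixes x y :: real assumes "x \<le> y" shows "tanh y - tanh x \<le> y - x"
proof -
  have "x - tanh x \<le> y - tanh y"
    by (rule DERIV_nonneg_imp_nondecreasing[OF assms])
      (auto intro!: exI derivative_eq_intros)
  then show ?thesis by simp
qed

lemma tanh_lipschitz: "\<bar>tanh y - tanh x\<bar> \<le> \<bar>y - x :: real\<bar>"
proof (cases "x \<le> y")
  case True then show ?thesis using tanh_diff_le[OF True] by (simp add: abs_if)
next
  case False then show ?thesis using tanh_diff_le[of y x] by (simp add: abs_if)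
qed

lemma abs_tanh_le_1: "\<bar>tanh x :: real\<bar> \<le> 1"
  using tanh_real_gt_neg1[of x] tanh_real_lt_1[of x] by linarith

text \<open>A spin has variance at most 1 in every field, that is, \<open>tanh\<close> is
  1-Lipschitz. Uniformity in \<open>h\<close> is what makes this usable after tilting.\<close>

lemma psi_le_square: "psi h x \<le> x\<^sup>2 / 2"
proof -
  have "(0::real)\<^sup>2 / 2 - psi h 0 \<le> x\<^sup>2 / 2 - psi h x"
  proof (rule min_of_deriv_sign[where l = "min x 0" and c = 0 and f = "\<lambda>x. x\<^sup>2 / 2 - psi h x" and f' = "\<lambda>y. y - (tanh (h + y) - tanh h)"])
    fix y :: real
    show "((\<lambda>x. x\<^sup>2 / 2 - psi h x) has_real_derivative y - (tanh (h + y) - tanh h)) (at y)"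
      by (auto intro!: derivative_eq_intros)
    show "0 \<le> y - (tanh (h + y) - tanh h)" if "0 \<le> y"
      using tanh_diff_le[of h "h + y"] that by simp
    show "y - (tanh (h + y) - tanh h) \<le> 0" if "y \<le> 0"
      using tanh_diff_le[of "h + y" h] that by simp
  qed auto
  then show ?thesis by simp
qed

section \<open>The ratio of \<open>tanh\<close> to its argument and the Kearns-Saul
  inequality\<close>

lemma tanh_gt_deriv: "0 < (y::real) \<Longrightarrow> y * (1 - (tanh y)\<^sup>2) < tanh y"
proof -
  assume "0 < y"
  let ?k = "\<lambda>y::real. tanh y - y * (1 - (tanh y)\<^sup>2)"
  have "?k 0 < ?k y"
  proof (rule DERIV_pos_imp_increasing_open[OF \<open>0 < y\<close>])
    fix x :: real assume x: "0 < x" "x < y"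
    have "(?k has_real_derivative 2 * x * tanh x * (1 - (tanh x)\<^sup>2)) (at x)"
      by (auto intro!: derivative_eq_intros simp: algebra_simps power2_eq_square)
    moreover have "(tanh x)\<^sup>2 < 1"
      using tanh_real_gt_neg1[of x] tanh_real_lt_1[of x] by (simp add: abs_square_less_1)
    moreover have "0 < 2 * x * tanh x * (1 - (tanh x)\<^sup>2)"
      using x \<open>(tanh x)\<^sup>2 < 1\<close> by simp
    ultimately show "\<exists>d. (?k has_real_derivative d) (at x) \<and> 0 < d"
      by blast
  next
    show "continuous_on {0..y} ?k" by (intro continuous_intros) auto
  qed
  then show ?thesis by simp
qed

text \<open>The numerator of the derivative is negative because b z is at most w = b z + B and w (1
  - tanh^2 w) < tanh w. The case b = 1, B = 0 gives the Kearns-Saul inequality, the general case the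
  uniqueness of the mean-field point.\<close>

lemma tanh_ratio_decreasing:
  fixes b B :: real
  assumes "0 < x" "x < y" "0 < b" "0 \<le> B"
  shows "tanh (b * y + B) / y < tanh (b * x + B) / x"
proof (rule DERIV_neg_imp_decreasing[OF assms(2)])
  fix z assume z: "x \<le> z" "z \<le> y"
  then have z0: "0 < z" using assms by linarith
  let ?w = "b * z + B"
  have w: "0 < ?w" "b * z \<le> ?w" using z0 assms by (auto intro: add_pos_nonneg)
  have sq: "(tanh ?w)\<^sup>2 < 1"
    using tanh_real_gt_neg1[of ?w] tanh_real_lt_1[of ?w] by (simp add: abs_square_less_1)
  have "b * z * (1 - (tanh ?w)\<^sup>2) \<le> ?w * (1 - (tanh ?w)\<^sup>2)"
    using w sq by (intro mult_right_mono) auto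
  also have "\<dots> < tanh ?w" by (rule tanh_gt_deriv[OF w(1)])
  finally have neg: "b * z * (1 - (tanh ?w)\<^sup>2) - tanh ?w < 0" by simp
  have "((\<lambda>z. tanh (b * z + B) / z) has_real_derivative
      (b * z * (1 - (tanh ?w)\<^sup>2) - tanh ?w) / z\<^sup>2) (at z)"
    using z0 by (auto intro!: derivative_eq_intros simp: power2_eq_square algebra_simps)
  moreover have "(b * z * (1 - (tanh ?w)\<^sup>2) - tanh ?w) / z\<^sup>2 < 0"
    using neg z0 by (simp add: divide_neg_pos)
  ultimately show "\<exists>d. ((\<lambda>z. tanh (b * z + B) / z) has_real_derivative d) (at z) \<and> d < 0"
    by blast
qed

lemma tanh_ratio_antimono:
  fixes x y :: real
  assumes "0 < x" "x \<le> y" shows "tanh y / y \<le> tanh x / x"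
  using tanh_ratio_decreasing[of x y 1 0] assms by (cases "x = y") auto

text \<open>The quadratic minus \<open>ln cosh\<close> has derivative
  \<open>?s * y - tanh y\<close>, which changes sign from negative to positive at y = h because tanh
  y / y decreases; so it is smallest at h.\<close>

lemma ln_cosh_quadratic:
  fixes h y :: real
  assumes "h > 0" "y \<ge> 0"
  shows "ln (cosh y) - ln (cosh h) \<le> tanh h / h * (y\<^sup>2 - h\<^sup>2) / 2"
proof -
  let ?s = "tanh h / h"
  have "?s * h\<^sup>2 / 2 - ln (cosh h) \<le> ?s * y\<^sup>2 / 2 - ln (cosh y)"
  proof (rule min_of_deriv_sign[where l = 0 and c = h and f = "\<lambda>y. ?s * y\<^sup>2 / 2 - ln (cosh y)"
      and f' = "\<lambda>y. ?s * y - tanh y"])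
    fix z :: real
    show "((\<lambda>y. ?s * y\<^sup>2 / 2 - ln (cosh y)) has_real_derivative ?s * z - tanh z) (at z)"
      using assms by (auto intro!: derivative_eq_intros)
    show "?s * z - tanh z \<le> 0" if "0 \<le> z" "z \<le> h"
    proof (cases "z = 0")
      case False
      have "?s \<le> tanh z / z" using that assms False by (intro tanh_ratio_antimono) auto
      moreover have "0 < z" using False that by simp
      ultimately show ?thesis by (simp only: pos_le_divide_eq)
    qed auto
    show "?s * z - tanh z \<ge> 0" if "h \<le> z"
    proof -
      have "tanh z / z \<le> ?s" using that assms by (intro tanh_ratio_antimono) auto
      then show ?thesis using assms that by (simp add: pos_divide_le_eq)
    qed
  qed (use assms in auto)
  then show ?thesis by (simp add: algebra_simps diff_divide_distrib)
qed

text \<open>Written in h + x, both sides are even, so the previous lemma applies to absolute values.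
  By the same symmetry equality holds at x = 0 and also at x = - 2 h, so the constant is
  optimal.\<close>

lemma psi_le_kearns_saul:
  fixes h x :: real
  assumes "h \<noteq> 0" shows "psi h x \<le> tanh h / h * x\<^sup>2 / 2"
proof -
  have *: "ln (cosh (h + x)) - ln (cosh h) \<le> tanh h / h * ((h + x)\<^sup>2 - h\<^sup>2) / 2"
  proof -
    have even: "cosh \<bar>z\<bar> = cosh z" "tanh \<bar>z\<bar> / \<bar>z\<bar> = tanh z / z" for z :: real
      by (auto simp: abs_if)
    show ?thesis using ln_cosh_quadratic[of "\<bar>h\<bar>" "\<bar>h + x\<bar>"] assms by (simp only: even power2_abs abs_ge_zero zero_less_abs_iff not_False_eq_True)
  qed
  have "tanh h / h * ((h + x)\<^sup>2 - h\<^sup>2) / 2 = tanh h / h * x\<^sup>2 / 2 + x * tanh h"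
    using assms by (simp add: field_simps power2_eq_square)
  then show ?thesis using * by (simp add: psi_def)
qed

lemma tanh_concave: "concave_on {0..} (tanh :: real \<Rightarrow> real)"
proof (rule f''_le0_imp_concave)
  fix x :: real
  show "(tanh has_real_derivative (1 - (tanh x)\<^sup>2)) (at x)"
    by (auto intro!: derivative_eq_intros)
  show "((\<lambda>x. 1 - (tanh x)\<^sup>2) has_real_derivative - (2 * tanh x * (1 - (tanh x)\<^sup>2))) (at x)"
    by (auto intro!: derivative_eq_intros)
  show "- (2 * tanh x * (1 - (tanh x)\<^sup>2)) \<le> 0" if "x \<in> {0..}"
    using that abs_tanh_le_1[of x] by (simp add: abs_square_le_1)
qed auto

text \<open>By concavity \<open>tanh\<close> lies above its chord on [h / 2, h] and below the
  extension of that chord beyond h. Hence for y >= h / 2 the chord slope \<open>s2\<close>, which is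
  smaller than tanh h / h, may serve as the quadratic constant.\<close>

lemma psi_gain_aux:
  fixes h :: real
  assumes "h > 0"
  obtains c where "c > 0"
    "\<And>y. y \<ge> 0 \<Longrightarrow> psi h (y - h) \<le> tanh h / h * (y - h)\<^sup>2 / 2 - c * (y - h)\<^sup>2"
proof -
  define t where "t = tanh h"
  define u where "u = tanh (h / 2)"
  define s where "s = t / h"
  define s2 where "s2 = (t - u) / (h / 2)"
  have "u / (h / 2) > s"
    using tanh_ratio_decreasing[of "h / 2" h 1 0] assms by (simp add: s_def u_def t_def)
  then have u: "u > t / 2" using assms by (simp add: s_def field_simps)
  have s: "s2 < s" using u assms by (simp add: s_def s2_def field_simps)
  have tu: "t - u = s2 * (h / 2)" using assms by (simp add: s2_def)
  have above: "tanh y \<ge> t + s2 * (y - h)" if "h / 2 \<le> y" "y \<le> h" for y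
  proof -
    define l where "l = (y - h / 2) / (h / 2)"
    have l: "0 \<le> l" "l \<le> 1" using that assms by (auto simp: l_def field_simps)
    have "y = (1 - l) * (h / 2) + l * h" using assms by (simp add: l_def field_simps)
    moreover have "tanh ((1 - l) *\<^sub>R (h / 2) + l *\<^sub>R h) \<ge> (1 - l) * tanh (h / 2) + l * tanh h"
      by (rule concave_onD[OF tanh_concave]) (use l assms in auto)
    ultimately have "tanh y \<ge> (1 - l) * u + l * t" by (simp add: u_def t_def)
    also have "(1 - l) * u + l * t = t - (1 - l) * (t - u)" by (simp add: algebra_simps)
    also have "(1 - l) * (t - u) = s2 * (h - y)"
      unfolding tu l_def using assms by (simp add: field_simps)
    finally show ?thesis by (simp add: algebra_simps)
  qed
  have below: "tanh y \<le> t + s2 * (y - h)" if "h \<le> y" for y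
  proof -
    define l where "l = (h / 2) / (y - h / 2)"
    have l: "0 < l" "l \<le> 1" using that assms by (auto simp: l_def field_simps)
    have "y - h / 2 \<noteq> 0" using assms that by simp
    then have "l * (y - h / 2) = h / 2" unfolding l_def by (metis nonzero_eq_divide_eq)
    then have "h = (1 - l) * (h / 2) + l * y" by (simp add: field_simps)
    moreover have "tanh ((1 - l) *\<^sub>R (h / 2) + l *\<^sub>R y) \<ge> (1 - l) * tanh (h / 2) + l * tanh y"
      by (rule concave_onD[OF tanh_concave]) (use l assms that in auto)
    ultimately have "t \<ge> (1 - l) * u + l * tanh y" by (simp add: u_def t_def)
    then have "l * (tanh y - u) \<le> t - u" by (simp add: algebra_simps)
    then have "tanh y - u \<le> (t - u) / l" using l by (simp add: field_simps)
    also have "(t - u) / l = s2 * (y - h / 2)"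
      unfolding tu l_def using assms that by (simp add: field_simps)
    finally show ?thesis using tu by (simp add: algebra_simps)
  qed
  have far: "psi h (y - h) \<le> s2 * (y - h)\<^sup>2 / 2" if "y \<ge> h / 2" for y
  proof -
    have "s2 * (h - h)\<^sup>2 / 2 - psi h (h - h) \<le> s2 * (y - h)\<^sup>2 / 2 - psi h (y - h)"
    proof (rule min_of_deriv_sign[where l = "h / 2" and c = h and f = "\<lambda>y. s2 * (y - h)\<^sup>2 / 2 - psi h (y - h)"
      and f' = "\<lambda>y. s2 * (y - h) - (tanh y - t)"])
      fix z :: real
      have "((\<lambda>y. psi h (y - h)) has_real_derivative tanh z - t) (at z)"
        unfolding psi_def t_def by (auto intro!: derivative_eq_intros)
      then show "((\<lambda>y. s2 * (y - h)\<^sup>2 / 2 - psi h (y - h)) has_real_derivative s2 * (z - h) - (tanh z - t)) (at z)"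
        by (auto intro!: derivative_eq_intros)
    qed (use above below that assms in force)+
    then show ?thesis by simp
  qed
  \<comment> \<open>For y < h / 2 the deficit \<open>?g\<close> is at least its value at h / 2,
    which is at least (s - s2) / 2 * (h / 2)^2 = (s - s2) / 8 * h^2, while (y - h)^2 is at most
    h^2.\<close>
  define c where "c = (s - s2) / 8"
  have c: "c > 0" using s by (simp add: c_def)
  show ?thesis
  proof (rule that[OF c], unfold t_def [symmetric] s_def [symmetric])
    fix y :: real assume y: "y \<ge> 0"
    show "psi h (y - h) \<le> s * (y - h)\<^sup>2 / 2 - c * (y - h)\<^sup>2"
    proof (cases "y \<ge> h / 2")
      case True
      have "s2 / 2 \<le> s / 2 - c" using s by (simp add: c_def diff_divide_distrib)
      then have "s2 / 2 * (y - h)\<^sup>2 \<le> (s / 2 - c) * (y - h)\<^sup>2" by (intro mult_right_mono) auto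
      with far[OF True] show ?thesis by (simp add: algebra_simps)
    next
      case False
      let ?g = "\<lambda>y. s * (y - h)\<^sup>2 / 2 - psi h (y - h)"
      have "?g (h / 2) \<le> ?g y"
      proof (rule DERIV_nonpos_imp_nonincreasing[where f = ?g])
        show "y \<le> h / 2" using False by simp
        fix z assume z: "y \<le> z" "z \<le> h / 2"
        have "((\<lambda>y. psi h (y - h)) has_real_derivative tanh z - t) (at z)"
          unfolding psi_def t_def by (auto intro!: derivative_eq_intros)
        then have g': "(?g has_real_derivative s * (z - h) - (tanh z - t)) (at z)"
          by (auto intro!: derivative_eq_intros)
        have "s * z \<le> tanh z"
        proof (cases "z = 0")
          case False
          then have "s \<le> tanh z / z" using z y assms unfolding s_def t_def
            by (intro tanh_ratio_antimono) auto
          then show ?thesis using False z y by (simp add: field_simps)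
        qed auto
        moreover have "s * h = t" using assms by (simp add: s_def)
        ultimately have "s * (z - h) - (tanh z - t) \<le> 0" by (simp add: algebra_simps)
        with g' show "\<exists>d. (?g has_real_derivative d) (at z) \<and> d \<le> 0" by blast
      qed
      moreover have "?g (h / 2) \<ge> (s - s2) / 2 * (h / 2)\<^sup>2"
        using far[of "h / 2"] by (simp add: field_simps power2_eq_square)
      moreover have "(s - s2) / 2 * (h / 2)\<^sup>2 \<ge> c * (y - h)\<^sup>2"
      proof -
        have "(y - h)\<^sup>2 \<le> h\<^sup>2" using y False assms by (intro iffD1[OF abs_le_square_iff]) auto
        then have "c * (y - h)\<^sup>2 \<le> c * h\<^sup>2" using c by (intro mult_left_mono) auto
        then show ?thesis by (simp add: c_def power2_eq_square)
      qed
      ultimately show ?thesis by simp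
    qed
  qed
qed

text \<open>The range must stay away from the second equality point x = - 2 h. If h + x is negative,
  it is reflected to \<open>?y\<close>, which lies in [0, h / 2].\<close>

lemma psi_gain:
  fixes h :: real
  assumes "h > 0"
  obtains c where "c > 0"
    "\<And>x. x \<ge> - (3 / 2) * h \<Longrightarrow> psi h x \<le> tanh h / h * x\<^sup>2 / 2 - c * x\<^sup>2"
proof -
  obtain c where c: "c > 0"
    "\<And>y. y \<ge> 0 \<Longrightarrow> psi h (y - h) \<le> tanh h / h * (y - h)\<^sup>2 / 2 - c * (y - h)\<^sup>2"
    using psi_gain_aux[OF assms] by blast
  show ?thesis
  proof (rule that[of "c / 9"])
    fix x assume x: "x \<ge> - (3 / 2) * h"
    let ?s = "tanh h / h"
    show "psi h x \<le> ?s * x\<^sup>2 / 2 - c / 9 * x\<^sup>2"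
    proof (cases "h + x \<ge> 0")
      case True
      then have "psi h x \<le> ?s * x\<^sup>2 / 2 - c * x\<^sup>2" using c(2)[of "h + x"] by simp
      moreover have "c / 9 * x\<^sup>2 \<le> c * x\<^sup>2" using c(1) by (intro mult_right_mono) auto
      ultimately show ?thesis by simp
    next
      case False
      let ?y = "- (h + x)"
      have 1: "psi h (?y - h) \<le> ?s * (?y - h)\<^sup>2 / 2 - c * (?y - h)\<^sup>2" using c(2)[of ?y] False by simp
      have 2: "psi h (?y - h) = psi h x - (?y - h - x) * tanh h"
      proof -
        have "cosh (h + (?y - h)) = cosh (h + x)" by (metis add.commute cosh_minus diff_add_cancel)
        then show ?thesis by (simp add: psi_def algebra_simps)
      qed
      have 3: "?s * (?y - h)\<^sup>2 / 2 = ?s * x\<^sup>2 / 2 - (?y - h - x) * tanh h"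
        using assms by (simp add: field_simps power2_eq_square)
      \<comment> \<open>The reflected shift has size 2 h + x >= h / 2, and |x| <= 3 h / 2; this
        ratio of 3 is the source of c / 9.\<close>
      have "(x / 3)\<^sup>2 \<le> (?y - h)\<^sup>2"
        using x False assms by (intro iffD1[OF abs_le_square_iff]) auto
      then have "c * (x / 3)\<^sup>2 \<le> c * (?y - h)\<^sup>2" using c by (intro mult_left_mono) auto
      then have "c / 9 * x\<^sup>2 \<le> c * (?y - h)\<^sup>2" by (simp add: power_divide)
      with 1 2 3 show ?thesis by linarith
    qed
  qed (use c in auto)
qed

text \<open>Meant for a uniform tilt b perturbed by a fluctuation w: the gain in b survives at the
  price of a worse constant in w. The margin between 5/4 and 3/2 is essential: if b + w leaves the
  range of \<open>psi_gain\<close>, then |w| > h / 4 and |b| <= 5 |w|, so 25 c w^2 pays for the lost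
  gain.\<close>

lemma psi_shift_gain:
  fixes h :: real
  assumes "h > 0"
  obtains c0 where "c0 > 0"
    "\<And>c b w. 0 < c \<Longrightarrow> c \<le> c0 \<Longrightarrow> b \<ge> - (5 / 4) * h \<Longrightarrow>
      psi h (b + w) \<le> tanh h / h * (b + w)\<^sup>2 / 2 - c * b\<^sup>2 + 25 * c * w\<^sup>2"
proof -
  let ?s = "tanh h / h"
  obtain c1 where c1: "c1 > 0"
    "\<And>x. x \<ge> - (3 / 2) * h \<Longrightarrow> psi h x \<le> ?s * x\<^sup>2 / 2 - c1 * x\<^sup>2"
    using psi_gain[OF assms] by blast
  show ?thesis
  proof (rule that[of "c1 / 2"])
    fix c b w :: real assume c: "0 < c" "c \<le> c1 / 2" and b: "b \<ge> - (5 / 4) * h"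
    show "psi h (b + w) \<le> ?s * (b + w)\<^sup>2 / 2 - c * b\<^sup>2 + 25 * c * w\<^sup>2"
    proof (cases "b + w \<ge> - (3 / 2) * h")
      case True
      have "0 \<le> (b + 2 * w)\<^sup>2" by simp
      then have sq: "2 * (b + w)\<^sup>2 \<ge> b\<^sup>2 - 2 * w\<^sup>2" by (simp add: power2_eq_square algebra_simps)
      have "c * (b\<^sup>2 - 2 * w\<^sup>2) \<le> c * (2 * (b + w)\<^sup>2)" using sq c by (intro mult_left_mono) auto
      also have "\<dots> \<le> c1 * (b + w)\<^sup>2"
        using mult_right_mono[of "2 * c" c1 "(b + w)\<^sup>2"] c by simp
      finally have "c * b\<^sup>2 - 2 * (c * w\<^sup>2) \<le> c1 * (b + w)\<^sup>2" by (simp add: algebra_simps)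
      moreover have "0 \<le> c * w\<^sup>2" using c by simp
      ultimately show ?thesis using c1(2)[OF True] by linarith
    next
      case False
      have "\<bar>b\<bar> \<le> \<bar>5 * w\<bar>" using False b assms by linarith
      then have "b\<^sup>2 \<le> (5 * w)\<^sup>2" by (rule iffD1[OF abs_le_square_iff])
      then have "c * b\<^sup>2 \<le> c * (25 * w\<^sup>2)" using c by (intro mult_left_mono) (auto simp: power_mult_distrib)
      moreover have "psi h (b + w) \<le> ?s * (b + w)\<^sup>2 / 2" using psi_le_kearns_saul assms by simp
      ultimately show ?thesis by simp
    qed
  qed (use c1 in auto)
qed

section \<open>Polynomial bounds near zero field\<close>

lemma tanh_ge_cubic: "0 \<le> (x::real) \<Longrightarrow> tanh x \<ge> x - x ^ 3 / 3"
proof -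
  assume x: "0 \<le> x"
  have "tanh 0 - (0 - 0 ^ 3 / 3) \<le> tanh x - (x - x ^ 3 / 3)"
  proof (rule DERIV_nonneg_imp_nondecreasing[OF x])
    fix y :: real assume y: "0 \<le> y" "y \<le> x"
    have "((\<lambda>x. tanh x - (x - x ^ 3 / 3)) has_real_derivative y\<^sup>2 - (tanh y)\<^sup>2) (at y)"
      by (auto intro!: derivative_eq_intros simp: power2_eq_square)
    moreover have "(tanh y)\<^sup>2 \<le> y\<^sup>2"
      using tanh_lipschitz[of y 0] by (intro iffD1[OF abs_le_square_iff]) simp
    then have "0 \<le> y\<^sup>2 - (tanh y)\<^sup>2" by simp
    ultimately show "\<exists>d. ((\<lambda>x. tanh x - (x - x ^ 3 / 3)) has_real_derivative d) (at y) \<and> 0 \<le> d"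
      by blast
  qed
  then show ?thesis by simp
qed

text \<open>Successive integration on [0, 1]: tanh z >= z / 2 gives 1 - tanh^2 z <= 1 - z^2 / 4,
  hence tanh z <= z - z^3 / 12, hence the bound with 48 = 4 * 12. Evenness covers negative
  arguments.\<close>

lemma ln_cosh_quartic:
  fixes x :: real assumes "\<bar>x\<bar> \<le> 1"
  shows "ln (cosh x) \<le> x\<^sup>2 / 2 - x ^ 4 / 48"
proof -
  have tanh_half: "tanh z \<ge> z / 2" if z: "0 \<le> z" "z \<le> 1" for z :: real
  proof -
    have "z ^ 3 \<le> z" using z power_decreasing[of 1 3 z] by simp
    then show ?thesis using tanh_ge_cubic[OF z(1)] z by linarith
  qed
  have tanh_le: "tanh z \<le> z - z ^ 3 / 12" if z: "0 \<le> z" "z \<le> 1" for z :: real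
  proof -
    have "0 - 0 ^ 3 / 12 - tanh 0 \<le> z - z ^ 3 / 12 - tanh z"
    proof (rule DERIV_nonneg_imp_nondecreasing[OF z(1)])
      fix y :: real assume y: "0 \<le> y" "y \<le> z"
      have "((\<lambda>x. x - x ^ 3 / 12 - tanh x) has_real_derivative (tanh y)\<^sup>2 - y\<^sup>2 / 4) (at y)"
        by (auto intro!: derivative_eq_intros simp: power2_eq_square)
      moreover have "(y / 2)\<^sup>2 \<le> (tanh y)\<^sup>2"
        using tanh_half[of y] y z by (intro power_mono) auto
      then have "0 \<le> (tanh y)\<^sup>2 - y\<^sup>2 / 4" by (simp add: power_divide)
      ultimately show "\<exists>d. ((\<lambda>x. x - x ^ 3 / 12 - tanh x) has_real_derivative d) (at y) \<and> 0 \<le> d"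
        by blast
    qed
    then show ?thesis by simp
  qed
  have main: "ln (cosh z) \<le> z\<^sup>2 / 2 - z ^ 4 / 48" if z: "0 \<le> z" "z \<le> 1" for z :: real
  proof -
    have "0\<^sup>2 / 2 - 0 ^ 4 / 48 - ln (cosh 0) \<le> z\<^sup>2 / 2 - z ^ 4 / 48 - ln (cosh z)"
    proof (rule DERIV_nonneg_imp_nondecreasing[OF z(1)])
      fix y :: real assume y: "0 \<le> y" "y \<le> z"
      have "((\<lambda>x. x\<^sup>2 / 2 - x ^ 4 / 48 - ln (cosh x)) has_real_derivative y - y ^ 3 / 12 - tanh y) (at y)"
        by (auto intro!: derivative_eq_intros)
      moreover have "0 \<le> y - y ^ 3 / 12 - tanh y" using tanh_le[of y] y z by simp
      ultimately show "\<exists>d. ((\<lambda>x. x\<^sup>2 / 2 - x ^ 4 / 48 - ln (cosh x)) has_real_derivative d) (at y) \<and> 0 \<le> d"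
        by blast
    qed
    then show ?thesis by simp
  qed
  show ?thesis using main[of "\<bar>x\<bar>"] assms by (simp add: abs_if split: if_splits)
qed

section \<open>Product measures on spins\<close>

definition mult_mv :: "nat \<Rightarrow> (nat \<Rightarrow> nat \<Rightarrow> real) \<Rightarrow> (nat \<Rightarrow> real) \<Rightarrow> nat \<Rightarrow> real" where
  "mult_mv N Q y i = (\<Sum>j<N. Q i j * y j)"

definition quad :: "nat \<Rightarrow> (nat \<Rightarrow> nat \<Rightarrow> real) \<Rightarrow> (nat \<Rightarrow> real) \<Rightarrow> real" where
  "quad N Q y = (\<Sum>i<N. y i * mult_mv N Q y i)"

definition frob :: "nat \<Rightarrow> (nat \<Rightarrow> nat \<Rightarrow> real) \<Rightarrow> real" where
  "frob N Q = (\<Sum>i<N. \<Sum>j<N. (Q i j)\<^sup>2)"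

definition sym_on :: "nat \<Rightarrow> (nat \<Rightarrow> nat \<Rightarrow> real) \<Rightarrow> bool" where
  "sym_on N Q \<longleftrightarrow> (\<forall>i<N. \<forall>j<N. Q i j = Q j i)"

lemma frob_nonneg: "0 \<le> frob N Q"
  by (simp add: frob_def sum_nonneg)

lemma mult_mv_adjoint:
  assumes "sym_on N Q"
  shows "(\<Sum>i<N. x i * mult_mv N Q y i) = (\<Sum>i<N. mult_mv N Q x i * y i)"
proof -
  have "(\<Sum>i<N. x i * mult_mv N Q y i) = (\<Sum>i<N. \<Sum>j<N. x i * (Q i j * y j))"
    by (simp add: mult_mv_def sum_distrib_left)
  also have "\<dots> = (\<Sum>j<N. \<Sum>i<N. x i * (Q i j * y j))" by (rule sum.swap)
  also have "\<dots> = (\<Sum>j<N. \<Sum>i<N. Q j i * x i * y j)"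
    using assms by (intro sum.cong refl) (auto simp: sym_on_def)
  finally show ?thesis by (simp add: mult_mv_def sum_distrib_right)
qed

lemma mult_mv_upd:
  assumes "i < N"
  shows "mult_mv N Q (y(i := x)) k = mult_mv N Q y k + (x - y i) * Q k i"
proof -
  have "mult_mv N Q (y(i := x)) k = (\<Sum>j<N. Q k j * y j + (if j = i then Q k i * (x - y i) else 0))"
    unfolding mult_mv_def by (intro sum.cong refl) (auto simp: algebra_simps)
  also have "\<dots> = mult_mv N Q y k + (x - y i) * Q k i"
    using assms by (simp add: sum.distrib mult_mv_def)
  finally show ?thesis .
qed

text \<open>With zero diagonal the form is affine in each coordinate, its slope being twice the
  local field. For this reason the diagonal is split off before integrating by parts over single
  spins.\<close>

lemma quad_upd:
  assumes "i < N" "sym_on N Q" "Q i i = 0"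
  shows "quad N Q (y(i := x)) = quad N Q y + 2 * (x - y i) * mult_mv N Q y i"
proof -
  have "quad N Q (y(i := x)) = (\<Sum>k<N. (y(i := x)) k * mult_mv N Q y k + (x - y i) * (Q k i * (y(i := x)) k))"
    unfolding quad_def mult_mv_upd[OF assms(1)] by (simp add: algebra_simps)
  also have "\<dots> = (\<Sum>k<N. y k * mult_mv N Q y k + (if k = i then (x - y i) * mult_mv N Q y i else 0)
      + (x - y i) * (Q i k * y k))"
    using assms by (intro sum.cong refl) (auto simp: algebra_simps sym_on_def)
  also have "\<dots> = quad N Q y + (x - y i) * mult_mv N Q y i + (x - y i) * mult_mv N Q y i"
    using assms(1) by (simp add: sum.distrib quad_def mult_mv_def sum_distrib_left)
  finally show ?thesis by simp
qed

section \<open>Expectation of independent spins in a field \<open>h\<close>\<close>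

definition spins :: "nat \<Rightarrow> (nat \<Rightarrow> real) set" where
  "spins N = {..<N} \<rightarrow>\<^sub>E {-1, 1}"

definition spin_expect :: "real \<Rightarrow> nat \<Rightarrow> ((nat \<Rightarrow> real) \<Rightarrow> real) \<Rightarrow> real" where
  "spin_expect h N f = (\<Sum>\<sigma>\<in>spins N. (\<Prod>i<N. exp (h * \<sigma> i) / (2 * cosh h)) * f \<sigma>)"

lemma finite_spins [simp]: "finite (spins N)"
  unfolding spins_def by (rule finite_PiE) auto

lemma spins_cases: "\<sigma> \<in> spins N \<Longrightarrow> i < N \<Longrightarrow> \<sigma> i = -1 \<or> \<sigma> i = 1"
  by (auto simp: spins_def PiE_iff)

lemma spins_abs: "\<sigma> \<in> spins N \<Longrightarrow> i < N \<Longrightarrow> \<bar>\<sigma> i\<bar> = 1"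
  using spins_cases by fastforce

lemma spin_weight_pos: "0 < (\<Prod>i<N. exp (h * \<sigma> i) / (2 * cosh h :: real))"
  by (intro prod_pos) (auto simp: cosh_real_pos)

lemma spin_expect_mono:
  "(\<And>\<sigma>. \<sigma> \<in> spins N \<Longrightarrow> f \<sigma> \<le> g \<sigma>) \<Longrightarrow> spin_expect h N f \<le> spin_expect h N g"
  unfolding spin_expect_def
  by (intro sum_mono mult_left_mono less_imp_le[OF spin_weight_pos])

lemma spin_expect_add: "spin_expect h N (\<lambda>\<sigma>. f \<sigma> + g \<sigma>) = spin_expect h N f + spin_expect h N g"
  by (simp add: spin_expect_def algebra_simps sum.distrib)

lemma spin_expect_cmult: "spin_expect h N (\<lambda>\<sigma>. c * f \<sigma>) = c * spin_expect h N f"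
  by (simp add: spin_expect_def algebra_simps sum_distrib_left)

lemma spin_expect_sum: "spin_expect h N (\<lambda>\<sigma>. \<Sum>k\<in>K. f k \<sigma>) = (\<Sum>k\<in>K. spin_expect h N (f k))"
  by (simp add: spin_expect_def sum_distrib_left sum.swap[of _ K])

lemma spin_sum_prod:
  "(\<Sum>\<sigma>\<in>spins N. \<Prod>i<N. f i (\<sigma> i)) = (\<Prod>i<N. f i (-1) + f i (1::real) :: real)"
proof -
  have "(\<Prod>i<N. \<Sum>x\<in>{-1, 1::real}. f i x) = (\<Sum>\<sigma>\<in>spins N. \<Prod>i<N. f i (\<sigma> i))"
    unfolding spins_def by (rule prod_sum_PiE) auto
  then show ?thesis by simp
qed

lemma exp_psi: "exp (psi h w) = cosh (h + w) / cosh h * exp (- w * tanh h)"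
  by (simp add: psi_def exp_diff exp_minus cosh_real_pos divide_inverse)

lemma spin_expect_exp_linear:
  "spin_expect h N (\<lambda>\<sigma>. exp (\<Sum>i<N. w i * (\<sigma> i - tanh h))) = exp (\<Sum>i<N. psi h (w i))"
proof -
  let ?f = "\<lambda>i x. exp (h * x) / (2 * cosh h) * exp (w i * (x - tanh h))"
  have "spin_expect h N (\<lambda>\<sigma>. exp (\<Sum>i<N. w i * (\<sigma> i - tanh h))) = (\<Sum>\<sigma>\<in>spins N. \<Prod>i<N. ?f i (\<sigma> i))"
    by (simp only: spin_expect_def exp_sum finite_lessThan prod.distrib)
  also have "\<dots> = (\<Prod>i<N. ?f i (-1) + ?f i 1)" by (rule spin_sum_prod)
  also have "\<dots> = (\<Prod>i<N. exp (psi h (w i)))"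
  proof (rule prod.cong[OF refl])
    fix i
    have e: "exp (h * -1) * exp (w i * (-1 - tanh h)) = exp (- (h + w i)) * exp (- w i * tanh h)"
      "exp (h * 1) * exp (w i * (1 - tanh h)) = exp (h + w i) * exp (- w i * tanh h)"
      by (simp_all add: exp_add [symmetric] algebra_simps)
    have "?f i (-1) + ?f i 1 = (exp (- (h + w i)) + exp (h + w i)) * exp (- w i * tanh h) / (2 * cosh h)"
      unfolding times_divide_eq_left e by (simp add: add_divide_distrib algebra_simps)
    also have "exp (- (h + w i)) + exp (h + w i) = 2 * cosh (h + w i)"
      by (simp add: cosh_def)
    finally show "?f i (-1) + ?f i 1 = exp (psi h (w i))"
      by (simp add: exp_psi)
  qed
  finally show ?thesis by (simp add: exp_sum)
qed

lemma spin_expect_one [simp]: "spin_expect h N (\<lambda>_. 1) = 1"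
  using spin_expect_exp_linear[of h N "\<lambda>_. 0"] by simp

lemma spin_expect_const [simp]: "spin_expect h N (\<lambda>_. c) = c"
  using spin_expect_cmult[of h N c "\<lambda>_. 1"] by simp

text \<open>Change of measure that removes a magnetisation term from the exponent. The tilted
  measure is again a product measure, so all bounds that are uniform in the field can be
  reused.\<close>

lemma spin_expect_tilt:
  "spin_expect h N (\<lambda>\<sigma>. exp (b * (\<Sum>i<N. \<sigma> i - tanh h)) * f \<sigma>)
    = exp (real N * psi h b) * spin_expect (h + b) N f"
proof -
  have "(\<Prod>i<N. exp (h * \<sigma> i) / (2 * cosh h)) * exp (b * (\<Sum>i<N. \<sigma> i - tanh h))
      = exp (real N * psi h b) * (\<Prod>i<N. exp ((h + b) * \<sigma> i) / (2 * cosh (h + b)))" for \<sigma>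
  proof -
    have "(\<Prod>i<N. exp (h * \<sigma> i) / (2 * cosh h)) * exp (b * (\<Sum>i<N. \<sigma> i - tanh h))
      = (\<Prod>i<N. exp (h * \<sigma> i) / (2 * cosh h) * exp (b * (\<sigma> i - tanh h)))"
      by (simp only: sum_distrib_left exp_sum finite_lessThan prod.distrib)
    also have "\<dots> = (\<Prod>i<N. exp (psi h b) * (exp ((h + b) * \<sigma> i) / (2 * cosh (h + b))))"
    proof (rule prod.cong[OF refl])
      fix i
      have "exp (b * (\<sigma> i - tanh h)) = exp (b * \<sigma> i) * exp (- b * tanh h)"
        "exp ((h + b) * \<sigma> i) = exp (h * \<sigma> i) * exp (b * \<sigma> i)"
        by (simp_all add: exp_add [symmetric] algebra_simps)
      then show "exp (h * \<sigma> i) / (2 * cosh h) * exp (b * (\<sigma> i - tanh h))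
          = exp (psi h b) * (exp ((h + b) * \<sigma> i) / (2 * cosh (h + b)))"
        by (simp add: exp_psi mult_ac)
    qed
    also have "\<dots> = exp (real N * psi h b) * (\<Prod>i<N. exp ((h + b) * \<sigma> i) / (2 * cosh (h + b)))"
      by (simp only: prod.distrib prod_constant exp_of_nat_mult card_lessThan)
    finally show ?thesis .
  qed
  then show ?thesis
    by (simp add: spin_expect_def sum_distrib_left mult.assoc [symmetric])
qed

lemma spin_expect_exp_linear_le:
  "spin_expect h N (\<lambda>\<sigma>. exp (\<Sum>i<N. w i * (\<sigma> i - tanh h))) \<le> exp ((\<Sum>i<N. (w i)\<^sup>2) / 2)"
  unfolding spin_expect_exp_linear
  by (auto simp: sum_divide_distrib intro!: sum_mono psi_le_square)

text \<open>Convexity of \<open>exp\<close>, applied to X - a and Y - b, whose exponentials have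
  expectation at most 1.\<close>

lemma spin_expect_holder:
  assumes "0 \<le> \<alpha>" "\<alpha> \<le> 1"
    and X: "spin_expect h N (\<lambda>\<sigma>. exp (X \<sigma>)) \<le> exp a"
    and Y: "spin_expect h N (\<lambda>\<sigma>. exp (Y \<sigma>)) \<le> exp b"
  shows "spin_expect h N (\<lambda>\<sigma>. exp (\<alpha> * X \<sigma> + (1 - \<alpha>) * Y \<sigma>)) \<le> exp (\<alpha> * a + (1 - \<alpha>) * b)"
proof -
  let ?c = "exp (\<alpha> * a + (1 - \<alpha>) * b)"
  have pt: "exp (\<alpha> * X \<sigma> + (1 - \<alpha>) * Y \<sigma>)
      \<le> ?c * (\<alpha> * exp (- a) * exp (X \<sigma>) + (1 - \<alpha>) * exp (- b) * exp (Y \<sigma>))" for \<sigma>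
  proof -
    have "exp ((1 - (1 - \<alpha>)) *\<^sub>R (X \<sigma> - a) + (1 - \<alpha>) *\<^sub>R (Y \<sigma> - b))
        \<le> (1 - (1 - \<alpha>)) * exp (X \<sigma> - a) + (1 - \<alpha>) * exp (Y \<sigma> - b)"
      by (rule convex_onD[OF exp_convex]) (use assms in auto)
    then have "?c * exp (\<alpha> * (X \<sigma> - a) + (1 - \<alpha>) * (Y \<sigma> - b))
        \<le> ?c * (\<alpha> * exp (X \<sigma> - a) + (1 - \<alpha>) * exp (Y \<sigma> - b))"
      by simp
    also have "?c * exp (\<alpha> * (X \<sigma> - a) + (1 - \<alpha>) * (Y \<sigma> - b)) = exp (\<alpha> * X \<sigma> + (1 - \<alpha>) * Y \<sigma>)"
      by (simp add: exp_add [symmetric] algebra_simps)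
    finally show ?thesis by (simp add: exp_diff exp_minus divide_inverse mult_ac)
  qed
  have "spin_expect h N (\<lambda>\<sigma>. exp (\<alpha> * X \<sigma> + (1 - \<alpha>) * Y \<sigma>)) \<le> spin_expect h N (\<lambda>\<sigma>.
      ?c * (\<alpha> * exp (- a) * exp (X \<sigma>) + (1 - \<alpha>) * exp (- b) * exp (Y \<sigma>)))"
    by (rule spin_expect_mono) (rule pt)
  also have "\<dots> = ?c * (\<alpha> * exp (- a) * spin_expect h N (\<lambda>\<sigma>. exp (X \<sigma>))
        + (1 - \<alpha>) * exp (- b) * spin_expect h N (\<lambda>\<sigma>. exp (Y \<sigma>)))"
    by (simp only: spin_expect_cmult spin_expect_add)
  also have "\<dots> \<le> ?c * (\<alpha> * exp (- a) * exp a + (1 - \<alpha>) * exp (- b) * exp b)"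
    using assms by (intro mult_left_mono add_mono) auto
  also have "\<dots> = ?c" by (simp add: mult.assoc exp_add [symmetric])
  finally show ?thesis .
qed

section \<open>High temperature\<close>

lemma spin_flip_sum:
  assumes "i < N"
  shows "(\<Sum>\<sigma>\<in>spins N. F \<sigma>) = (\<Sum>\<sigma>\<in>spins N. F (\<sigma>(i := - \<sigma> i)))"
proof (rule sum.reindex_bij_witness[where i = "\<lambda>\<sigma>. \<sigma>(i := - \<sigma> i)" and j = "\<lambda>\<sigma>. \<sigma>(i := - \<sigma> i)"])
  fix \<sigma> assume s: "\<sigma> \<in> spins N"
  have "- \<sigma> i \<in> {-1, 1}" using spins_cases[OF s assms] by auto
  then show "\<sigma>(i := - \<sigma> i) \<in> spins N"
    using s assms by (auto simp: spins_def PiE_iff extensional_def)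
qed (auto simp: spins_def PiE_iff extensional_def assms)

text \<open>Integration by parts: \<open>tanh (q \<sigma>)\<close> is the conditional mean of \<open>\<sigma> i\<close> given the other spins.\<close>

lemma spin_stein:
  assumes i: "i < N"
    and V: "\<And>\<sigma>. \<sigma> \<in> spins N \<Longrightarrow> V (\<sigma>(i := - \<sigma> i)) = V \<sigma> - 2 * \<sigma> i * q \<sigma>"
    and q: "\<And>\<sigma>. \<sigma> \<in> spins N \<Longrightarrow> q (\<sigma>(i := - \<sigma> i)) = q \<sigma>"
    and g: "\<And>\<sigma>. \<sigma> \<in> spins N \<Longrightarrow> g (\<sigma>(i := - \<sigma> i)) = g \<sigma>"
  shows "(\<Sum>\<sigma>\<in>spins N. exp (V \<sigma>) * ((\<sigma> i - tanh (q \<sigma>)) * g \<sigma>)) = (0::real)"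
proof -
  let ?F = "\<lambda>\<sigma>. exp (V \<sigma>) * ((\<sigma> i - tanh (q \<sigma>)) * g \<sigma>)"
  \<comment> \<open>The contributions of a configuration and of its flip cancel: this is exp z (1 -
    tanh z) = exp (- z) (1 + tanh z) at the local field z.\<close>
  have "?F \<sigma> + ?F (\<sigma>(i := - \<sigma> i)) = 0" if s: "\<sigma> \<in> spins N" for \<sigma>
  proof -
    have e: "exp x * (1 - tanh x) = exp (- x) * (1 + tanh x)" for x :: real
    proof -
      have "exp x * (1 - tanh x) * cosh x = exp (- x) * (1 + tanh x) * cosh x"
      proof -
        have "(1 - tanh x) * cosh x = exp (- x)" "(1 + tanh x) * cosh x = exp x"
          by (simp_all add: tanh_def algebra_simps cosh_minus_sinh cosh_plus_sinh sinh_plus_cosh)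
        then show ?thesis by (simp add: mult.assoc exp_add [symmetric])
      qed
      then show ?thesis using cosh_real_pos[of x] by simp
    qed
    have *: "exp y * (x - tanh z) + exp (y - 2 * x * z) * (- x - tanh z) = 0"
      if "x = -1 \<or> x = 1" for x y z :: real
    proof -
      have "exp (y - x * z) * (exp (x * z) * (x - tanh z) + exp (- (x * z)) * (- x - tanh z)) = 0"
      proof -
        have "exp (x * z) * (x - tanh z) + exp (- (x * z)) * (- x - tanh z) = 0"
          using that
        proof
          assume "x = -1" then show ?thesis using e[of z] by (simp add: algebra_simps)
        next
          assume "x = 1" then show ?thesis using e[of z] by (simp add: algebra_simps)
        qed
        then show ?thesis by simp
      qed
      moreover have "exp (y - x * z) * exp (x * z) = exp y"
        "exp (y - x * z) * exp (- (x * z)) = exp (y - 2 * x * z)"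
        by (simp_all add: exp_add [symmetric])
      ultimately show ?thesis by (simp add: distrib_left mult.assoc [symmetric])
    qed
    show ?thesis using *[OF spins_cases[OF s i], of "V \<sigma>" "q \<sigma>"]
      unfolding V[OF s] q[OF s] g[OF s] fun_upd_same mult.assoc [symmetric] distrib_right [symmetric]
      by simp
  qed
  then have "(\<Sum>\<sigma>\<in>spins N. ?F \<sigma> + ?F (\<sigma>(i := - \<sigma> i))) = 0" by simp
  then show ?thesis using spin_flip_sum[OF i, of ?F] by (simp only: sum.distrib)
qed

lemma exp_spin_weight:
  "(\<Prod>i<N. exp (h * \<sigma> i) / (2 * cosh h)) = exp (h * (\<Sum>i<N. \<sigma> i)) / (2 * cosh h :: real) ^ N"
proof -
  have "(\<Prod>i<N. exp (h * \<sigma> i) / (2 * cosh h)) = (\<Prod>i<N. exp (h * \<sigma> i)) / (\<Prod>i<N. 2 * cosh h)"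
    by (rule prod_dividef)
  then show ?thesis by (simp only: prod_constant card_lessThan sum_distrib_left exp_sum finite_lessThan)
qed

section \<open>The Gibbs measure at interpolation parameter \<open>s\<close>, for a form of operator
  norm at most 1/2\<close>

context
  fixes N :: nat and Q :: "nat \<Rightarrow> nat \<Rightarrow> real" and h s :: real
  assumes Q: "sym_on N Q" "\<And>i. i < N \<Longrightarrow> Q i i = 0"
    and small: "\<And>y. (\<Sum>i<N. (mult_mv N Q y i)\<^sup>2) \<le> (\<Sum>i<N. (y i)\<^sup>2) / 4"
    and s: "0 \<le> s" "s \<le> 1"
begin

abbreviation ctr :: "(nat \<Rightarrow> real) \<Rightarrow> nat \<Rightarrow> real" where
  "ctr \<sigma> \<equiv> \<lambda>i. \<sigma> i - tanh h"

abbreviation energy :: "(nat \<Rightarrow> real) \<Rightarrow> real" where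
  "energy \<sigma> \<equiv> h * (\<Sum>i<N. \<sigma> i) + s * (quad N Q (ctr \<sigma>) / 2)"

lemma ctr_flip: "ctr (\<sigma>(i := x)) = (ctr \<sigma>)(i := x - tanh h)"
  by auto

lemma energy_flip:
  assumes "i < N"
  shows "energy (\<sigma>(i := - \<sigma> i)) = energy \<sigma> - 2 * \<sigma> i * (h + s * mult_mv N Q (ctr \<sigma>) i)"
proof -
  have "(\<Sum>k<N. (\<sigma>(i := - \<sigma> i)) k) = (\<Sum>k<N. \<sigma> k + (if k = i then - 2 * \<sigma> i else 0))"
    by (intro sum.cong) auto
  also have "\<dots> = (\<Sum>k<N. \<sigma> k) - 2 * \<sigma> i" using assms by (simp add: sum.distrib)
  finally have flip: "(\<Sum>k<N. (\<sigma>(i := - \<sigma> i)) k) = (\<Sum>k<N. \<sigma> k) - 2 * \<sigma> i" .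
  show ?thesis
    unfolding flip ctr_flip quad_upd[OF assms Q(1) Q(2)[OF assms]] by (simp add: field_simps)
qed

lemma field_flip:
  assumes "i < N"
  shows "mult_mv N Q (ctr (\<sigma>(i := - \<sigma> i))) i = mult_mv N Q (ctr \<sigma>) i"
  unfolding ctr_flip mult_mv_upd[OF assms] by (simp add: Q(2)[OF assms])

lemma stein_sum:
  assumes "\<And>i \<sigma>. i < N \<Longrightarrow> \<sigma> \<in> spins N \<Longrightarrow> G i (\<sigma>(i := - \<sigma> i)) = G i \<sigma>"
  shows "(\<Sum>\<sigma>\<in>spins N. exp (energy \<sigma>) * (\<Sum>i<N. ctr \<sigma> i * G i \<sigma>))
    = (\<Sum>\<sigma>\<in>spins N. exp (energy \<sigma>) *
        (\<Sum>i<N. (tanh (h + s * mult_mv N Q (ctr \<sigma>) i) - tanh h) * G i \<sigma>))"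
proof -
  have "(\<Sum>\<sigma>\<in>spins N. exp (energy \<sigma>) * ((\<sigma> i - tanh (h + s * mult_mv N Q (ctr \<sigma>) i)) * G i \<sigma>)) = 0"
    if i: "i < N" for i
    using i by (intro spin_stein) (simp_all only: energy_flip field_flip assms)
  then have "(\<Sum>i<N. \<Sum>\<sigma>\<in>spins N.
      exp (energy \<sigma>) * ((\<sigma> i - tanh (h + s * mult_mv N Q (ctr \<sigma>) i)) * G i \<sigma>)) = 0"
    by simp
  then have "(\<Sum>\<sigma>\<in>spins N. \<Sum>i<N.
      exp (energy \<sigma>) * ((\<sigma> i - tanh (h + s * mult_mv N Q (ctr \<sigma>) i)) * G i \<sigma>)) = 0"
    by (subst sum.swap)
  moreover have "(\<Sum>i<N. exp (energy \<sigma>) * ((\<sigma> i - tanh (h + s * mult_mv N Q (ctr \<sigma>) i)) * G i \<sigma>))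
      = exp (energy \<sigma>) * (\<Sum>i<N. ctr \<sigma> i * G i \<sigma>)
        - exp (energy \<sigma>) * (\<Sum>i<N. (tanh (h + s * mult_mv N Q (ctr \<sigma>) i) - tanh h) * G i \<sigma>)" for \<sigma>
    by (simp add: sum_distrib_left right_diff_distrib left_diff_distrib sum_subtractf)
  ultimately show ?thesis by (simp add: sum_subtractf)
qed

lemma sum_weight_add:
  "(\<Sum>x\<in>X. w x * (f x + c)) = (\<Sum>x\<in>X. w x * f x) + c * (\<Sum>x\<in>X. w x :: real)"
  by (simp add: distrib_left sum.distrib sum_distrib_left mult.commute)

lemma mult_le_abs_mult: "\<bar>x\<bar> \<le> \<bar>y\<bar> \<Longrightarrow> x * z \<le> \<bar>y\<bar> * \<bar>z :: real\<bar>"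
  by (rule order_trans[OF abs_ge_self]) (simp add: abs_mult mult_right_mono)

lemma tanh_field_le: "\<bar>tanh (h + s * z) - tanh h\<bar> \<le> \<bar>z\<bar>"
proof -
  have "\<bar>tanh (h + s * z) - tanh h\<bar> \<le> \<bar>s * z\<bar>" using tanh_lipschitz[of "h + s * z" h] by simp
  also have "\<dots> \<le> \<bar>z\<bar>" using s mult_right_mono[of s 1 "\<bar>z\<bar>"] by (simp add: abs_mult)
  finally show ?thesis .
qed

text \<open>For Y = \<open>ctr \<sigma>\<close> one has |Q Y|^2 = Y . Q^2 Y. Off its diagonal, Q^2 Y
  can be integrated by parts, which replaces Y_i by a quantity of size at most |(Q Y)_i|; as Q has
  norm at most 1/2, the outcome is at most half the left-hand side and is absorbed. The diagonal of
  Q^2 contributes its trace, the squared Frobenius norm.\<close>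

lemma local_field_second_moment:
  "(\<Sum>\<sigma>\<in>spins N. exp (energy \<sigma>) * (\<Sum>i<N. (mult_mv N Q (ctr \<sigma>) i)\<^sup>2))
    \<le> 16 * frob N Q * (\<Sum>\<sigma>\<in>spins N. exp (energy \<sigma>))"
proof -
  define K where "K i = (\<Sum>k<N. (Q i k)\<^sup>2)" for i
  define z where "z \<sigma> = mult_mv N Q (ctr \<sigma>)" for \<sigma>
  \<comment> \<open>\<open>K i\<close> is the i-th diagonal entry of Q^2. Subtracting
    \<open>K i * ctr \<sigma> i\<close> removes the self-interaction, so that \<open>G i\<close>
    does not depend on the i-th spin.\<close>
  define G where "G i \<sigma> = mult_mv N Q (z \<sigma>) i - K i * ctr \<sigma> i" for i \<sigma>
  have K: "0 \<le> K i" "(\<Sum>i<N. K i) = frob N Q" for i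
    by (auto simp: K_def frob_def sum_nonneg)
  have Gflip: "G i (\<sigma>(i := - \<sigma> i)) = G i \<sigma>" if i: "i < N" for i \<sigma>
  proof -
    have zk: "z (\<sigma>(i := - \<sigma> i)) k = z \<sigma> k + (- 2 * \<sigma> i) * Q k i" for k
      unfolding z_def ctr_flip mult_mv_upd[OF i] by simp
    have "mult_mv N Q (z (\<sigma>(i := - \<sigma> i))) i
        = (\<Sum>k<N. Q i k * z \<sigma> k + (- 2 * \<sigma> i) * (Q i k)\<^sup>2)"
      unfolding mult_mv_def zk
    proof (intro sum.cong refl)
      fix k assume "k \<in> {..<N}"
      then have "Q k i = Q i k" using Q(1) i by (simp add: sym_on_def)
      then show "Q i k * (z \<sigma> k + (- 2 * \<sigma> i) * Q k i) = Q i k * z \<sigma> k + - 2 * \<sigma> i * (Q i k)\<^sup>2"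
        by (simp add: algebra_simps power2_eq_square)
    qed
    also have "\<dots> = mult_mv N Q (z \<sigma>) i + (- 2 * \<sigma> i) * K i"
      by (simp add: sum.distrib mult_mv_def K_def sum_distrib_left sum_negf sum_subtractf mult.assoc)
    finally show ?thesis by (simp add: G_def algebra_simps)
  qed
  define S where "S \<sigma> = (\<Sum>i<N. (z \<sigma> i)\<^sup>2)" for \<sigma>
  have ctr2: "\<bar>ctr \<sigma> i\<bar> \<le> 2" if "\<sigma> \<in> spins N" "i < N" for \<sigma> i
    using spins_abs[OF that] abs_tanh_le_1[of h] by linarith
  have up: "S \<sigma> \<le> (\<Sum>i<N. ctr \<sigma> i * G i \<sigma>) + 4 * frob N Q" if "\<sigma> \<in> spins N" for \<sigma>
  proof -
    have "S \<sigma> = (\<Sum>i<N. z \<sigma> i * mult_mv N Q (ctr \<sigma>) i)" by (simp add: S_def z_def power2_eq_square)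
    also have "\<dots> = (\<Sum>i<N. ctr \<sigma> i * G i \<sigma> + K i * (ctr \<sigma> i)\<^sup>2)"
      unfolding mult_mv_adjoint[OF Q(1)] by (simp add: G_def algebra_simps power2_eq_square)
    also have "\<dots> \<le> (\<Sum>i<N. ctr \<sigma> i * G i \<sigma> + K i * 4)"
    proof (intro sum_mono add_left_mono mult_left_mono K)
      fix i assume "i \<in> {..<N}"
      then have "(ctr \<sigma> i)\<^sup>2 \<le> 2\<^sup>2" using ctr2[OF that] by (intro power2_le_iff_abs_le[THEN iffD2]) auto
      then show "(ctr \<sigma> i)\<^sup>2 \<le> 4" by simp
    qed
    also have "\<dots> = (\<Sum>i<N. ctr \<sigma> i * G i \<sigma>) + 4 * frob N Q"
      by (simp add: sum.distrib K(2) [symmetric] sum_distrib_right mult.commute[of 4])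
    finally show ?thesis .
  qed
  have down: "(\<Sum>i<N. (tanh (h + s * mult_mv N Q (ctr \<sigma>) i) - tanh h) * G i \<sigma>) \<le> S \<sigma> / 2 + 4 * frob N Q"
    if "\<sigma> \<in> spins N" for \<sigma>
  proof -
    have "(tanh (h + s * mult_mv N Q (ctr \<sigma>) i) - tanh h) * G i \<sigma>
        \<le> ((z \<sigma> i)\<^sup>2 / 4 + (mult_mv N Q (z \<sigma>) i)\<^sup>2) + 4 * K i" if i: "i < N" for i
    proof -
      let ?d = "tanh (h + s * mult_mv N Q (ctr \<sigma>) i) - tanh h"
      let ?w = "mult_mv N Q (z \<sigma>) i"
      have d: "\<bar>?d\<bar> \<le> \<bar>z \<sigma> i\<bar>" "\<bar>?d\<bar> \<le> 2"
        unfolding z_def using tanh_field_le abs_tanh_le_1[of h] abs_tanh_le_1[of "h + s * mult_mv N Q (ctr \<sigma>) i"]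
        by auto
      have "?d * ?w \<le> \<bar>z \<sigma> i\<bar> * \<bar>?w\<bar>"
        using d(1) by (rule mult_le_abs_mult)
      \<comment> \<open>AM-GM with weights such that, after summing, \<open>small\<close> turns both
        terms into a quarter of \<open>S \<sigma>\<close>.\<close>
      also have "\<dots> \<le> (z \<sigma> i)\<^sup>2 / 4 + ?w\<^sup>2"
        using zero_le_power2[of "\<bar>z \<sigma> i\<bar> / 2 - \<bar>?w\<bar>"]
        by (simp add: power2_diff power_divide)
      finally have 1: "?d * ?w \<le> (z \<sigma> i)\<^sup>2 / 4 + ?w\<^sup>2" .
      have "- (?d * ctr \<sigma> i) \<le> \<bar>?d\<bar> * \<bar>ctr \<sigma> i\<bar>" by (metis abs_ge_minus_self abs_mult)
      also have "\<dots> \<le> 2 * 2" using d(2) ctr2[OF \<open>\<sigma> \<in> spins N\<close> i] by (intro mult_mono) auto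
      finally have "K i * (- (?d * ctr \<sigma> i)) \<le> K i * 4" using K(1) by (intro mult_left_mono) auto
      with 1 show ?thesis by (simp add: G_def algebra_simps)
    qed
    then have "(\<Sum>i<N. (tanh (h + s * mult_mv N Q (ctr \<sigma>) i) - tanh h) * G i \<sigma>)
        \<le> (\<Sum>i<N. ((z \<sigma> i)\<^sup>2 / 4 + (mult_mv N Q (z \<sigma>) i)\<^sup>2) + 4 * K i)"
      by (intro sum_mono) auto
    also have "\<dots> = S \<sigma> / 4 + (\<Sum>i<N. (mult_mv N Q (z \<sigma>) i)\<^sup>2) + 4 * frob N Q"
      by (simp add: sum.distrib K(2) [symmetric] sum_distrib_left S_def sum_divide_distrib)
    also have "\<dots> \<le> S \<sigma> / 4 + S \<sigma> / 4 + 4 * frob N Q"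
      using small[of "z \<sigma>"] by (simp add: S_def)
    finally show ?thesis by simp
  qed
  let ?E = "\<lambda>f. \<Sum>\<sigma>\<in>spins N. exp (energy \<sigma>) * f \<sigma>"
  have "?E S \<le> ?E (\<lambda>\<sigma>. (\<Sum>i<N. ctr \<sigma> i * G i \<sigma>) + 4 * frob N Q)"
    using up by (intro sum_mono mult_left_mono) auto
  also have "\<dots> = ?E (\<lambda>\<sigma>. \<Sum>i<N. ctr \<sigma> i * G i \<sigma>) + 4 * frob N Q * (\<Sum>\<sigma>\<in>spins N. exp (energy \<sigma>))"
    by (rule sum_weight_add)
  also have "?E (\<lambda>\<sigma>. \<Sum>i<N. ctr \<sigma> i * G i \<sigma>)
      = ?E (\<lambda>\<sigma>. \<Sum>i<N. (tanh (h + s * mult_mv N Q (ctr \<sigma>) i) - tanh h) * G i \<sigma>)"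
    by (rule stein_sum) (rule Gflip)
  also have "\<dots> \<le> ?E (\<lambda>\<sigma>. S \<sigma> / 2 + 4 * frob N Q)"
    using down by (intro sum_mono mult_left_mono) auto
  also have "\<dots> = ?E S / 2 + 4 * frob N Q * (\<Sum>\<sigma>\<in>spins N. exp (energy \<sigma>))"
    unfolding sum_weight_add by (simp add: sum_divide_distrib)
  finally have "?E S \<le> 16 * frob N Q * (\<Sum>\<sigma>\<in>spins N. exp (energy \<sigma>))" by linarith
  then show ?thesis by (simp add: S_def z_def)
qed

text \<open>The local field at i does not involve the i-th spin, so a single integration by parts
  bounds the mean energy by the second moment of the local field.\<close>

lemma energy_moment:
  "(\<Sum>\<sigma>\<in>spins N. exp (energy \<sigma>) * (quad N Q (ctr \<sigma>) / 2))
    \<le> 8 * frob N Q * (\<Sum>\<sigma>\<in>spins N. exp (energy \<sigma>))"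
proof -
  let ?z = "\<lambda>\<sigma>. mult_mv N Q (ctr \<sigma>)"
  have "(\<Sum>\<sigma>\<in>spins N. exp (energy \<sigma>) * quad N Q (ctr \<sigma>))
      = (\<Sum>\<sigma>\<in>spins N. exp (energy \<sigma>) * (\<Sum>i<N. ctr \<sigma> i * ?z \<sigma> i))"
    by (rule sum.cong[OF refl]) (simp add: quad_def[of N Q "ctr _", symmetric])
  also have "\<dots> = (\<Sum>\<sigma>\<in>spins N. exp (energy \<sigma>) * (\<Sum>i<N. (tanh (h + s * ?z \<sigma> i) - tanh h) * ?z \<sigma> i))"
    by (rule stein_sum) (rule field_flip)
  also have "\<dots> \<le> (\<Sum>\<sigma>\<in>spins N. exp (energy \<sigma>) * (\<Sum>i<N. (?z \<sigma> i)\<^sup>2))"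
  proof (intro sum_mono mult_left_mono)
    fix \<sigma> i
    have "(tanh (h + s * ?z \<sigma> i) - tanh h) * ?z \<sigma> i \<le> \<bar>?z \<sigma> i\<bar> * \<bar>?z \<sigma> i\<bar>"
      by (rule mult_le_abs_mult[OF tanh_field_le])
    then show "(tanh (h + s * ?z \<sigma> i) - tanh h) * ?z \<sigma> i \<le> (?z \<sigma> i)\<^sup>2"
      by (simp add: power2_eq_square)
  qed auto
  also note local_field_second_moment
  finally show ?thesis by (simp add: sum_divide_distrib [symmetric])
qed

end

text \<open>The derivative of \<open>ln (Z s)\<close> is the mean energy at coupling s, at most 8
  times the squared Frobenius norm for every s in [0, 1]; integrate from the product measure at s =
  0.\<close>

lemma high_temperature_bound:
  assumes Q: "sym_on N Q" "\<And>i. i < N \<Longrightarrow> Q i i = 0"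
    and small: "\<And>y. (\<Sum>i<N. (mult_mv N Q y i)\<^sup>2) \<le> (\<Sum>i<N. (y i)\<^sup>2) / 4"
  shows "spin_expect h N (\<lambda>\<sigma>. exp (quad N Q (\<lambda>i. \<sigma> i - tanh h) / 2)) \<le> exp (8 * frob N Q)"
proof -
  let ?q = "\<lambda>\<sigma>. quad N Q (\<lambda>i. \<sigma> i - tanh h) / 2"
  let ?e = "\<lambda>s \<sigma>. h * (\<Sum>i<N. \<sigma> i) + s * ?q \<sigma>"
  define Z where "Z s = (\<Sum>\<sigma>\<in>spins N. exp (?e s \<sigma>))" for s
  have "spins N \<noteq> {}"
    by (simp add: spins_def PiE_eq_empty_iff)
  then have Zpos: "Z s > 0" for s unfolding Z_def by (intro sum_pos) auto
  have "8 * frob N Q * 0 - ln (Z 0) \<le> 8 * frob N Q * 1 - ln (Z 1)"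
  proof (rule DERIV_nonneg_imp_nondecreasing[where f = "\<lambda>s. 8 * frob N Q * s - ln (Z s)"])
    fix s :: real assume s: "0 \<le> s" "s \<le> 1"
    have "(Z has_real_derivative (\<Sum>\<sigma>\<in>spins N. exp (?e s \<sigma>) * ?q \<sigma>)) (at s)"
      unfolding Z_def [abs_def] by (auto intro!: derivative_eq_intros)
    then have "((\<lambda>s. 8 * frob N Q * s - ln (Z s)) has_real_derivative
        8 * frob N Q - (\<Sum>\<sigma>\<in>spins N. exp (?e s \<sigma>) * ?q \<sigma>) / Z s) (at s)"
      using Zpos[of s] by (auto intro!: derivative_eq_intros)
    moreover have "(\<Sum>\<sigma>\<in>spins N. exp (?e s \<sigma>) * ?q \<sigma>) \<le> 8 * frob N Q * Z s"
      unfolding Z_def by (rule energy_moment[OF Q small s])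
    then have "0 \<le> 8 * frob N Q - (\<Sum>\<sigma>\<in>spins N. exp (?e s \<sigma>) * ?q \<sigma>) / Z s"
      using Zpos[of s] by (simp add: pos_divide_le_eq)
    ultimately show "\<exists>d. ((\<lambda>s. 8 * frob N Q * s - ln (Z s)) has_real_derivative d) (at s) \<and> 0 \<le> d"
      by blast
  qed simp
  then have "exp (ln (Z 1)) \<le> exp (8 * frob N Q + ln (Z 0))" by simp
  then have "Z 1 \<le> exp (8 * frob N Q) * Z 0" using Zpos by (simp add: exp_add)
  moreover have "spin_expect h N (\<lambda>\<sigma>. exp (?q \<sigma>)) = Z 1 / (2 * cosh h) ^ N"
    unfolding spin_expect_def exp_spin_weight Z_def
    by (simp add: exp_add sum_divide_distrib)
  moreover have "Z 0 / (2 * cosh h) ^ N = 1"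
    using spin_expect_one[of h N] unfolding spin_expect_def exp_spin_weight Z_def
    by (simp add: sum_divide_distrib)
  moreover have "0 < (2 * cosh h) ^ N" by (simp add: cosh_real_pos)
  ultimately show ?thesis
    using divide_right_mono[of "Z 1" "exp (8 * frob N Q) * Z 0" "(2 * cosh h) ^ N"] by simp
qed

section \<open>Linearisation of squares\<close>

text \<open>Since n^2 >= |n|, two geometric series dominate; the bound does not depend on the cutoff
  \<open>K\<close>.\<close>

lemma discrete_gaussian_sum:
  fixes \<delta> :: real
  assumes "0 < \<delta>"
  shows "(\<Sum>n\<in>{- int K..int K}. exp (- \<delta> * (of_int n)\<^sup>2)) \<le> 2 / (1 - exp (- \<delta>))"
proof -
  let ?f = "\<lambda>n::int. exp (- \<delta> * (of_int n)\<^sup>2)"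
  have geo: "(\<Sum>m\<le>K. exp (- \<delta>) ^ m) \<le> 1 / (1 - exp (- \<delta>))"
  proof -
    have "(\<Sum>m\<le>K. exp (- \<delta>) ^ m) \<le> (\<Sum>m. exp (- \<delta>) ^ m)"
      using assms by (intro sum_le_suminf summable_geometric) auto
    also have "\<dots> = 1 / (1 - exp (- \<delta>))" using assms by (intro suminf_geometric) auto
    finally show ?thesis .
  qed
  have le: "exp (- \<delta> * (real m)\<^sup>2) \<le> exp (- \<delta>) ^ m" for m
  proof -
    have "real m \<le> (real m)\<^sup>2" by (cases m) (simp_all add: power2_eq_square)
    then have "\<delta> * real m \<le> \<delta> * (real m)\<^sup>2" using assms by (intro mult_left_mono) auto
    then show ?thesis by (simp add: exp_of_nat_mult [symmetric] mult.commute)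
  qed
  have "{- int K..int K} \<subseteq> int ` {..K} \<union> (\<lambda>m. - int m) ` {..K}"
  proof
    fix n assume "n \<in> {- int K..int K}"
    then show "n \<in> int ` {..K} \<union> (\<lambda>m. - int m) ` {..K}"
      by (cases n rule: int_cases2) auto
  qed
  then have "(\<Sum>n\<in>{- int K..int K}. ?f n) \<le> (\<Sum>n\<in>int ` {..K} \<union> (\<lambda>m. - int m) ` {..K}. ?f n)"
    by (intro sum_mono2) auto
  also have "\<dots> \<le> (\<Sum>n\<in>int ` {..K}. ?f n) + (\<Sum>n\<in>(\<lambda>m. - int m) ` {..K}. ?f n)"
    by (subst sum_Un) (auto intro!: sum_nonneg)
  also have "\<dots> = (\<Sum>m\<le>K. exp (- \<delta> * (real m)\<^sup>2)) + (\<Sum>m\<le>K. exp (- \<delta> * (real m)\<^sup>2))"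
    by (simp add: sum.reindex inj_on_def)
  also have "\<dots> \<le> (\<Sum>m\<le>K. exp (- \<delta>) ^ m) + (\<Sum>m\<le>K. exp (- \<delta>) ^ m)"
    using le by (intro add_mono sum_mono) auto
  also have "\<dots> \<le> 1 / (1 - exp (- \<delta>)) + 1 / (1 - exp (- \<delta>))" using geo by (intro add_mono)
  finally show ?thesis by simp
qed

text \<open>Replacing a square by its tangent at a nearby integer loses at most a / 2. A sum over
  integers of exponentials of linear functions thus plays the part of the Gaussian integral.\<close>

lemma square_le_tangent:
  fixes a x n :: real
  assumes "0 \<le> a" "\<bar>x - n\<bar> \<le> 1"
  shows "a * x\<^sup>2 / 2 \<le> a * n * x - a * n\<^sup>2 / 2 + a / 2"
proof -
  have "(x - n)\<^sup>2 \<le> 1" using assms(2) by (simp add: abs_square_le_1)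
  then have "a * (x - n)\<^sup>2 \<le> a * 1" using assms(1) by (intro mult_left_mono)
  then show ?thesis by (simp add: power2_diff algebra_simps)
qed

text \<open>The price of one square: \<open>exp (a / 2)\<close> for the rounding, the other factor
  for the discrete Gaussian sum.\<close>

definition gauss_const :: "real \<Rightarrow> real \<Rightarrow> real" where
  "gauss_const a \<delta> = exp (a / 2) * (2 / (1 - exp (- \<delta>)))"

lemma gauss_const_ge_1:
  assumes "0 \<le> a" "0 < \<delta>" shows "1 \<le> gauss_const a \<delta>"
proof -
  have "exp (- \<delta>) < 1" using assms by simp
  moreover have "0 < exp (- \<delta>)" by (rule exp_gt_zero)
  ultimately have "0 < 1 - exp (- \<delta>)" "1 - exp (- \<delta>) \<le> 2" by linarith+
  then have "1 \<le> 2 / (1 - exp (- \<delta>))" by (simp add: le_divide_eq)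
  then show ?thesis unfolding gauss_const_def
    using mult_mono[of 1 "exp (a / 2)" 1 "2 / (1 - exp (- \<delta>))"] assms by simp
qed

text \<open>Discretised Hubbard--Stratonovich linearisation of finitely many orthogonal squares: each
  square costs a constant factor.\<close>

lemma spin_expect_squares:
  fixes e :: "nat \<Rightarrow> nat \<Rightarrow> real"
  assumes "0 < a" "a * q < 1" "0 \<le> M" "finite S"
    and on: "\<And>k l. k \<in> S \<Longrightarrow> l \<in> S \<Longrightarrow> (\<Sum>i<N. e k i * e l i) = (if k = l then 1 else 0)"
    and V: "\<And>k. k \<in> S \<Longrightarrow> c * (\<Sum>i<N. e k i) = 0"
    and H: "\<And>w. c * (\<Sum>i<N. w i) = 0 \<Longrightarrow>
      spin_expect h N (\<lambda>\<sigma>. exp (\<Sum>i<N. w i * (\<sigma> i - tanh h))) \<le> M * exp (q * (\<Sum>i<N. (w i)\<^sup>2) / 2)"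
    and w: "c * (\<Sum>i<N. w i) = 0" "\<And>k. k \<in> S \<Longrightarrow> (\<Sum>i<N. w i * e k i) = 0"
  shows "spin_expect h N (\<lambda>\<sigma>. exp ((\<Sum>i<N. w i * (\<sigma> i - tanh h))
      + a * (\<Sum>k\<in>S. (\<Sum>i<N. e k i * (\<sigma> i - tanh h))\<^sup>2) / 2))
    \<le> M * gauss_const a (a * (1 - a * q) / 2) ^ card S * exp (q * (\<Sum>i<N. (w i)\<^sup>2) / 2)"
  using \<open>finite S\<close> on V w
\<comment> \<open>Linearising the square along \<open>e k\<close> adds a multiple of
  \<open>e k\<close> to the linear field, hence the general \<open>w\<close>. The number
  \<open>c\<close> is a switch: c = 0 imposes nothing, while c = 1 confines all fields to those with
  sum zero.\<close>
proof (induction S arbitrary: w rule: finite_induct)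
  case empty
  then show ?case using H by simp
next
  case (insert k S)
  let ?C = "gauss_const a (a * (1 - a * q) / 2)"
  let ?Y = "\<lambda>\<sigma> i. \<sigma> i - tanh h"
  let ?x = "\<lambda>\<sigma>. \<Sum>i<N. e k i * ?Y \<sigma> i"
  let ?r = "\<lambda>\<sigma>. a * (\<Sum>k\<in>S. (\<Sum>i<N. e k i * ?Y \<sigma> i)\<^sup>2) / 2"
  let ?w = "\<lambda>n i. w i + a * of_int n * e k i"
  have \<delta>: "0 < a * (1 - a * q) / 2" using assms by simp
  \<comment> \<open>A bound for the linear form over all configurations, plus one to leave room for
    the floor. It bounds the range of integers only and does not survive in the estimate.\<close>
  define K where "K = nat \<lceil>(\<Sum>i<N. \<bar>e k i\<bar> * 2)\<rceil> + 1"
  have xK: "\<lfloor>?x \<sigma>\<rfloor> \<in> {- int K..int K}" if "\<sigma> \<in> spins N" for \<sigma>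
  proof -
    have "\<bar>?x \<sigma>\<bar> \<le> (\<Sum>i<N. \<bar>e k i * ?Y \<sigma> i\<bar>)" by (rule sum_abs)
    also have "\<dots> \<le> (\<Sum>i<N. \<bar>e k i\<bar> * 2)"
    proof (intro sum_mono)
      fix i assume "i \<in> {..<N}"
      then have "\<bar>?Y \<sigma> i\<bar> \<le> 2" using spins_abs[OF that, of i] abs_tanh_le_1[of h] by auto
      then show "\<bar>e k i * ?Y \<sigma> i\<bar> \<le> \<bar>e k i\<bar> * 2" unfolding abs_mult by (intro mult_left_mono) auto
    qed
    also have "\<dots> \<le> real K - 1" unfolding K_def by linarith
    finally have "\<bar>?x \<sigma>\<bar> \<le> real K - 1" .
    then have "- real K \<le> ?x \<sigma>" "?x \<sigma> \<le> real K" by auto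
    then show ?thesis by (auto simp: le_floor_iff floor_le_iff)
  qed
  have step: "exp ((\<Sum>i<N. w i * ?Y \<sigma> i) + a * (\<Sum>k\<in>insert k S. (\<Sum>i<N. e k i * ?Y \<sigma> i)\<^sup>2) / 2)
      \<le> (\<Sum>n\<in>{- int K..int K}. exp (a / 2 - a * (of_int n)\<^sup>2 / 2) *
           exp ((\<Sum>i<N. ?w n i * ?Y \<sigma> i) + ?r \<sigma>))" (is "_ \<le> sum ?t _")
    if s: "\<sigma> \<in> spins N" for \<sigma>
  proof -
    define n where "n = \<lfloor>?x \<sigma>\<rfloor>"
    have "\<bar>?x \<sigma> - of_int n\<bar> \<le> 1" unfolding n_def by linarith
    then have "a * (?x \<sigma>)\<^sup>2 / 2 \<le> a * of_int n * ?x \<sigma> - a * (of_int n)\<^sup>2 / 2 + a / 2"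
      using assms(1) by (intro square_le_tangent) auto
    moreover have "(\<Sum>i<N. ?w n i * ?Y \<sigma> i) = (\<Sum>i<N. w i * ?Y \<sigma> i) + a * of_int n * ?x \<sigma>"
      by (simp add: distrib_right sum.distrib sum_distrib_left mult.assoc)
    moreover have "a * (\<Sum>k\<in>insert k S. (\<Sum>i<N. e k i * ?Y \<sigma> i)\<^sup>2) / 2 = a * (?x \<sigma>)\<^sup>2 / 2 + ?r \<sigma>"
      using insert.hyps by (simp add: distrib_left add_divide_distrib)
    ultimately have "exp ((\<Sum>i<N. w i * ?Y \<sigma> i) + a * (\<Sum>k\<in>insert k S. (\<Sum>i<N. e k i * ?Y \<sigma> i)\<^sup>2) / 2) \<le> ?t n"
      unfolding exp_add [symmetric] by simp
    also have "\<dots> \<le> sum ?t {- int K..int K}"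
      using xK[OF s] by (intro member_le_sum) (auto simp: n_def)
    finally show ?thesis .
  qed
  have ekek: "(\<Sum>i<N. e k i * e k i) = 1" using insert.prems(1)[of k k] by simp
  have wek: "(\<Sum>i<N. w i * e k i) = 0" using insert.prems(4) by simp
  have IH: "spin_expect h N (\<lambda>\<sigma>. exp ((\<Sum>i<N. ?w n i * ?Y \<sigma> i) + ?r \<sigma>))
      \<le> M * ?C ^ card S * exp (q * (\<Sum>i<N. (w i)\<^sup>2) / 2) * exp (q * (a * of_int n)\<^sup>2 / 2)" for n
  proof -
    have "spin_expect h N (\<lambda>\<sigma>. exp ((\<Sum>i<N. ?w n i * ?Y \<sigma> i) + ?r \<sigma>))
        \<le> M * ?C ^ card S * exp (q * (\<Sum>i<N. (?w n i)\<^sup>2) / 2)"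
    proof (rule insert.IH)
      show "c * (\<Sum>i<N. ?w n i) = 0"
        using insert.prems(2)[of k] insert.prems(3)
        by (auto simp: sum.distrib sum_distrib_left [symmetric] distrib_left)
      fix l assume l: "l \<in> S"
      then have "k \<noteq> l" using insert.hyps by auto
      then have "(\<Sum>i<N. e k i * e l i) = 0" using insert.prems(1)[of k l] l by simp
      moreover have "(\<Sum>i<N. ?w n i * e l i) = (\<Sum>i<N. w i * e l i) + a * of_int n * (\<Sum>i<N. e k i * e l i)"
        by (simp add: distrib_right sum.distrib sum_distrib_left mult.assoc)
      ultimately show "(\<Sum>i<N. ?w n i * e l i) = 0" using insert.prems(4)[of l] l by simp
    qed (use insert.prems in auto)
    \<comment> \<open>Pythagoras: \<open>w\<close> is orthogonal to \<open>e k\<close>, so the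
      squared norm grows by exactly (a n)^2.\<close>
    also have "(\<Sum>i<N. (?w n i)\<^sup>2) = (\<Sum>i<N. (w i)\<^sup>2 + 2 * (a * of_int n) * (w i * e k i) + (a * of_int n)\<^sup>2 * (e k i * e k i))"
      by (intro sum.cong refl) (simp add: power2_eq_square algebra_simps)
    also have "\<dots> = (\<Sum>i<N. (w i)\<^sup>2) + (a * of_int n)\<^sup>2"
      by (simp only: sum.distrib sum_distrib_left [symmetric] ekek wek mult_zero_right mult_1_right add_0_right)
    finally show ?thesis by (simp add: distrib_left add_divide_distrib exp_add mult.assoc)
  qed
  have "spin_expect h N (\<lambda>\<sigma>. exp ((\<Sum>i<N. w i * ?Y \<sigma> i) + a * (\<Sum>k\<in>insert k S. (\<Sum>i<N. e k i * ?Y \<sigma> i)\<^sup>2) / 2))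
      \<le> (\<Sum>n\<in>{- int K..int K}. exp (a / 2 - a * (of_int n)\<^sup>2 / 2) *
           spin_expect h N (\<lambda>\<sigma>. exp ((\<Sum>i<N. ?w n i * ?Y \<sigma> i) + ?r \<sigma>)))"
    unfolding spin_expect_cmult [symmetric] spin_expect_sum [symmetric]
    by (rule spin_expect_mono) (rule step)
  also have "\<dots> \<le> (\<Sum>n\<in>{- int K..int K}. exp (a / 2 - a * (of_int n)\<^sup>2 / 2) *
      (M * ?C ^ card S * exp (q * (\<Sum>i<N. (w i)\<^sup>2) / 2) * exp (q * (a * of_int n)\<^sup>2 / 2)))"
    by (intro sum_mono mult_left_mono IH) auto
  also have "\<dots> = M * ?C ^ card S * exp (q * (\<Sum>i<N. (w i)\<^sup>2) / 2) * exp (a / 2) *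
      (\<Sum>n\<in>{- int K..int K}. exp (- (a * (1 - a * q) / 2) * (of_int n)\<^sup>2))"
  proof -
    \<comment> \<open>Here a q < 1 matters: - a n^2 / 2 from the tangent beats the growth q (a n)^2
      / 2, leaving - a (1 - a q) / 2 * n^2.\<close>
    have "exp (a / 2 - a * (of_int n)\<^sup>2 / 2) * exp (q * (a * of_int n)\<^sup>2 / 2)
        = exp (a / 2) * exp (- (a * (1 - a * q) / 2) * (of_int n)\<^sup>2)" for n
      unfolding exp_add [symmetric] by (simp add: field_simps power2_eq_square)
    then show ?thesis unfolding sum_distrib_left by (intro sum.cong refl) (simp add: mult_ac)
  qed
  also have "\<dots> \<le> M * ?C ^ card S * exp (q * (\<Sum>i<N. (w i)\<^sup>2) / 2) * exp (a / 2) *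
      (2 / (1 - exp (- (a * (1 - a * q) / 2))))"
    using gauss_const_ge_1[of a "a * (1 - a * q) / 2"] \<delta> assms
    by (intro mult_left_mono discrete_gaussian_sum[OF \<delta>]) auto
  also have "\<dots> = M * ?C ^ card (insert k S) * exp (q * (\<Sum>i<N. (w i)\<^sup>2) / 2)"
    using insert.hyps by (simp add: gauss_const_def)
  finally show ?case .
qed

section \<open>Orthonormal eigenbases\<close>

definition orthobasis :: "nat \<Rightarrow> (nat \<Rightarrow> nat \<Rightarrow> real) \<Rightarrow> bool" where
  "orthobasis N e \<longleftrightarrow>
     (\<forall>k<N. \<forall>l<N. (\<Sum>i<N. e k i * e l i) = (if k = l then 1 else 0)) \<and>
     (\<forall>i<N. \<forall>j<N. (\<Sum>k<N. e k i * e k j) = (if i = j then 1 else 0))"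

text \<open>Functional calculus: the matrix with eigenvectors \<open>e k\<close> and eigenvalues
  \<open>f k\<close>. Truncating \<open>f\<close> cuts the spectrum.\<close>

definition spec_mat :: "nat \<Rightarrow> (nat \<Rightarrow> nat \<Rightarrow> real) \<Rightarrow> (nat \<Rightarrow> real) \<Rightarrow> nat \<Rightarrow> nat \<Rightarrow> real" where
  "spec_mat N e f i j = (\<Sum>k<N. f k * e k i * e k j)"

lemma sum_delta_lessThan:
  fixes g :: "nat \<Rightarrow> real"
  assumes "k < N" shows "(\<Sum>l<N. g l * (if k = l then 1 else 0)) = g k"
proof -
  have "(\<Sum>l<N. g l * (if k = l then 1 else 0)) = (\<Sum>l<N. if k = l then g l else 0)"
    by (intro sum.cong) auto
  then show ?thesis using assms by simp
qed

context
  fixes N :: nat and e :: "nat \<Rightarrow> nat \<Rightarrow> real"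
  assumes e: "orthobasis N e"
begin

lemma orthonormal: "k < N \<Longrightarrow> l < N \<Longrightarrow> (\<Sum>i<N. e k i * e l i) = (if k = l then 1 else 0)"
  and complete: "i < N \<Longrightarrow> j < N \<Longrightarrow> (\<Sum>k<N. e k i * e k j) = (if i = j then 1 else 0)"
  using e by (auto simp: orthobasis_def)

lemma basis_entry_sum: "i < N \<Longrightarrow> (\<Sum>k<N. (e k i)\<^sup>2) = 1"
  using complete[of i i] by (simp add: power2_eq_square)

lemma basis_vector_norm: "k < N \<Longrightarrow> (\<Sum>i<N. (e k i)\<^sup>2) = 1"
  using orthonormal[of k k] by (simp add: power2_eq_square)

lemma norm_combination: "(\<Sum>i<N. (\<Sum>k<N. g k * e k i)\<^sup>2) = (\<Sum>k<N. (g k)\<^sup>2)"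
proof -
  have "(\<Sum>i<N. (\<Sum>k<N. g k * e k i)\<^sup>2) = (\<Sum>i<N. \<Sum>k<N. \<Sum>l<N. g k * g l * (e k i * e l i))"
    unfolding power2_eq_square sum_product by (intro sum.cong refl) (simp add: mult_ac)
  also have "\<dots> = (\<Sum>k<N. \<Sum>i<N. \<Sum>l<N. g k * g l * (e k i * e l i))" by (rule sum.swap)
  also have "\<dots> = (\<Sum>k<N. \<Sum>l<N. \<Sum>i<N. g k * g l * (e k i * e l i))"
    by (rule sum.cong[OF refl]) (rule sum.swap)
  also have "\<dots> = (\<Sum>k<N. \<Sum>l<N. g k * g l * (if k = l then 1 else 0))"
    by (simp add: sum_distrib_left [symmetric] orthonormal)
  also have "\<dots> = (\<Sum>k<N. (g k)\<^sup>2)" by (simp add: sum_delta_lessThan power2_eq_square)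
  finally show ?thesis .
qed

lemma basis_expand:
  assumes "i < N" shows "(\<Sum>k<N. (\<Sum>j<N. e k j * y j) * e k i) = y i"
proof -
  have "(\<Sum>k<N. (\<Sum>j<N. e k j * y j) * e k i) = (\<Sum>k<N. \<Sum>j<N. y j * (e k i * e k j))"
    unfolding sum_distrib_right by (intro sum.cong refl) (simp add: mult_ac)
  also have "\<dots> = (\<Sum>j<N. \<Sum>k<N. y j * (e k i * e k j))" by (rule sum.swap)
  also have "\<dots> = (\<Sum>j<N. y j * (if i = j then 1 else 0))"
    using assms by (simp add: sum_distrib_left [symmetric] complete)
  finally show ?thesis using assms by (simp add: sum_delta_lessThan)
qed

lemma parseval: "(\<Sum>k<N. (\<Sum>i<N. e k i * y i)\<^sup>2) = (\<Sum>i<N. (y i)\<^sup>2)"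
proof -
  have "(\<Sum>i<N. (y i)\<^sup>2) = (\<Sum>i<N. (\<Sum>k<N. (\<Sum>j<N. e k j * y j) * e k i)\<^sup>2)"
    by (intro sum.cong refl) (simp add: basis_expand)
  then show ?thesis by (simp add: norm_combination)
qed

lemma mult_mv_spec: "mult_mv N (spec_mat N e f) y i = (\<Sum>k<N. (f k * (\<Sum>j<N. e k j * y j)) * e k i)"
proof -
  have "mult_mv N (spec_mat N e f) y i = (\<Sum>j<N. \<Sum>k<N. f k * e k i * e k j * y j)"
    by (simp add: mult_mv_def spec_mat_def sum_distrib_right)
  also have "\<dots> = (\<Sum>k<N. \<Sum>j<N. f k * e k i * e k j * y j)" by (rule sum.swap)
  finally show ?thesis by (simp add: sum_distrib_left sum_distrib_right mult_ac)
qed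

lemma quad_spec: "quad N (spec_mat N e f) y = (\<Sum>k<N. f k * (\<Sum>i<N. e k i * y i)\<^sup>2)"
proof -
  have "quad N (spec_mat N e f) y = (\<Sum>i<N. \<Sum>k<N. f k * (\<Sum>j<N. e k j * y j) * (e k i * y i))"
    unfolding quad_def mult_mv_spec by (simp add: sum_distrib_left mult_ac)
  also have "\<dots> = (\<Sum>k<N. \<Sum>i<N. f k * (\<Sum>j<N. e k j * y j) * (e k i * y i))" by (rule sum.swap)
  finally show ?thesis by (simp add: sum_distrib_left [symmetric] power2_eq_square mult.assoc)
qed

lemma norm_mult_mv_spec:
  "(\<Sum>i<N. (mult_mv N (spec_mat N e f) y i)\<^sup>2) = (\<Sum>k<N. (f k)\<^sup>2 * (\<Sum>i<N. e k i * y i)\<^sup>2)"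
  unfolding mult_mv_spec norm_combination by (simp add: power_mult_distrib)

lemma frob_spec: "frob N (spec_mat N e f) = (\<Sum>k<N. (f k)\<^sup>2)"
proof -
  have "frob N (spec_mat N e f) = (\<Sum>i<N. \<Sum>j<N. (\<Sum>k<N. (f k * e k i) * e k j)\<^sup>2)"
    by (simp add: frob_def spec_mat_def)
  also have "\<dots> = (\<Sum>i<N. \<Sum>k<N. (f k)\<^sup>2 * (e k i)\<^sup>2)"
    unfolding norm_combination by (simp add: power_mult_distrib)
  also have "\<dots> = (\<Sum>k<N. \<Sum>i<N. (f k)\<^sup>2 * (e k i)\<^sup>2)" by (rule sum.swap)
  also have "\<dots> = (\<Sum>k<N. (f k)\<^sup>2)"
    by (simp add: sum_distrib_left [symmetric] basis_vector_norm)
  finally show ?thesis .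
qed

lemma sym_on_spec: "sym_on N (spec_mat N e f)"
  by (simp add: sym_on_def spec_mat_def mult_ac)

end

section \<open>Congruence, scaling and removal of the diagonal\<close>

lemma quad_cong: "(\<And>i j. i < N \<Longrightarrow> j < N \<Longrightarrow> D i j = D' i j) \<Longrightarrow> quad N D y = quad N D' y"
  by (simp add: quad_def mult_mv_def)

lemma frob_cong: "(\<And>i j. i < N \<Longrightarrow> j < N \<Longrightarrow> D i j = D' i j) \<Longrightarrow> frob N D = frob N D'"
  by (simp add: frob_def)

lemma mult_mv_scale: "mult_mv N (\<lambda>i j. a * Q i j) y i = a * mult_mv N Q y i"
  by (simp add: mult_mv_def sum_distrib_left mult.assoc)

lemma quad_scale: "quad N (\<lambda>i j. a * Q i j) y = a * quad N Q y"
  by (simp add: quad_def mult_mv_scale sum_distrib_left mult_ac)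

lemma mult_mv_off_diag:
  assumes "i < N"
  shows "mult_mv N (\<lambda>i j. if i = j then 0 else Q i j) y i = mult_mv N Q y i - Q i i * y i"
proof -
  have "mult_mv N (\<lambda>i j. if i = j then 0 else Q i j) y i
      = (\<Sum>j<N. Q i j * y j - (if i = j then Q i i * y i else 0))"
    unfolding mult_mv_def by (intro sum.cong refl) auto
  then show ?thesis using assms by (simp add: sum_subtractf mult_mv_def)
qed

lemma quad_off_diag:
  "quad N Q y = quad N (\<lambda>i j. if i = j then 0 else Q i j) y + (\<Sum>i<N. Q i i * (y i)\<^sup>2)"
proof -
  have "quad N (\<lambda>i j. if i = j then 0 else Q i j) y = (\<Sum>i<N. y i * mult_mv N Q y i - Q i i * (y i)\<^sup>2)"
    unfolding quad_def by (intro sum.cong refl) (simp add: mult_mv_off_diag algebra_simps power2_eq_square)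
  then show ?thesis by (simp add: quad_def sum_subtractf)
qed

lemma frob_off_diag_le: "frob N (\<lambda>i j. if i = j then 0 else Q i j) \<le> frob N Q"
  unfolding frob_def by (intro sum_mono) auto

text \<open>Vectors are functions on all of the naturals, so compactness comes from the Tychonoff
  theorem; the unit sphere below is made compact by confining the coordinates from N on to
  {0}.\<close>

lemma compact_box: "compact {x :: nat \<Rightarrow> real. \<forall>i. x i \<in> S i}" if "\<And>i. compact (S i)"
proof -
  have "compactin (product_topology (\<lambda>i::nat. euclidean :: real topology) UNIV) (PiE UNIV S)"
    using that by (subst compactin_PiE) (auto simp: compactin_euclidean_iff)
  moreover have "PiE UNIV S = {x. \<forall>i. x i \<in> S i}" by (auto simp: PiE_iff)
  ultimately show ?thesis by (simp add: euclidean_product_topology compactin_euclidean_iff)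
qed

section \<open>Extending orthonormal families and the spectral theorem\<close>

definition residual :: "nat \<Rightarrow> (nat \<Rightarrow> nat \<Rightarrow> real) \<Rightarrow> nat \<Rightarrow> (nat \<Rightarrow> real) \<Rightarrow> nat \<Rightarrow> real" where
  "residual N e m z i = z i - (\<Sum>k<m. (\<Sum>j<N. e k j * z j) * e k i)"

context
  fixes N m :: nat and e :: "nat \<Rightarrow> nat \<Rightarrow> real"
  assumes on: "\<And>k l. k < m \<Longrightarrow> l < m \<Longrightarrow> (\<Sum>i<N. e k i * e l i) = (if k = l then 1 else 0)"
begin

lemma residual_orthogonal:
  assumes "l < m" shows "(\<Sum>i<N. e l i * residual N e m z i) = 0"
proof -
  have "(\<Sum>i<N. e l i * (\<Sum>k<m. (\<Sum>j<N. e k j * z j) * e k i))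
      = (\<Sum>i<N. \<Sum>k<m. (\<Sum>j<N. e k j * z j) * (e l i * e k i))"
    unfolding sum_distrib_left by (intro sum.cong refl) (simp add: mult_ac)
  also have "\<dots> = (\<Sum>k<m. \<Sum>i<N. (\<Sum>j<N. e k j * z j) * (e l i * e k i))" by (rule sum.swap)
  also have "\<dots> = (\<Sum>k<m. (\<Sum>j<N. e k j * z j) * (if l = k then 1 else 0))"
    using assms by (simp add: sum_distrib_left [symmetric] on)
  also have "\<dots> = (\<Sum>j<N. e l j * z j)" using assms by (rule sum_delta_lessThan)
  finally show ?thesis by (simp add: residual_def right_diff_distrib sum_subtractf)
qed

lemma residual_norm:
  "(\<Sum>i<N. (residual N e m z i)\<^sup>2) = (\<Sum>i<N. (z i)\<^sup>2) - (\<Sum>k<m. (\<Sum>j<N. e k j * z j)\<^sup>2)"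
proof -
  let ?r = "residual N e m z"
  have "(\<Sum>i<N. ?r i * (\<Sum>k<m. (\<Sum>j<N. e k j * z j) * e k i))
      = (\<Sum>i<N. \<Sum>k<m. (\<Sum>j<N. e k j * z j) * (e k i * ?r i))"
    unfolding sum_distrib_left by (intro sum.cong refl) (simp add: mult_ac)
  also have "\<dots> = (\<Sum>k<m. \<Sum>i<N. (\<Sum>j<N. e k j * z j) * (e k i * ?r i))" by (rule sum.swap)
  also have "\<dots> = 0" by (simp add: sum_distrib_left [symmetric] residual_orthogonal)
  finally have 1: "(\<Sum>i<N. ?r i * (\<Sum>k<m. (\<Sum>j<N. e k j * z j) * e k i)) = 0" .
  have "(\<Sum>i<N. (?r i)\<^sup>2) = (\<Sum>i<N. ?r i * z i - ?r i * (\<Sum>k<m. (\<Sum>j<N. e k j * z j) * e k i))"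
    by (intro sum.cong refl) (simp add: power2_eq_square right_diff_distrib [symmetric] residual_def)
  also have "\<dots> = (\<Sum>i<N. ?r i * z i)" using 1 by (simp add: sum_subtractf)
  also have "\<dots> = (\<Sum>i<N. (z i)\<^sup>2) - (\<Sum>i<N. \<Sum>k<m. (\<Sum>j<N. e k j * z j) * (e k i * z i))"
    by (simp add: residual_def left_diff_distrib sum_subtractf power2_eq_square sum_distrib_right mult.assoc)
  also have "(\<Sum>i<N. \<Sum>k<m. (\<Sum>j<N. e k j * z j) * (e k i * z i))
      = (\<Sum>k<m. \<Sum>i<N. (\<Sum>j<N. e k j * z j) * (e k i * z i))" by (rule sum.swap)
  also have "\<dots> = (\<Sum>k<m. (\<Sum>j<N. e k j * z j)\<^sup>2)"
    by (simp add: sum_distrib_left [symmetric] power2_eq_square)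
  finally show ?thesis .
qed

text \<open>The trace of the projection onto the complement of the first m vectors, computed on the
  standard basis. It serves as a dimension count: positive if m < N, which yields a further unit
  vector, and zero if m = N, which yields completeness.\<close>

lemma residual_unit_norms:
  "(\<Sum>j<N. \<Sum>i<N. (residual N e m (\<lambda>i. if i = j then 1 else 0) i)\<^sup>2) = real N - real m"
proof -
  have "(\<Sum>i<N. (residual N e m (\<lambda>i. if i = j then 1 else 0) i)\<^sup>2) = 1 - (\<Sum>k<m. (e k j)\<^sup>2)" if "j < N" for j
  proof -
    have "(\<Sum>i<N. e k i * (if i = j then 1 else 0)) = e k j" for k
      using sum_delta_lessThan[OF that, of "e k"] by (simp add: eq_commute)
    moreover have "(\<Sum>i<N. (if i = j then 1 else 0 :: real)\<^sup>2) = 1"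
    proof -
      have "(\<Sum>i<N. (if i = j then 1 else 0 :: real)\<^sup>2) = (\<Sum>i<N. 1 * (if j = i then 1 else 0 :: real))"
        by (intro sum.cong) auto
      then show ?thesis using sum_delta_lessThan[OF that, of "\<lambda>_. 1"] by simp
    qed
    ultimately show ?thesis unfolding residual_norm by simp
  qed
  then have "(\<Sum>j<N. \<Sum>i<N. (residual N e m (\<lambda>i. if i = j then 1 else 0) i)\<^sup>2)
      = (\<Sum>j<N. 1 - (\<Sum>k<m. (e k j)\<^sup>2))" by simp
  also have "\<dots> = real N - (\<Sum>k<m. \<Sum>j<N. (e k j)\<^sup>2)"
    by (simp add: sum_subtractf sum.swap[of _ "{..<N}"])
  also have "(\<Sum>k<m. \<Sum>j<N. (e k j)\<^sup>2) = (\<Sum>k<m. 1)"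
    using on by (intro sum.cong) (auto simp: power2_eq_square)
  finally show ?thesis by simp
qed

lemma unit_orthogonal_exists:
  assumes "m < N"
  obtains x where "(\<Sum>i<N. (x i)\<^sup>2) = 1" "\<And>k. k < m \<Longrightarrow> (\<Sum>i<N. e k i * x i) = 0"
proof -
  let ?r = "\<lambda>j. residual N e m (\<lambda>i. if i = j then 1 else 0)"
  have "\<not> (\<forall>j<N. (\<Sum>i<N. (?r j i)\<^sup>2) = 0)"
  proof
    assume "\<forall>j<N. (\<Sum>i<N. (?r j i)\<^sup>2) = 0"
    then have "(\<Sum>j<N. \<Sum>i<N. (?r j i)\<^sup>2) = 0" by simp
    then show False using residual_unit_norms assms by simp
  qed
  then obtain j where j: "(\<Sum>i<N. (?r j i)\<^sup>2) \<noteq> 0" by blast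
  define n where "n = sqrt (\<Sum>i<N. (?r j i)\<^sup>2)"
  have n2: "n\<^sup>2 = (\<Sum>i<N. (?r j i)\<^sup>2)" unfolding n_def by (simp add: sum_nonneg)
  show ?thesis
  proof (rule that[of "\<lambda>i. ?r j i / n"])
    show "(\<Sum>i<N. (?r j i / n)\<^sup>2) = 1"
      using j by (simp add: power_divide sum_divide_distrib [symmetric] n2)
    show "(\<Sum>i<N. e k i * (?r j i / n)) = 0" if "k < m" for k
      using residual_orthogonal[OF that] by (simp add: sum_divide_distrib [symmetric])
  qed
qed

lemma orthonormal_complete:
  assumes "m = N"
  shows "orthobasis N e"
proof -
  let ?r = "\<lambda>j. residual N e m (\<lambda>i. if i = j then 1 else 0)"
  have "(\<Sum>j<N. \<Sum>i<N. (?r j i)\<^sup>2) = 0" using residual_unit_norms assms by simp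
  then have r0: "?r j i = 0" if "i < N" "j < N" for i j
    using that by (simp add: sum_nonneg_eq_0_iff sum_nonneg)
  have "(\<Sum>k<N. e k i * e k j) = (if i = j then 1 else 0)" if ij: "i < N" "j < N" for i j
  proof -
    have "(\<Sum>i<N. e k i * (if i = j then 1 else 0)) = e k j" for k
      using sum_delta_lessThan[OF ij(2), of "e k"] by (simp add: eq_commute)
    then show ?thesis using r0[OF ij] by (simp add: residual_def assms mult.commute)
  qed
  then show ?thesis using on assms by (simp add: orthobasis_def)
qed

end

lemma mult_mv_add_scale:
  "mult_mv N A (\<lambda>i. x i + s * u i) i = mult_mv N A x i + s * mult_mv N A u i"
  by (simp add: mult_mv_def distrib_left sum.distrib sum_distrib_left mult_ac)

lemma quad_add_scale:
  assumes "sym_on N A"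
  shows "quad N A (\<lambda>i. x i + s * u i) = quad N A x + 2 * s * (\<Sum>i<N. u i * mult_mv N A x i) + s\<^sup>2 * quad N A u"
proof -
  have "quad N A (\<lambda>i. x i + s * u i) = quad N A x + s * (\<Sum>i<N. u i * mult_mv N A x i)
      + s * (\<Sum>i<N. x i * mult_mv N A u i) + s\<^sup>2 * quad N A u"
    unfolding quad_def mult_mv_add_scale
    by (simp add: distrib_left distrib_right sum.distrib sum_distrib_left power2_eq_square mult_ac)
  also have "(\<Sum>i<N. x i * mult_mv N A u i) = (\<Sum>i<N. u i * mult_mv N A x i)"
    by (subst mult_mv_adjoint[OF assms]) (simp add: mult.commute)
  finally show ?thesis by simp
qed

lemma quad_scale_arg: "quad N A (\<lambda>i. s * x i) = s\<^sup>2 * quad N A x"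
  by (simp add: quad_def mult_mv_def sum_distrib_left power2_eq_square mult_ac)

lemma quad_arg_cong: "(\<And>i. i < N \<Longrightarrow> x i = y i) \<Longrightarrow> quad N A x = quad N A y"
  by (simp add: quad_def mult_mv_def)

text \<open>A maximiser of the form on the unit sphere of the complement exists by compactness; the
  first variation shows that it is an eigenvector.\<close>

lemma rayleigh_step:
  fixes e :: "nat \<Rightarrow> nat \<Rightarrow> real"
  assumes A: "sym_on N A" and m: "m < N"
    and on: "\<And>k l. k < m \<Longrightarrow> l < m \<Longrightarrow> (\<Sum>i<N. e k i * e l i) = (if k = l then 1 else 0)"
    and ev: "\<And>k i. k < m \<Longrightarrow> i < N \<Longrightarrow> mult_mv N A (e k) i = l k * e k i"
  shows "\<exists>x \<mu>. (\<Sum>i<N. (x i)\<^sup>2) = 1 \<and> (\<forall>k<m. (\<Sum>i<N. e k i * x i) = 0) \<and>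
    (\<forall>i<N. mult_mv N A x i = \<mu> * x i) \<and>
    (\<forall>y. (\<forall>k<m. (\<Sum>i<N. e k i * y i) = 0) \<longrightarrow> quad N A y \<le> \<mu> * (\<Sum>i<N. (y i)\<^sup>2))"
proof -
  define B where "B = {x :: nat \<Rightarrow> real. \<forall>i. x i \<in> (if i < N then {-1..1} else {0})}"
  define K where "K = B \<inter> {x. (\<Sum>i<N. (x i)\<^sup>2) = 1} \<inter> (\<Inter>k\<in>{..<m}. {x. (\<Sum>i<N. e k i * x i) = 0})"
  have "compact B" unfolding B_def by (rule compact_box) auto
  moreover have "closed {x :: nat \<Rightarrow> real. (\<Sum>i<N. (x i)\<^sup>2) = 1}"
    by (intro closed_Collect_eq continuous_intros continuous_on_product_coordinates)
  moreover have "closed (\<Inter>k\<in>{..<m}. {x :: nat \<Rightarrow> real. (\<Sum>i<N. e k i * x i) = 0})"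
    by (intro closed_INT ballI closed_Collect_eq continuous_intros continuous_on_product_coordinates)
  ultimately have "compact K" unfolding K_def by (intro compact_Int_closed)
  have inK: "(\<lambda>i. if i < N then x i else 0) \<in> K"
    if "(\<Sum>i<N. (x i)\<^sup>2) = 1" "\<And>k. k < m \<Longrightarrow> (\<Sum>i<N. e k i * x i) = 0" for x
  proof -
    have "\<bar>x i\<bar> \<le> 1" if i: "i < N" for i
    proof -
      have "(x i)\<^sup>2 \<le> (\<Sum>i<N. (x i)\<^sup>2)" using i by (intro member_le_sum) auto
      then show ?thesis using \<open>(\<Sum>i<N. (x i)\<^sup>2) = 1\<close> by (simp add: abs_square_le_1)
    qed
    then show ?thesis using that by (auto simp: K_def B_def abs_le_iff)
  qed
  obtain x0 where "(\<Sum>i<N. (x0 i)\<^sup>2) = 1" "\<And>k. k < m \<Longrightarrow> (\<Sum>i<N. e k i * x0 i) = 0"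
    using unit_orthogonal_exists[OF on m] by metis
  then have "K \<noteq> {}" using inK by blast
  have "continuous_on K (quad N A)"
    unfolding quad_def [abs_def] mult_mv_def
    by (intro continuous_intros continuous_on_subset[OF continuous_on_product_coordinates]) auto
  then obtain x where x: "x \<in> K" "\<And>y. y \<in> K \<Longrightarrow> quad N A y \<le> quad N A x"
    using continuous_attains_sup[OF \<open>compact K\<close> \<open>K \<noteq> {}\<close>] by blast
  define \<mu> where "\<mu> = quad N A x"
  have x1: "(\<Sum>i<N. (x i)\<^sup>2) = 1" and xe: "\<And>k. k < m \<Longrightarrow> (\<Sum>i<N. e k i * x i) = 0"
    using x(1) by (auto simp: K_def)
  have max: "quad N A y \<le> \<mu> * (\<Sum>i<N. (y i)\<^sup>2)"
    if y: "\<And>k. k < m \<Longrightarrow> (\<Sum>i<N. e k i * y i) = 0" for y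
  proof (cases "(\<Sum>i<N. (y i)\<^sup>2) = 0")
    case True
    then have "\<And>i. i < N \<Longrightarrow> y i = 0" by (simp add: sum_nonneg_eq_0_iff)
    then show ?thesis using True by (simp add: quad_def)
  next
    case False
    define n where "n = sqrt (\<Sum>i<N. (y i)\<^sup>2)"
    have n2: "n\<^sup>2 = (\<Sum>i<N. (y i)\<^sup>2)" unfolding n_def by (simp add: sum_nonneg)
    have n0: "n \<noteq> 0" using False n2 by auto
    let ?z = "\<lambda>i. inverse n * y i"
    have "(\<Sum>i<N. (?z i)\<^sup>2) = 1" using False
      by (simp add: power_mult_distrib sum_distrib_left [symmetric] n2 power_inverse)
    moreover have "(\<Sum>i<N. e k i * ?z i) = 0" if "k < m" for k
      using y[OF that] by (simp add: mult.left_commute sum_distrib_left [symmetric])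
    ultimately have "quad N A (\<lambda>i. if i < N then ?z i else 0) \<le> \<mu>"
      unfolding \<mu>_def by (intro x(2) inK) auto
    also have "quad N A (\<lambda>i. if i < N then ?z i else 0) = quad N A ?z" by (rule quad_arg_cong) simp
    finally have "inverse n ^ 2 * quad N A y \<le> \<mu>" by (simp add: quad_scale_arg)
    then have "n\<^sup>2 * (inverse n ^ 2 * quad N A y) \<le> n\<^sup>2 * \<mu>" by (intro mult_left_mono) auto
    moreover have "n\<^sup>2 * (inverse n ^ 2 * quad N A y) = quad N A y" using n0 by (simp add: power_inverse)
    ultimately have "quad N A y \<le> n\<^sup>2 * \<mu>" by (simp only:)
    then show ?thesis by (simp only: n2 mult.commute)
  qed
  \<comment> \<open>The defect of the eigenvector equation is itself an admissible direction, since
    A preserves the complement. Moving x by s u changes the form minus \<mu> times the squared norm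
    by 2 s |u|^2 + O(s^2).\<close>
  define u where "u i = mult_mv N A x i - \<mu> * x i" for i
  have ue: "(\<Sum>i<N. e k i * u i) = 0" if k: "k < m" for k
  proof -
    have "(\<Sum>i<N. e k i * mult_mv N A x i) = (\<Sum>i<N. l k * (e k i * x i))"
      unfolding mult_mv_adjoint[OF A] using ev[OF k] by (simp add: mult.assoc)
    also have "\<dots> = 0" using xe[OF k] by (simp add: sum_distrib_left [symmetric])
    finally have Ax: "(\<Sum>i<N. e k i * mult_mv N A x i) = 0" .
    have "(\<Sum>i<N. e k i * u i) = (\<Sum>i<N. e k i * mult_mv N A x i - \<mu> * (e k i * x i))"
      by (intro sum.cong refl) (simp add: u_def algebra_simps)
    then show ?thesis unfolding sum_subtractf sum_distrib_left [symmetric] Ax xe[OF k] by simp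
  qed
  define U where "U = (\<Sum>i<N. (u i)\<^sup>2)"
  define c where "c = quad N A u - \<mu> * U"
  have var: "2 * s * U + s\<^sup>2 * c \<le> 0" for s
  proof -
    have "quad N A (\<lambda>i. x i + s * u i) \<le> \<mu> * (\<Sum>i<N. (x i + s * u i)\<^sup>2)"
    proof (rule max)
      fix k assume k: "k < m"
      have "(\<Sum>i<N. e k i * (x i + s * u i)) = (\<Sum>i<N. e k i * x i + s * (e k i * u i))"
        by (intro sum.cong refl) (simp add: algebra_simps)
      then show "(\<Sum>i<N. e k i * (x i + s * u i)) = 0"
        unfolding sum.distrib sum_distrib_left [symmetric] xe[OF k] ue[OF k] by simp
    qed
    moreover have "(\<Sum>i<N. (x i + s * u i)\<^sup>2) = (\<Sum>i<N. (x i)\<^sup>2 + 2 * s * (u i * x i) + s\<^sup>2 * (u i)\<^sup>2)"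
      by (intro sum.cong refl) (simp add: power2_eq_square algebra_simps)
    then have "(\<Sum>i<N. (x i + s * u i)\<^sup>2) = 1 + 2 * s * (\<Sum>i<N. u i * x i) + s\<^sup>2 * U"
      by (simp add: sum.distrib sum_distrib_left [symmetric] x1 U_def)
    moreover have "U = (\<Sum>i<N. u i * mult_mv N A x i) - \<mu> * (\<Sum>i<N. u i * x i)"
    proof -
      have "U = (\<Sum>i<N. u i * mult_mv N A x i - \<mu> * (u i * x i))"
        unfolding U_def by (intro sum.cong refl) (simp add: u_def power2_eq_square algebra_simps)
      then show ?thesis by (simp add: sum_subtractf sum_distrib_left)
    qed
    moreover have "2 * s * U + s\<^sup>2 * (q - \<mu> * U) \<le> 0"
      if "\<mu> + 2 * s * a + s\<^sup>2 * q \<le> \<mu> * X" "X = 1 + 2 * s * w + s\<^sup>2 * U" "U = a - \<mu> * w" for a q X w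
    proof -
      have "a = U + \<mu> * w" using that(3) by simp
      then show ?thesis using that(1) unfolding that(2) by (simp add: algebra_simps)
    qed
    ultimately show ?thesis
      unfolding quad_add_scale[OF A] c_def \<mu>_def [symmetric] by blast
  qed
  have "U = 0"
  proof (rule ccontr)
    assume "U \<noteq> 0"
    then have U: "0 < U" unfolding U_def by (simp add: sum_nonneg order.not_eq_order_implies_strict)
    \<comment> \<open>So small that the second-order term s c is at most U in size and cannot offset
      2 U.\<close>
    define s where "s = U / (\<bar>c\<bar> + 1)"
    have s: "0 < s" unfolding s_def using U by simp
    have "s * (2 * U + s * c) \<le> 0" using var[of s] by (simp add: algebra_simps power2_eq_square)
    then have "2 * U + s * c \<le> 0" using s by (simp add: mult_le_0_iff)
    moreover have "- (s * c) \<le> s * (\<bar>c\<bar> + 1)"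
      using mult_left_mono[of "- c" "\<bar>c\<bar> + 1" s] s by simp
    moreover have "s * (\<bar>c\<bar> + 1) = U" by (simp add: s_def)
    ultimately show False using U by linarith
  qed
  then have "\<And>i. i < N \<Longrightarrow> u i = 0" by (simp add: U_def sum_nonneg_eq_0_iff)
  then have "\<forall>i<N. mult_mv N A x i = \<mu> * x i" by (simp add: u_def)
  with x1 xe max show ?thesis by (intro exI[of _ x] exI[of _ \<mu>]) blast
qed

text \<open>Each new eigenvalue is a maximum over the complement of the earlier eigenvectors, so the
  eigenvalues come out in decreasing order, as needed to match \<open>eigval\<close>.\<close>

lemma symmetric_eigenbasis:
  assumes A: "sym_on N A"
  obtains e l where "orthobasis N e" "\<And>i j. i < N \<Longrightarrow> j < N \<Longrightarrow> A i j = spec_mat N e l i j"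
    "\<And>j k. j \<le> k \<Longrightarrow> k < N \<Longrightarrow> l k \<le> l j"
proof -
  have ex: "m \<le> N \<Longrightarrow> \<exists>e l. (\<forall>k<m. \<forall>j<m. (\<Sum>i<N. e k i * e j i) = (if k = j then 1 else 0)) \<and>
      (\<forall>k<m. \<forall>i<N. mult_mv N A (e k) i = l k * e k i) \<and>
      (\<forall>k<m. \<forall>y. (\<forall>j<k. (\<Sum>i<N. e j i * y i) = 0) \<longrightarrow> quad N A y \<le> l k * (\<Sum>i<N. (y i)\<^sup>2))" for m
  proof (induction m)
    case 0
    then show ?case by simp
  next
    case (Suc m)
    then obtain e l where on: "\<forall>k<m. \<forall>j<m. (\<Sum>i<N. e k i * e j i) = (if k = j then 1 else 0)"
      and ev: "\<forall>k<m. \<forall>i<N. mult_mv N A (e k) i = l k * e k i"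
      and mx: "\<forall>k<m. \<forall>y. (\<forall>j<k. (\<Sum>i<N. e j i * y i) = 0) \<longrightarrow> quad N A y \<le> l k * (\<Sum>i<N. (y i)\<^sup>2)"
      by auto
    have m: "m < N" using Suc.prems by simp
    have "\<exists>x \<mu>. (\<Sum>i<N. (x i)\<^sup>2) = 1 \<and> (\<forall>k<m. (\<Sum>i<N. e k i * x i) = 0) \<and>
    (\<forall>i<N. mult_mv N A x i = \<mu> * x i) \<and>
    (\<forall>y. (\<forall>k<m. (\<Sum>i<N. e k i * y i) = 0) \<longrightarrow> quad N A y \<le> \<mu> * (\<Sum>i<N. (y i)\<^sup>2))"
      by (rule rayleigh_step[OF A m]) (use on ev in auto)
    then obtain x \<mu> where x: "(\<Sum>i<N. (x i)\<^sup>2) = 1" "\<forall>k<m. (\<Sum>i<N. e k i * x i) = 0"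
      "\<forall>i<N. mult_mv N A x i = \<mu> * x i"
      "\<forall>y. (\<forall>k<m. (\<Sum>i<N. e k i * y i) = 0) \<longrightarrow> quad N A y \<le> \<mu> * (\<Sum>i<N. (y i)\<^sup>2)"
      by blast
    let ?e = "e(m := x)" and ?l = "l(m := \<mu>)"
    have xe: "(\<Sum>i<N. x i * e k i) = 0" if "k < m" for k using x(2) that by (simp add: mult.commute)
    have xx: "(\<Sum>i<N. x i * x i) = 1" using x(1) by (simp add: power2_eq_square)
    have "\<forall>k<Suc m. \<forall>j<Suc m. (\<Sum>i<N. ?e k i * ?e j i) = (if k = j then 1 else 0)"
      using on x(2) xe xx by (auto simp: less_Suc_eq)
    moreover have "\<forall>k<Suc m. \<forall>i<N. mult_mv N A (?e k) i = ?l k * ?e k i"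
      using ev x(3) by (auto simp: less_Suc_eq)
    moreover have "\<forall>k<Suc m. \<forall>y. (\<forall>j<k. (\<Sum>i<N. ?e j i * y i) = 0) \<longrightarrow> quad N A y \<le> ?l k * (\<Sum>i<N. (y i)\<^sup>2)"
    proof (intro allI impI)
      fix k y assume k: "k < Suc m" and y: "\<forall>j<k. (\<Sum>i<N. ?e j i * y i) = 0"
      have y': "(\<Sum>i<N. e j i * y i) = 0" if "j < k" for j using y[rule_format, OF that] that k by simp
      show "quad N A y \<le> ?l k * (\<Sum>i<N. (y i)\<^sup>2)"
        using x(4) mx y' k by (cases "k = m") auto
    qed
    ultimately show ?case by blast
  qed
  obtain e l where on: "\<forall>k<N. \<forall>j<N. (\<Sum>i<N. e k i * e j i) = (if k = j then 1 else 0)"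
    and ev: "\<forall>k<N. \<forall>i<N. mult_mv N A (e k) i = l k * e k i"
    and mx: "\<forall>k<N. \<forall>y. (\<forall>j<k. (\<Sum>i<N. e j i * y i) = 0) \<longrightarrow> quad N A y \<le> l k * (\<Sum>i<N. (y i)\<^sup>2)"
    using ex[OF order_refl] by (elim exE conjE) (rule that)
  have e: "orthobasis N e" using on by (intro orthonormal_complete[where m = N]) auto
  show ?thesis
  proof (rule that[OF e])
    fix i j assume ij: "i < N" "j < N"
    have "spec_mat N e l i j = (\<Sum>k<N. mult_mv N A (e k) i * e k j)"
      unfolding spec_mat_def using ev ij by simp
    also have "\<dots> = (\<Sum>k<N. \<Sum>n<N. A i n * (e k j * e k n))"
      unfolding mult_mv_def sum_distrib_right by (intro sum.cong refl) (simp add: mult_ac)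
    also have "\<dots> = (\<Sum>n<N. \<Sum>k<N. A i n * (e k j * e k n))" by (rule sum.swap)
    also have "\<dots> = (\<Sum>n<N. A i n * (if j = n then 1 else 0))"
      using ij by (simp add: sum_distrib_left [symmetric] complete[OF e])
    also have "\<dots> = A i j" using ij by (intro sum_delta_lessThan)
    finally show "A i j = spec_mat N e l i j" by simp
  next
    fix j k assume jk: "j \<le> k" "k < N"
    have k1: "(\<Sum>i<N. (e k i)\<^sup>2) = 1" by (rule basis_vector_norm[OF e jk(2)])
    have "quad N A (e k) = l k * (\<Sum>i<N. (e k i)\<^sup>2)"
      using ev jk by (simp add: quad_def power2_eq_square sum_distrib_left mult_ac)
    moreover have "quad N A (e k) \<le> l j * (\<Sum>i<N. (e k i)\<^sup>2)" using mx on jk by auto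
    ultimately show "l k \<le> l j" by (simp add: k1)
  qed
qed

section \<open>Agreement with the ordered roots of the characteristic polynomial\<close>

lemma proots_linear_factors:
  "proots (\<Prod>a\<leftarrow>xs. [:- a, 1:]) = mset (xs :: real list)"
proof (induction xs)
  case (Cons a xs)
  have "(\<Prod>a\<leftarrow>xs. [:- a, 1:]) \<noteq> 0" by (auto simp: prod_list_zero_iff)
  then have "proots ([:- a, 1:] * (\<Prod>a\<leftarrow>xs. [:- a, 1:])) = proots [:- a, 1:] + proots (\<Prod>a\<leftarrow>xs. [:- a, 1:])"
    by (intro proots_mult) auto
  then show ?case using Cons.IH by (simp only: list.map prod_list.Cons proots_linear_factor) simp
qed simp

text \<open>The eigenvectors form an orthogonal matrix that conjugates A to a diagonal one, with the
  same characteristic polynomial. \<open>eigval\<close> counts from 1 and \<open>l\<close> from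
  0.\<close>

lemma eigval_spectral:
  assumes A: "A \<in> carrier_mat N N" and e: "orthobasis N e"
    and sp: "\<And>i j. i < N \<Longrightarrow> j < N \<Longrightarrow> A $$ (i, j) = spec_mat N e l i j"
    and l: "\<And>j k. j \<le> k \<Longrightarrow> k < N \<Longrightarrow> l k \<le> l j"
    and k: "k < N"
  shows "eigval (Suc k) A = l k"
proof -
  define U where "U = mat N N (\<lambda>(i, k). e k i)"
  define L where "L = mat N N (\<lambda>(i, j). if i = j then l i else 0)"
  have car: "U \<in> carrier_mat N N" "L \<in> carrier_mat N N" "U\<^sup>T \<in> carrier_mat N N"
    by (auto simp: U_def L_def)
  have "U * U\<^sup>T = 1\<^sub>m N"
    by (rule eq_matI) (auto simp: U_def scalar_prod_def atLeast0LessThan complete[OF e])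
  moreover have "U\<^sup>T * U = 1\<^sub>m N"
    by (rule eq_matI) (auto simp: U_def scalar_prod_def atLeast0LessThan orthonormal[OF e])
  moreover have "A = U * L * U\<^sup>T"
  proof (rule eq_matI)
    fix i j assume "i < dim_row (U * L * U\<^sup>T)" "j < dim_col (U * L * U\<^sup>T)"
    then have ij: "i < N" "j < N" by (auto simp: U_def)
    have UL: "(U * L) $$ (i, k) = l k * e k i" if "k < N" for k
    proof -
      have "(U * L) $$ (i, k) = (\<Sum>n<N. e n i * (if n = k then l n else 0))"
        using ij that by (simp add: U_def L_def scalar_prod_def atLeast0LessThan)
      also have "\<dots> = (\<Sum>n<N. e n i * l n * (if k = n then 1 else 0))" by (intro sum.cong) auto
      finally show ?thesis using that by (simp add: sum_delta_lessThan)
    qed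
    have "(U * L * U\<^sup>T) $$ (i, j) = (\<Sum>k<N. (U * L) $$ (i, k) * U $$ (j, k))"
      by (subst index_mult_mat(1)) (use ij car in \<open>auto simp: scalar_prod_def atLeast0LessThan\<close>)
    also have "\<dots> = (\<Sum>k<N. l k * e k i * e k j)"
      using ij UL by (intro sum.cong) (auto simp: U_def)
    finally show "A $$ (i, j) = (U * L * U\<^sup>T) $$ (i, j)" using sp[OF ij] by (simp add: spec_mat_def)
  qed (use A in \<open>auto simp: U_def\<close>)
  ultimately have "similar_mat_wit A L U (U\<^sup>T)"
    using A car by (intro similar_mat_witI[of _ _ N]) auto
  then have "similar_mat A L" unfolding similar_mat_def by blast
  then have "char_poly A = char_poly L" by (rule char_poly_similar)
  also have "\<dots> = (\<Prod>a\<leftarrow>diag_mat L. [:- a, 1:])"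
    by (rule char_poly_upper_triangular[OF car(2)]) (auto simp: L_def upper_triangular_def)
  also have "diag_mat L = map l [0..<N]"
    by (auto simp: diag_mat_def L_def)
  finally have "proots (char_poly A) = mset (map l [0..<N])" by (simp only: proots_linear_factors)
  moreover have "sorted_list_of_multiset (mset (map l [0..<N])) = rev (map l [0..<N])"
  proof -
    have "sorted (rev (map l [0..<N]))"
      by (auto simp: sorted_rev_iff_nth_mono l)
    then have "sort (map l [0..<N]) = rev (map l [0..<N])"
      by (intro properties_for_sort) (auto)
    then show ?thesis by (simp only: sorted_list_of_multiset_mset)
  qed
  ultimately show ?thesis using k by (simp only: eigval_def) simp
qed

section \<open>Subcritical quadratic forms\<close>

text \<open>Eigenvalues exceeding \<open>\<eta>\<close> are few and are linearised, those in \<open>[-\<eta>, \<eta>]\<close> are at high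
  temperature once their diagonal is removed, and those below \<open>-\<eta>\<close> are dropped.\<close>

lemma tilted_quadratic_bound:
  fixes \<beta> q \<Lambda> :: real
  assumes pos: "0 < \<beta>" "0 \<le> q" "0 < \<Lambda>" and sub: "\<beta> * \<Lambda> * q < 1"
  obtains C where "0 \<le> C" "\<And>N e l D h M c v.
    orthobasis N e \<Longrightarrow> (\<And>i j. i < N \<Longrightarrow> j < N \<Longrightarrow> D i j = spec_mat N e l i j) \<Longrightarrow>
    (\<And>k. k < N \<Longrightarrow> l k \<le> \<Lambda>) \<Longrightarrow>
    (\<And>k. k < N \<Longrightarrow> l k \<noteq> 0 \<Longrightarrow> c * (\<Sum>i<N. e k i) = 0) \<Longrightarrow> 1 \<le> M \<Longrightarrow>
    (\<And>w. c * (\<Sum>i<N. w i) = 0 \<Longrightarrow>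
      spin_expect h N (\<lambda>\<sigma>. exp (\<Sum>i<N. w i * (\<sigma> i - tanh h))) \<le> M * exp (q * (\<Sum>i<N. (w i)\<^sup>2) / 2)) \<Longrightarrow>
    spin_expect h N (\<lambda>\<sigma>. exp (\<beta> / 2 * quad N D (\<lambda>i. \<sigma> i - tanh h) + (\<Sum>i<N. v i * (\<sigma> i - tanh h))))
      \<le> M * exp (C * (frob N D + (\<Sum>i<N. \<bar>D i i\<bar>) + (\<Sum>i<N. (v i)\<^sup>2)))"
proof -
  \<comment> \<open>The Hoelder weight of the large eigenvalues: the midpoint between \<beta>
    \<Lambda> q and 1, so that a = \<beta> \<Lambda> / \<alpha> still satisfies a q < 1.\<close>
  define \<alpha> where "\<alpha> = (1 + \<beta> * \<Lambda> * q) / 2"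
  have bq: "0 \<le> \<beta> * \<Lambda> * q" using pos by simp
  have \<alpha>: "0 < \<alpha>" "\<alpha> < 1" "\<beta> * \<Lambda> * q < \<alpha>" 
    unfolding \<alpha>_def using sub bq by - (linarith | argo)+
  define a where "a = \<beta> * \<Lambda> / \<alpha>"
  have a: "0 < a" "a * q < 1" using pos \<alpha> by (auto simp: a_def field_simps)
  define G where "G = gauss_const a (a * (1 - a * q) / 2)"
  have G: "1 \<le> G" unfolding G_def using a by (intro gauss_const_ge_1) auto
  \<comment> \<open>The remaining weight 1 - \<alpha> is halved between the small eigenvalues and
    the linear term; \<open>b\<close> and \<open>p\<close> compensate for these weights.\<close>
  define b where "b = \<beta> / (1 - \<alpha>)"
  have b: "0 < b" using pos \<alpha> by (simp add: b_def)
  \<comment> \<open>The small part and its diagonal each have norm at most \<eta>, so the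
    off-diagonal part has norm at most 2 \<eta>; after scaling by 2 b this is 1/2, the threshold of
    \<open>high_temperature_bound\<close>.\<close>
  define \<eta> where "\<eta> = 1 / (8 * b)"
  have \<eta>: "0 < \<eta>" using b by (simp add: \<eta>_def)
  define p where "p = 2 / (1 - \<alpha>)"
  define C where "C = ln G / \<eta>\<^sup>2 + (32 * b\<^sup>2 + 4 * b * (1 + 1 / \<eta>)) + p\<^sup>2 / 2"
  have C0: "0 \<le> ln G / \<eta>\<^sup>2" "0 \<le> 32 * b\<^sup>2 + 4 * b * (1 + 1 / \<eta>)" "0 \<le> p\<^sup>2 / 2"
    using G b \<eta> by auto
  show ?thesis
  proof (rule that[of C])
    show "0 \<le> C" unfolding C_def using C0 by linarith
    fix N :: nat and e :: "nat \<Rightarrow> nat \<Rightarrow> real" and l :: "nat \<Rightarrow> real" and D :: "nat \<Rightarrow> nat \<Rightarrow> real"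
      and h M c :: real and v :: "nat \<Rightarrow> real"
    assume e: "orthobasis N e" and D: "\<And>i j. i < N \<Longrightarrow> j < N \<Longrightarrow> D i j = spec_mat N e l i j"
      and l: "\<And>k. k < N \<Longrightarrow> l k \<le> \<Lambda>"
      and c: "\<And>k. k < N \<Longrightarrow> l k \<noteq> 0 \<Longrightarrow> c * (\<Sum>i<N. e k i) = 0" and M: "1 \<le> M"
      and H: "\<And>w. c * (\<Sum>i<N. w i) = 0 \<Longrightarrow>
        spin_expect h N (\<lambda>\<sigma>. exp (\<Sum>i<N. w i * (\<sigma> i - tanh h))) \<le> M * exp (q * (\<Sum>i<N. (w i)\<^sup>2) / 2)"
    let ?Y = "\<lambda>\<sigma> i. \<sigma> i - tanh h"
    define F where "F = frob N D"
    define d where "d = (\<Sum>i<N. \<bar>D i i\<bar>)"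
    define r where "r = (\<Sum>i<N. (v i)\<^sup>2)"
    have "F = frob N (spec_mat N e l)" unfolding F_def by (rule frob_cong) (rule D)
    then have Fl: "F = (\<Sum>k<N. (l k)\<^sup>2)" by (simp add: frob_spec[OF e])
    have nonneg: "0 \<le> F" "0 \<le> d" "0 \<le> r" by (auto simp: F_def d_def r_def frob_nonneg sum_nonneg)
    define S where "S = {k. k < N \<and> \<eta> < l k}"
    define fQ where "fQ k = (if \<bar>l k\<bar> \<le> \<eta> then l k else 0)" for k
    define Q where "Q = spec_mat N e fQ"
    have S: "finite S" "S \<subseteq> {..<N}" by (auto simp: S_def)
    have cardS: "real (card S) \<le> F / \<eta>\<^sup>2"
    proof -
      have "real (card S) * \<eta>\<^sup>2 = (\<Sum>k\<in>S. \<eta>\<^sup>2)" by simp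
      also have "\<dots> \<le> (\<Sum>k\<in>S. (l k)\<^sup>2)" using \<eta> by (intro sum_mono power_mono) (auto simp: S_def)
      also have "\<dots> \<le> F" unfolding Fl using S by (intro sum_mono2) auto
      finally show ?thesis using \<eta> by (simp add: field_simps)
    qed
    have quad_D: "quad N D y \<le> \<Lambda> * (\<Sum>k\<in>S. (\<Sum>i<N. e k i * y i)\<^sup>2) + quad N Q y" for y
    proof -
      let ?x = "\<lambda>k. (\<Sum>i<N. e k i * y i)\<^sup>2"
      have "quad N D y = quad N (spec_mat N e l) y" by (rule quad_cong) (rule D)
      also have "\<dots> = (\<Sum>k<N. l k * ?x k)" by (rule quad_spec[OF e])
      also have "\<dots> \<le> (\<Sum>k<N. (if k \<in> S then \<Lambda> * ?x k else 0) + fQ k * ?x k)"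
        using l \<eta> by (intro sum_mono) (auto simp: S_def fQ_def mult_right_mono mult_nonpos_nonneg)
      also have "\<dots> = (\<Sum>k\<in>S. \<Lambda> * ?x k) + quad N Q y"
      proof -
        have "{..<N} \<inter> S = S" using S by auto
        then show ?thesis
          by (simp add: sum.distrib quad_spec[OF e] Q_def sum.inter_restrict[symmetric])
      qed
      finally show ?thesis by (simp add: sum_distrib_left)
    qed
    have Qii_le: "\<bar>Q i i\<bar> \<le> \<eta>" if i: "i < N" for i
    proof -
      have "\<bar>Q i i\<bar> \<le> (\<Sum>k<N. \<bar>fQ k * e k i * e k i\<bar>)" unfolding Q_def spec_mat_def by (rule sum_abs)
      also have "\<dots> \<le> (\<Sum>k<N. \<eta> * (e k i)\<^sup>2)"
        using \<eta> by (intro sum_mono) (auto simp: fQ_def abs_mult power2_eq_square mult.assoc intro!: mult_right_mono)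
      also have "\<dots> = \<eta>" using basis_entry_sum[OF e i] by (simp add: sum_distrib_left [symmetric])
      finally show ?thesis .
    qed
    \<comment> \<open>Truncation spoils the diagonal, but only by eigenvalues with |l k| > \<eta>,
      for which |l k| <= (l k)^2 / \<eta>. Hence the new diagonal costs a multiple of the squared
      Frobenius norm instead of N \<eta>.\<close>
    have Q_trace: "(\<Sum>i<N. \<bar>Q i i\<bar>) \<le> d + F / \<eta>"
    proof -
      have "\<bar>Q i i\<bar> \<le> \<bar>D i i\<bar> + (\<Sum>k<N. (l k)\<^sup>2 / \<eta> * (e k i)\<^sup>2)" if i: "i < N" for i
      proof -
        have "\<bar>D i i - Q i i\<bar> = \<bar>\<Sum>k<N. (l k - fQ k) * (e k i)\<^sup>2\<bar>"
          unfolding D[OF i i] Q_def spec_mat_def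
          by (simp add: sum_subtractf [symmetric] algebra_simps power2_eq_square)
        also have "\<dots> \<le> (\<Sum>k<N. \<bar>(l k - fQ k) * (e k i)\<^sup>2\<bar>)" by (rule sum_abs)
        also have "\<dots> \<le> (\<Sum>k<N. (l k)\<^sup>2 / \<eta> * (e k i)\<^sup>2)"
        proof (intro sum_mono)
          fix k
          have "\<bar>l k - fQ k\<bar> \<le> (l k)\<^sup>2 / \<eta>"
          proof (cases "\<bar>l k\<bar> \<le> \<eta>")
            case False
            then have "\<eta> * \<bar>l k\<bar> \<le> \<bar>l k\<bar> * \<bar>l k\<bar>" by (intro mult_right_mono) auto
            then show ?thesis using False \<eta> by (simp add: fQ_def field_simps power2_eq_square)
          qed (use \<eta> in \<open>auto simp: fQ_def\<close>)
          then show "\<bar>(l k - fQ k) * (e k i)\<^sup>2\<bar> \<le> (l k)\<^sup>2 / \<eta> * (e k i)\<^sup>2"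
            unfolding abs_mult by (simp only: abs_power2) (intro mult_right_mono, auto)
        qed
        finally show ?thesis by linarith
      qed
      then have "(\<Sum>i<N. \<bar>Q i i\<bar>) \<le> (\<Sum>i<N. \<bar>D i i\<bar> + (\<Sum>k<N. (l k)\<^sup>2 / \<eta> * (e k i)\<^sup>2))"
        by (intro sum_mono) auto
      also have "\<dots> = d + (\<Sum>k<N. \<Sum>i<N. (l k)\<^sup>2 / \<eta> * (e k i)\<^sup>2)"
        unfolding sum.distrib d_def by (subst sum.swap) simp
      also have "\<dots> = d + F / \<eta>"
        unfolding sum_distrib_left [symmetric] by (simp add: basis_vector_norm[OF e] Fl sum_divide_distrib)
      finally show ?thesis .
    qed
    define Q0 where "Q0 = (\<lambda>i j. if i = j then 0 else Q i j)"
    define R where "R = (\<lambda>i j. 2 * b * Q0 i j)"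
    have b\<eta>: "2 * b * (2 * \<eta>) = 1 / 2" using b by (simp add: \<eta>_def)
    have R_small: "(\<Sum>i<N. (mult_mv N R y i)\<^sup>2) \<le> (\<Sum>i<N. (y i)\<^sup>2) / 4" for y
    proof -
      have "(mult_mv N R y i)\<^sup>2 \<le> (2 * b)\<^sup>2 * (2 * (mult_mv N Q y i)\<^sup>2 + 2 * (\<eta>\<^sup>2 * (y i)\<^sup>2))" if i: "i < N" for i
      proof -
        have "(Q i i * y i)\<^sup>2 \<le> \<eta>\<^sup>2 * (y i)\<^sup>2" unfolding power_mult_distrib
          using Qii_le[OF i] by (intro mult_right_mono power2_le_iff_abs_le[THEN iffD2]) (use \<eta> in auto)
        moreover have "(mult_mv N Q y i - Q i i * y i)\<^sup>2 \<le> 2 * (mult_mv N Q y i)\<^sup>2 + 2 * (Q i i * y i)\<^sup>2"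
          using zero_le_power2[of "mult_mv N Q y i + Q i i * y i"] by (simp add: power2_eq_square algebra_simps)
        ultimately show ?thesis
          unfolding R_def mult_mv_scale Q0_def mult_mv_off_diag[OF i] power_mult_distrib[of "2 * b"]
          by (intro mult_left_mono) auto
      qed
      then have "(\<Sum>i<N. (mult_mv N R y i)\<^sup>2) \<le> (\<Sum>i<N. (2 * b)\<^sup>2 * (2 * (mult_mv N Q y i)\<^sup>2 + 2 * (\<eta>\<^sup>2 * (y i)\<^sup>2)))"
        by (intro sum_mono) auto
      also have "\<dots> = (2 * b)\<^sup>2 * (2 * (\<Sum>i<N. (mult_mv N Q y i)\<^sup>2) + 2 * (\<eta>\<^sup>2 * (\<Sum>i<N. (y i)\<^sup>2)))"
        by (simp only: sum_distrib_left [symmetric] sum.distrib)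
      also have "(\<Sum>i<N. (mult_mv N Q y i)\<^sup>2) \<le> \<eta>\<^sup>2 * (\<Sum>i<N. (y i)\<^sup>2)"
      proof -
        have "(\<Sum>i<N. (mult_mv N Q y i)\<^sup>2) \<le> (\<Sum>k<N. \<eta>\<^sup>2 * (\<Sum>i<N. e k i * y i)\<^sup>2)"
          unfolding Q_def norm_mult_mv_spec[OF e]
          using \<eta> by (intro sum_mono mult_right_mono power2_le_iff_abs_le[THEN iffD2]) (auto simp: fQ_def)
        then show ?thesis by (simp add: sum_distrib_left [symmetric] parseval[OF e])
      qed
      then have "(2 * b)\<^sup>2 * (2 * (\<Sum>i<N. (mult_mv N Q y i)\<^sup>2) + 2 * (\<eta>\<^sup>2 * (\<Sum>i<N. (y i)\<^sup>2)))
          \<le> (2 * b)\<^sup>2 * (2 * (\<eta>\<^sup>2 * (\<Sum>i<N. (y i)\<^sup>2)) + 2 * (\<eta>\<^sup>2 * (\<Sum>i<N. (y i)\<^sup>2)))"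
        by (intro mult_left_mono add_mono) auto
      also have "\<dots> = (2 * b * (2 * \<eta>))\<^sup>2 * (\<Sum>i<N. (y i)\<^sup>2)" by (simp add: power2_eq_square)
      also have "\<dots> = (\<Sum>i<N. (y i)\<^sup>2) / 4" unfolding b\<eta> by (simp add: power2_eq_square)
      finally show ?thesis .
    qed
    have R_frob: "frob N R \<le> 4 * b\<^sup>2 * F"
    proof -
      have "frob N R = 4 * b\<^sup>2 * frob N Q0"
        by (simp add: frob_def R_def power_mult_distrib sum_distrib_left)
      also have "frob N Q0 \<le> frob N Q" unfolding Q0_def by (rule frob_off_diag_le)
      also have "frob N Q \<le> F" unfolding Q_def frob_spec[OF e] Fl
        by (intro sum_mono) (auto simp: fQ_def)
      finally show ?thesis using b by (simp add: mult_left_mono)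
    qed
    have R_sym: "sym_on N R" "\<And>i. i < N \<Longrightarrow> R i i = 0"
      using sym_on_spec[OF e, of fQ] by (auto simp: R_def Q0_def Q_def sym_on_def)
    define X1 where "X1 \<sigma> = a * (\<Sum>k\<in>S. (\<Sum>i<N. e k i * ?Y \<sigma> i)\<^sup>2) / 2" for \<sigma>
    define X2 where "X2 \<sigma> = b * quad N Q (?Y \<sigma>)" for \<sigma>
    define X3 where "X3 \<sigma> = (\<Sum>i<N. p * v i * ?Y \<sigma> i)" for \<sigma>
    \<comment> \<open>\<open>M\<close> enters through this factor alone. Since M >= 1, its Hoelder
      power \<alpha> is at most M.\<close>
    have E1: "spin_expect h N (\<lambda>\<sigma>. exp (X1 \<sigma>)) \<le> exp (ln M + ln G / \<eta>\<^sup>2 * F)"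
    proof -
      have "spin_expect h N (\<lambda>\<sigma>. exp ((\<Sum>i<N. 0 * ?Y \<sigma> i) + X1 \<sigma>))
          \<le> M * gauss_const a (a * (1 - a * q) / 2) ^ card S * exp (q * (\<Sum>i<N. 0\<^sup>2) / 2)"
        unfolding X1_def
      proof (rule spin_expect_squares[where c = c])
        show "\<And>k l. k \<in> S \<Longrightarrow> l \<in> S \<Longrightarrow> (\<Sum>i<N. e k i * e l i) = (if k = l then 1 else 0)"
          using S orthonormal[OF e] by blast
        show "\<And>k. k \<in> S \<Longrightarrow> c * sum (e k) {..<N} = 0" using c \<eta> by (auto simp: S_def)
      qed (use a M S H in auto)
      also have "\<dots> = exp (ln M + ln G * real (card S))"
        using M G by (simp add: G_def [symmetric] exp_add exp_of_nat2_mult)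
      also have "\<dots> \<le> exp (ln M + ln G / \<eta>\<^sup>2 * F)"
        using mult_left_mono[OF cardS, of "ln G"] G by simp
      finally show ?thesis by simp
    qed
    have E2: "spin_expect h N (\<lambda>\<sigma>. exp (X2 \<sigma>)) \<le> exp (32 * b\<^sup>2 * F + 4 * b * (d + F / \<eta>))"
    proof -
      have "X2 \<sigma> \<le> quad N R (?Y \<sigma>) / 2 + 4 * b * (d + F / \<eta>)" if s: "\<sigma> \<in> spins N" for \<sigma>
      proof -
        have "X2 \<sigma> = quad N R (?Y \<sigma>) / 2 + b * (\<Sum>i<N. Q i i * (?Y \<sigma> i)\<^sup>2)"
          unfolding X2_def quad_off_diag[of N Q] R_def quad_scale Q0_def by (simp add: algebra_simps)
        also have "(\<Sum>i<N. Q i i * (?Y \<sigma> i)\<^sup>2) \<le> (\<Sum>i<N. \<bar>Q i i\<bar> * 4)"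
        proof (intro sum_mono)
          fix i assume "i \<in> {..<N}"
          then have "\<bar>?Y \<sigma> i\<bar> \<le> 2" using spins_abs[OF s, of i] abs_tanh_le_1[of h] by auto
          then have "(?Y \<sigma> i)\<^sup>2 \<le> 2\<^sup>2" by (intro power2_le_iff_abs_le[THEN iffD2]) auto
          then have "\<bar>Q i i\<bar> * (?Y \<sigma> i)\<^sup>2 \<le> \<bar>Q i i\<bar> * 4" by (intro mult_left_mono) auto
          moreover have "Q i i * (?Y \<sigma> i)\<^sup>2 \<le> \<bar>Q i i\<bar> * (?Y \<sigma> i)\<^sup>2" by (intro mult_right_mono) auto
          ultimately show "Q i i * (?Y \<sigma> i)\<^sup>2 \<le> \<bar>Q i i\<bar> * 4" by linarith
        qed
        also have "\<dots> = 4 * (\<Sum>i<N. \<bar>Q i i\<bar>)" by (simp add: sum_distrib_left mult.commute)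
        also have "\<dots> \<le> 4 * (d + F / \<eta>)" using Q_trace by simp
        finally show ?thesis using b by (simp add: mult_left_mono algebra_simps)
      qed
      then have "spin_expect h N (\<lambda>\<sigma>. exp (X2 \<sigma>))
          \<le> spin_expect h N (\<lambda>\<sigma>. exp (4 * b * (d + F / \<eta>)) * exp (quad N R (?Y \<sigma>) / 2))"
        unfolding exp_add [symmetric] by (intro spin_expect_mono) (simp add: add.commute)
      also have "\<dots> \<le> exp (4 * b * (d + F / \<eta>)) * exp (8 * frob N R)"
        unfolding spin_expect_cmult using high_temperature_bound[OF R_sym R_small] by simp
      also have "\<dots> \<le> exp (4 * b * (d + F / \<eta>)) * exp (32 * b\<^sup>2 * F)"
        using R_frob by (simp add: mult.commute mult.left_commute)
      finally show ?thesis by (simp add: exp_add mult.commute)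
    qed
    have E3: "spin_expect h N (\<lambda>\<sigma>. exp (X3 \<sigma>)) \<le> exp (p\<^sup>2 / 2 * r)"
      using spin_expect_exp_linear_le[of h N "\<lambda>i. p * v i"]
      by (simp add: X3_def r_def power_mult_distrib sum_distrib_left [symmetric])
    let ?T2 = "32 * b\<^sup>2 * F + 4 * b * (d + F / \<eta>)"
    have "spin_expect h N (\<lambda>\<sigma>. exp (\<alpha> * X1 \<sigma> + (1 - \<alpha>) * (1 / 2 * X2 \<sigma> + (1 - 1 / 2) * X3 \<sigma>)))
        \<le> exp (\<alpha> * (ln M + ln G / \<eta>\<^sup>2 * F) + (1 - \<alpha>) * (1 / 2 * ?T2 + (1 - 1 / 2) * (p\<^sup>2 / 2 * r)))"
      using \<alpha> by (intro spin_expect_holder E1 E2 E3) auto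
    moreover have "spin_expect h N (\<lambda>\<sigma>. exp (\<beta> / 2 * quad N D (?Y \<sigma>) + (\<Sum>i<N. v i * ?Y \<sigma> i)))
        \<le> spin_expect h N (\<lambda>\<sigma>. exp (\<alpha> * X1 \<sigma> + (1 - \<alpha>) * (1 / 2 * X2 \<sigma> + (1 - 1 / 2) * X3 \<sigma>)))"
    proof (intro spin_expect_mono, unfold exp_le_cancel_iff)
      fix \<sigma>
      have "(1 - \<alpha>) * (1 / 2 * X2 \<sigma>) = \<beta> / 2 * quad N Q (?Y \<sigma>)"
      proof -
        have "(1 - \<alpha>) * b = \<beta>" using \<alpha> by (simp add: b_def)
        moreover have "(1 - \<alpha>) * (1 / 2 * X2 \<sigma>) = ((1 - \<alpha>) * b) / 2 * quad N Q (?Y \<sigma>)"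
          by (simp add: X2_def)
        ultimately show ?thesis by simp
      qed
      moreover have "(1 - \<alpha>) * ((1 - 1 / 2) * X3 \<sigma>) = (\<Sum>i<N. v i * ?Y \<sigma> i)"
      proof -
        have "(1 - \<alpha>) * ((1 - 1 / 2) * p) = 1" using \<alpha> by (simp add: p_def)
        moreover have "X3 \<sigma> = p * (\<Sum>i<N. v i * ?Y \<sigma> i)"
          by (simp add: X3_def sum_distrib_left mult.assoc)
        then have "(1 - \<alpha>) * ((1 - 1 / 2) * X3 \<sigma>) = ((1 - \<alpha>) * ((1 - 1 / 2) * p)) * (\<Sum>i<N. v i * ?Y \<sigma> i)"
          by (simp only: mult.assoc)
        ultimately show ?thesis by (simp only: mult_1)
      qed
      moreover have "\<alpha> * X1 \<sigma> = \<beta> / 2 * (\<Lambda> * (\<Sum>k\<in>S. (\<Sum>i<N. e k i * ?Y \<sigma> i)\<^sup>2))"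
        using \<alpha> by (simp add: X1_def a_def)
      moreover have "\<beta> / 2 * quad N D (?Y \<sigma>)
          \<le> \<beta> / 2 * (\<Lambda> * (\<Sum>k\<in>S. (\<Sum>i<N. e k i * ?Y \<sigma> i)\<^sup>2) + quad N Q (?Y \<sigma>))"
        using quad_D[of "?Y \<sigma>"] pos by (intro mult_left_mono) auto
      ultimately show "\<beta> / 2 * quad N D (?Y \<sigma>) + (\<Sum>i<N. v i * ?Y \<sigma> i)
          \<le> \<alpha> * X1 \<sigma> + (1 - \<alpha>) * (1 / 2 * X2 \<sigma> + (1 - 1 / 2) * X3 \<sigma>)"
        by (simp only: distrib_left)
    qed
    moreover have "\<alpha> * (ln M + ln G / \<eta>\<^sup>2 * F) + (1 - \<alpha>) * (1 / 2 * ?T2 + (1 - 1 / 2) * (p\<^sup>2 / 2 * r))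
        \<le> ln M + C * (F + d + r)"
    proof -
      have le1: "x * y \<le> y" if "0 \<le> y" "x \<le> 1" for x y :: real
        using that mult_right_mono[of x 1 y] by simp
      have n: "0 \<le> ln M" "0 \<le> ln G / \<eta>\<^sup>2 * F" "0 \<le> ?T2" "0 \<le> p\<^sup>2 / 2 * r"
        using M G nonneg b \<eta> C0(1) by auto
      have h1: "\<alpha> * (ln M + ln G / \<eta>\<^sup>2 * F) \<le> ln M + ln G / \<eta>\<^sup>2 * F"
        using n \<alpha> by (intro le1) auto
      have h2: "(1 - \<alpha>) * (1 / 2 * ?T2 + (1 - 1 / 2) * (p\<^sup>2 / 2 * r)) \<le> 1 / 2 * ?T2 + (1 - 1 / 2) * (p\<^sup>2 / 2 * r)"
        using n \<alpha> by (intro le1) auto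
      have h3: "ln G / \<eta>\<^sup>2 * F \<le> ln G / \<eta>\<^sup>2 * (F + d + r)"
        using C0(1) nonneg by (intro mult_left_mono) auto
      have h4: "?T2 \<le> (32 * b\<^sup>2 + 4 * b * (1 + 1 / \<eta>)) * (F + d + r)"
      proof -
        have "32 * b\<^sup>2 * F \<le> 32 * b\<^sup>2 * (F + d + r)" using nonneg by (intro mult_left_mono) auto
        moreover have "d + F / \<eta> \<le> (1 + 1 / \<eta>) * (F + d + r)"
          using nonneg \<eta> by (simp add: distrib_right distrib_left add_divide_distrib)
        then have "4 * b * (d + F / \<eta>) \<le> 4 * b * ((1 + 1 / \<eta>) * (F + d + r))"
          using b by (intro mult_left_mono) auto
        ultimately show ?thesis by (simp only: distrib_right mult.assoc)
      qed
      have h5: "p\<^sup>2 / 2 * r \<le> p\<^sup>2 / 2 * (F + d + r)"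
        using C0(3) nonneg by (intro mult_left_mono) auto
      have aux: "x1 + x2 \<le> m + (g' + t' + p')"
        if "x1 \<le> m + g" "x2 \<le> 1 / 2 * t + (1 - 1 / 2) * p" "g \<le> g'" "t \<le> t'" "p \<le> p'" "0 \<le> t" "0 \<le> p"
        for x1 x2 m g t p g' t' p' :: real
      proof -
        have "(1 - 1 / 2) * p = p / 2" "1 / 2 * t = t / 2" by simp_all
        with that show ?thesis by linarith
      qed
      have C_eq: "C * (F + d + r) = ln G / \<eta>\<^sup>2 * (F + d + r)
          + (32 * b\<^sup>2 + 4 * b * (1 + 1 / \<eta>)) * (F + d + r) + p\<^sup>2 / 2 * (F + d + r)"
        unfolding C_def by (simp only: distrib_right)
      show ?thesis unfolding C_eq by (rule aux[OF h1 h2 h3 h4 h5 n(3,4)])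
    qed
    ultimately have "spin_expect h N (\<lambda>\<sigma>. exp (\<beta> / 2 * quad N D (?Y \<sigma>) + (\<Sum>i<N. v i * ?Y \<sigma> i)))
        \<le> exp (ln M + C * (F + d + r))"
      by (meson exp_le_cancel_iff order_trans)
    then show "spin_expect h N (\<lambda>\<sigma>. exp (\<beta> / 2 * quad N D (?Y \<sigma>) + (\<Sum>i<N. v i * ?Y \<sigma> i)))
        \<le> M * exp (C * (frob N D + (\<Sum>i<N. \<bar>D i i\<bar>) + (\<Sum>i<N. (v i)\<^sup>2)))"
      using M by (simp add: exp_add F_def d_def r_def)
  qed
qed

section \<open>The mean-field prediction\<close>

lemma tanh_half_plus: "(1 + tanh x) / 2 = exp x / (2 * cosh x)" for x :: real
proof -
  have "(1 + tanh x) * cosh x = exp x"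
    by (simp add: tanh_def distrib_right cosh_plus_sinh)
  then show ?thesis using cosh_real_pos[of x] by (simp add: field_simps)
qed

lemma entropy_fun_tanh: "entropy_fun (tanh h) = h * tanh h - ln (2 * cosh h)"
proof -
  have "ln ((1 + tanh h) / 2) = h - ln (2 * cosh h)"
    unfolding tanh_half_plus by (subst ln_div) (auto simp: cosh_real_pos)
  moreover have "ln ((1 - tanh h) / 2) = - h - ln (2 * cosh h)"
    using tanh_half_plus[of "- h"] by (simp add: ln_div cosh_real_pos)
  ultimately show ?thesis unfolding entropy_fun_def by (simp only:) (simp add: field_simps)
qed

section \<open>The mean-field fixed point\<close>

lemma mf_fixed_point_exists:
  fixes \<beta> B :: real
  assumes "0 < \<beta>" "0 < B \<or> (B = 0 \<and> 1 < \<beta>)"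
  obtains x where "0 < x" "x = tanh (\<beta> * x + B)"
proof -
  have "\<exists>u. 0 < u \<and> u \<le> 1 \<and> u \<le> tanh (\<beta> * u + B)"
  proof (cases "0 < B")
    case True
    then have "0 < tanh B" by simp
    moreover have "tanh B \<le> tanh (\<beta> * tanh B + B)" using assms True by simp
    ultimately show ?thesis using tanh_real_lt_1[of B] by (intro exI[of _ "tanh B"]) auto
  next
    case False
    then have B: "B = 0" "1 < \<beta>" using assms by auto
    \<comment> \<open>Chosen so that (\<beta> u)^3 <= (\<beta> - 1) u; then the cubic lower bound
      for tanh (\<beta> u) is at least u, which starts the intermediate value argument.\<close>
    define u where "u = min 1 (sqrt ((\<beta> - 1) / \<beta> ^ 3))"
    have u: "0 < u" "u \<le> 1" using B by (auto simp: u_def)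
    have "u\<^sup>2 \<le> (sqrt ((\<beta> - 1) / \<beta> ^ 3))\<^sup>2" using u by (intro power_mono) (auto simp: u_def)
    then have "u\<^sup>2 \<le> (\<beta> - 1) / \<beta> ^ 3" using B by simp
    then have "\<beta> ^ 3 * u\<^sup>2 \<le> \<beta> - 1" using B by (simp add: field_simps)
    then have "\<beta> ^ 3 * u\<^sup>2 * u \<le> (\<beta> - 1) * u" using u by (intro mult_right_mono) auto
    moreover have "(\<beta> * u) ^ 3 = \<beta> ^ 3 * u\<^sup>2 * u" by (simp add: power_mult_distrib power2_eq_square power3_eq_cube)
    ultimately have "(\<beta> * u) ^ 3 \<le> (\<beta> - 1) * u" by (simp only:)
    moreover have "0 \<le> (\<beta> - 1) * u" using u B by simp
    moreover have "(\<beta> - 1) * u = \<beta> * u - u" by (simp add: left_diff_distrib)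
    ultimately have "u \<le> \<beta> * u - (\<beta> * u) ^ 3 / 3" by linarith
    also have "\<dots> \<le> tanh (\<beta> * u)" using u B by (intro tanh_ge_cubic) auto
    finally show ?thesis using u B by auto
  qed
  then obtain u where u: "0 < u" "u \<le> 1" "u \<le> tanh (\<beta> * u + B)" by blast
  have "\<exists>x\<ge>u. x \<le> 1 \<and> x - tanh (\<beta> * x + B) = 0"
    using u tanh_real_lt_1[of "\<beta> + B"]
    by (intro IVT'[of "\<lambda>x. x - tanh (\<beta> * x + B)"]) (auto intro!: continuous_intros)
  then obtain x where "u \<le> x" "x - tanh (\<beta> * x + B) = 0" by blast
  then show ?thesis using u by (intro that[of x]) auto
qed

text \<open>At every positive fixed point the strictly decreasing ratio tanh (\<beta> x + B) / x
  equals 1.\<close>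

lemma mf_fixed_point_unique:
  fixes \<beta> B :: real
  assumes "0 < \<beta>" "0 \<le> B" "0 < x" "x = tanh (\<beta> * x + B)" "0 < y" "y = tanh (\<beta> * y + B)"
  shows "x = y"
proof -
  have less: False if "0 < x" "x < y" "x = tanh (\<beta> * x + B)" "y = tanh (\<beta> * y + B)" for x y
    using tanh_ratio_decreasing[OF that(1,2) assms(1,2)] that by (simp add: that(3,4) [symmetric])
  show ?thesis using less[of x y] less[of y x] assms by (cases x y rule: linorder_cases) simp_all
qed

lemma mf_point_Theta12:
  assumes "(\<beta>, B) \<in> Theta12"
  shows "mf_point \<beta> B = tanh (\<beta> * mf_point \<beta> B + B)" "sgn (mf_point \<beta> B) = sgn B"
proof -
  have \<beta>: "0 < \<beta>" and B: "B \<noteq> 0" using assms by (auto simp: Theta12_def)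
  let ?P = "\<lambda>x. x = tanh (\<beta> * x + B) \<and> sgn x = sgn B"
  have "\<exists>!x. ?P x"
  proof (cases "0 < B")
    case True
    then obtain x where x: "0 < x" "x = tanh (\<beta> * x + B)" using mf_fixed_point_exists[of \<beta> B] \<beta> by blast
    show ?thesis
    proof (rule ex1I[of _ x])
      have "sgn x = sgn B" using x(1) True by simp
      with x(2) show "?P x" by (rule conjI)
      fix y assume y: "?P y"
      have "0 < y" using conjunct2[OF y] True by (simp add: sgn_1_pos)
      then show "y = x" using True
        by (intro mf_fixed_point_unique[OF \<beta> _ _ conjunct1[OF y] x]) auto
    qed
  next
    case False
    then have B: "0 < - B" using B by simp
    then obtain x where x: "0 < x" "x = tanh (\<beta> * x + - B)"
      using mf_fixed_point_exists[of \<beta> "- B"] \<beta> by blast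
    have neg: "tanh (\<beta> * - y + B) = - tanh (\<beta> * y + - B)" for y
      using tanh_minus[of "\<beta> * y + - B"] by (simp add: algebra_simps)
    show ?thesis
    proof (rule ex1I[of _ "- x"])
      have "sgn (- x) = sgn B" using x(1) B by simp
      moreover have "- x = tanh (\<beta> * - x + B)" unfolding neg by (rule arg_cong[OF x(2)])
      ultimately show "?P (- x)" by (intro conjI)
      fix y assume y: "?P y"
      have y1: "0 < - y" using conjunct2[OF y] B by (simp add: sgn_1_neg)
      have "tanh (\<beta> * y + B) = - tanh (\<beta> * - y + - B)" using neg[of "- y"] by simp
      then have y2: "- y = tanh (\<beta> * - y + - B)" using conjunct1[OF y] by linarith
      have "- y = x" using B by (intro mf_fixed_point_unique[OF \<beta> _ y1 y2 x]) auto
      then show "y = - x" by simp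
    qed
  qed
  from theI'[OF this] show "mf_point \<beta> B = tanh (\<beta> * mf_point \<beta> B + B)" "sgn (mf_point \<beta> B) = sgn B"
    using assms by (simp_all add: mf_point_def)
qed

lemma mf_point_Theta2:
  assumes "(\<beta>, B) \<in> Theta2"
  shows "0 < mf_point \<beta> B" "mf_point \<beta> B = tanh (\<beta> * mf_point \<beta> B)"
proof -
  have \<beta>: "1 < \<beta>" and B: "B = 0" using assms by (auto simp: Theta2_def)
  let ?P = "\<lambda>x. 0 < x \<and> x = tanh (\<beta> * x)"
  obtain x where "?P x" using mf_fixed_point_exists[of \<beta> 0] \<beta> by auto
  then have "\<exists>!x. ?P x" using mf_fixed_point_unique[of \<beta> 0] \<beta> by (intro ex1I[of _ x]) auto
  from theI'[OF this] show "0 < mf_point \<beta> B" "mf_point \<beta> B = tanh (\<beta> * mf_point \<beta> B)"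
    using assms B by (simp_all add: mf_point_def Theta12_def)
qed

lemma mf_point_zero: "(\<beta>, B) \<in> Theta11 \<or> (\<beta>, B) \<in> Theta3 \<Longrightarrow> mf_point \<beta> B = 0"
  by (auto simp: mf_point_def Theta11_def Theta12_def Theta2_def Theta3_def)

section \<open>The partition function as an expectation of independent spins\<close>

lemma partition_fun_spins:
  assumes "A \<in> carrier_mat N N"
  shows "partition_fun A \<beta> B
    = (\<Sum>\<sigma>\<in>spins N. exp (\<beta> / 2 * quad N (\<lambda>i j. A $$ (i, j)) \<sigma> + B * (\<Sum>i<N. \<sigma> i)))"
proof -
  have "dim_row A = N" using assms by simp
  show ?thesis unfolding partition_fun_def \<open>dim_row A = N\<close>
  proof (rule sum.reindex_bij_witness[where i = "vec N" and j = "\<lambda>v. restrict (\<lambda>i. v $ i) {..<N}"])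
    fix v :: "real Matrix.vec" assume v: "v \<in> spin_configs N"
    then have dv: "dim_vec v = N" by (auto simp: spin_configs_def)
    show "Matrix.vec N (restrict (\<lambda>i. v $ i) {..<N}) = v" using dv by (intro eq_vecI) auto
    show "restrict (\<lambda>i. v $ i) {..<N} \<in> spins N" using v by (auto simp: spins_def spin_configs_def)
    have "v \<bullet> (A *\<^sub>v v) = quad N (\<lambda>i j. A $$ (i, j)) (restrict (\<lambda>i. v $ i) {..<N})"
      using assms dv by (simp add: scalar_prod_def quad_def mult_mv_def atLeast0LessThan)
    then show "exp (\<beta> / 2 * quad N (\<lambda>i j. A $$ (i, j)) (restrict (\<lambda>i. v $ i) {..<N})
        + B * (\<Sum>i<N. restrict (\<lambda>i. v $ i) {..<N} i))
      = exp (\<beta> / 2 * (v \<bullet> (A *\<^sub>v v)) + B * (\<Sum>i<N. v $ i))"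
      by simp
  next
    fix \<sigma> assume "\<sigma> \<in> spins N"
    then show "restrict (\<lambda>i. Matrix.vec N \<sigma> $ i) {..<N} = \<sigma>"
      by (auto simp: spins_def PiE_iff extensional_def)
    show "Matrix.vec N \<sigma> \<in> spin_configs N"
      using spins_cases[OF \<open>\<sigma> \<in> spins N\<close>] by (auto simp: spin_configs_def)
  qed
qed

lemma quad_shift:
  assumes "sym_on N a"
  shows "quad N a (\<lambda>i. x i + s) = quad N a x + 2 * s * (\<Sum>i<N. mult_mv N a (\<lambda>_. 1) i * x i)
    + s\<^sup>2 * (\<Sum>i<N. mult_mv N a (\<lambda>_. 1) i)"
  using quad_add_scale[OF assms, of x s "\<lambda>_. 1"] mult_mv_adjoint[OF assms, of "\<lambda>_. 1" x]
  by (simp add: quad_def)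

text \<open>Expanding around t = tanh h produces the field B + \<beta> t R_i = h + \<beta> t (R_i -
  1). Its uniform part h goes into the product measure, so only the deviations R_i - 1
  remain.\<close>

lemma energy_centered:
  fixes \<beta> B h :: real
  assumes a: "sym_on N a" and h: "h = \<beta> * tanh h + B"
  defines "r \<equiv> \<lambda>i. mult_mv N a (\<lambda>_. 1) i - 1"
  shows "\<beta> / 2 * quad N a \<sigma> + B * (\<Sum>i<N. \<sigma> i) = h * (\<Sum>i<N. \<sigma> i)
    + (\<beta> / 2 * quad N a (\<lambda>i. \<sigma> i - tanh h) + (\<Sum>i<N. \<beta> * tanh h * r i * (\<sigma> i - tanh h)))
    + \<beta> * (tanh h)\<^sup>2 / 2 * ((\<Sum>i<N. r i) - real N)"
proof -
  define t where "t = tanh h"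
  let ?Y = "\<lambda>i. \<sigma> i - t" and ?R = "mult_mv N a (\<lambda>_. 1)"
  define p where "p = (\<Sum>i<N. r i * ?Y i)"
  define Y where "Y = (\<Sum>i<N. ?Y i)"
  have "(\<Sum>i<N. ?R i * ?Y i) = p + Y"
    by (simp add: p_def Y_def r_def algebra_simps sum.distrib [symmetric] sum_subtractf [symmetric])
  moreover have "(\<Sum>i<N. ?R i) = (\<Sum>i<N. r i) + real N" by (simp add: r_def sum_subtractf)
  ultimately have "quad N a \<sigma> = quad N a ?Y + 2 * t * (p + Y) + t\<^sup>2 * ((\<Sum>i<N. r i) + real N)"
    using quad_shift[OF a, of ?Y t] by simp
  moreover have "(\<Sum>i<N. \<sigma> i) = Y + real N * t" by (simp add: Y_def sum_subtractf)
  moreover have "(\<Sum>i<N. \<beta> * t * r i * ?Y i) = \<beta> * t * p" by (simp add: p_def sum_distrib_left mult.assoc)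
  moreover have "h = \<beta> * t + B" using h by (simp add: t_def)
  ultimately show ?thesis unfolding t_def [symmetric]
    by (simp add: field_simps power2_eq_square)
qed

lemma row_sum_mult_mv:
  "A \<in> carrier_mat N N \<Longrightarrow> i < N \<Longrightarrow> row_sum A i = mult_mv N (\<lambda>i j. A $$ (i, j)) (\<lambda>_. 1) i"
  by (simp add: row_sum_def mult_mv_def)

text \<open>An exact identity: the normalisation (2 cosh h)^N and the constant of the expansion are
  the mean-field prediction, by the formula for the entropy at tanh h.\<close>

lemma ln_partition_fun_gap:
  fixes \<beta> B h :: real
  assumes A: "A \<in> carrier_mat N N" "sym_on N (\<lambda>i j. A $$ (i, j))"
    and h: "h = \<beta> * tanh h + B" and t: "mf_point \<beta> B = tanh h"
  shows "ln (partition_fun A \<beta> B) - mf_prediction A \<beta> B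
    = ln (spin_expect h N (\<lambda>\<sigma>. exp (\<beta> / 2 * quad N (\<lambda>i j. A $$ (i, j)) (\<lambda>i. \<sigma> i - tanh h)
        + (\<Sum>i<N. \<beta> * tanh h * (row_sum A i - 1) * (\<sigma> i - tanh h)))))"
proof -
  let ?a = "\<lambda>i j. A $$ (i, j)"
  let ?r = "\<lambda>i. mult_mv N ?a (\<lambda>_. 1) i - 1"
  let ?g = "\<lambda>\<sigma>. \<beta> / 2 * quad N ?a (\<lambda>i. \<sigma> i - tanh h) + (\<Sum>i<N. \<beta> * tanh h * ?r i * (\<sigma> i - tanh h))"
  let ?K = "\<beta> * (tanh h)\<^sup>2 / 2 * ((\<Sum>i<N. ?r i) - real N)"
  have r: "row_sum A i - 1 = ?r i" if "i < N" for i using row_sum_mult_mv[OF A(1) that] by simp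
  let ?E = "spin_expect h N (\<lambda>\<sigma>. exp (?g \<sigma>))"
  have "partition_fun A \<beta> B = (\<Sum>\<sigma>\<in>spins N. exp ?K * (2 * cosh h) ^ N *
      ((\<Prod>i<N. exp (h * \<sigma> i) / (2 * cosh h)) * exp (?g \<sigma>)))"
    unfolding partition_fun_spins[OF A(1)] energy_centered[OF A(2) h] exp_spin_weight
    by (intro sum.cong refl) (simp add: exp_add cosh_real_pos)
  then have Z: "partition_fun A \<beta> B = exp ?K * (2 * cosh h) ^ N * ?E"
    by (simp add: spin_expect_def sum_distrib_left)
  have E: "0 < ?E" unfolding spin_expect_def
    by (intro sum_pos mult_pos_pos spin_weight_pos finite_spins exp_gt_zero)
      (simp add: spins_def PiE_eq_empty_iff)
  have "ln (partition_fun A \<beta> B) = ?K + real N * ln (2 * cosh h) + ln ?E"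
    unfolding Z using E cosh_real_pos[of h] by (simp add: ln_mult ln_realpow distrib_left)
  moreover have "mf_prediction A \<beta> B = real N * (\<beta> * (tanh h)\<^sup>2 / 2 + B * tanh h - entropy_fun (tanh h))
      + \<beta> * (tanh h)\<^sup>2 / 2 * (\<Sum>i<N. ?r i)"
    using A r by (simp add: mf_prediction_def Let_def t)
  moreover have "h * tanh h = \<beta> * (tanh h)\<^sup>2 + B * tanh h"
    by (subst (1) h) (simp add: algebra_simps power2_eq_square)
  ultimately have "ln (partition_fun A \<beta> B) - mf_prediction A \<beta> B = ln ?E"
    by (simp add: entropy_fun_tanh algebra_simps add_divide_distrib diff_divide_distrib)
  then show ?thesis using r by simp
qed

text \<open>One constant has to serve from N = 2 on. The finitely many early N are covered by the
  sum of their ratios, which requires x N <= 0 wherever y N vanishes.\<close>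

lemma lesssim_of_eventually:
  fixes x y :: "nat \<Rightarrow> real"
  assumes "\<And>N. N \<ge> N0 \<Longrightarrow> N \<ge> 2 \<Longrightarrow> x N \<le> C * y N"
    and y: "\<And>N. N \<ge> 2 \<Longrightarrow> 0 \<le> y N" and "\<And>N. N \<ge> 2 \<Longrightarrow> y N = 0 \<Longrightarrow> x N \<le> 0"
  shows "lesssim x y"
  unfolding lesssim_def
proof (intro exI allI impI)
  fix N :: nat assume N: "N \<ge> 2"
  let ?S = "\<Sum>N<N0. \<bar>x N / y N\<bar>"
  have S: "0 \<le> ?S" by (simp add: sum_nonneg)
  show "x N \<le> (\<bar>C\<bar> + ?S) * y N"
  proof (cases "N \<ge> N0")
    case True
    have "C * y N \<le> (\<bar>C\<bar> + ?S) * y N" using y[OF N] S by (intro mult_right_mono) auto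
    then show ?thesis using assms(1)[OF True N] by linarith
  next
    case False
    show ?thesis
    proof (cases "y N = 0")
      case True
      then show ?thesis using assms(3)[OF N] by simp
    next
      case y0: False
      have "\<bar>x N / y N\<bar> \<le> ?S" using False by (intro member_le_sum) auto
      then have "x N / y N \<le> \<bar>C\<bar> + ?S" by linarith
      then show ?thesis using y[OF N] y0 by (simp add: pos_divide_le_eq)
    qed
  qed
qed

section \<open>Compression to the complement of the constants\<close>

lemma quad_le_top:
  assumes e: "orthobasis N e" and sp: "\<And>i j. i < N \<Longrightarrow> j < N \<Longrightarrow> a i j = spec_mat N e l i j"
    and l: "\<And>k. k < N \<Longrightarrow> l k \<le> L"
  shows "quad N a y \<le> L * (\<Sum>i<N. (y i)\<^sup>2)"
proof -
  have "quad N a y = quad N (spec_mat N e l) y" by (rule quad_cong) (rule sp)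
  also have "\<dots> = (\<Sum>k<N. l k * (\<Sum>i<N. e k i * y i)\<^sup>2)" by (rule quad_spec[OF e])
  also have "\<dots> \<le> (\<Sum>k<N. L * (\<Sum>i<N. e k i * y i)\<^sup>2)"
    using l by (intro sum_mono mult_right_mono) auto
  also have "\<dots> = L * (\<Sum>i<N. (y i)\<^sup>2)" by (simp add: sum_distrib_left [symmetric] parseval[OF e])
  finally show ?thesis .
qed

lemma sum_split_0: "0 < (N::nat) \<Longrightarrow> (\<Sum>k<N. f k) = f 0 + (\<Sum>k\<in>{1..<N}. f k :: real)"
proof -
  assume "0 < N"
  then have "{..<N} = insert 0 {1..<N}" by auto
  then show ?thesis by simp
qed

text \<open>If the row sums are close to 1 in mean square, then the top eigenvector is close to the
  constants, so on their complement the form is controlled by the second eigenvalue.\<close>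

lemma quad_le_off_constants:
  fixes \<delta> :: real
  assumes e: "orthobasis N e" and sp: "\<And>i j. i < N \<Longrightarrow> j < N \<Longrightarrow> a i j = spec_mat N e l i j"
    and N: "0 < N" and \<delta>: "0 < \<delta>" "\<delta> \<le> 1" and l0: "l 0 \<le> 2"
    and l: "\<And>k. 1 \<le> k \<Longrightarrow> k < N \<Longrightarrow> l k \<le> 1 - \<delta> / 2"
    and r: "(\<Sum>i<N. (mult_mv N a (\<lambda>_. 1) i - 1)\<^sup>2) \<le> \<delta> ^ 3 / 64 * real N"
    and y: "(\<Sum>i<N. y i) = 0"
  shows "quad N a y \<le> (1 - \<delta> / 4) * (\<Sum>i<N. (y i)\<^sup>2)"
proof -
  define c where "c k = (\<Sum>i<N. e k i)" for k
  define x where "x k = (\<Sum>i<N. e k i * y i)" for k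
  define n where "n = (\<Sum>i<N. (y i)\<^sup>2)"
  define T where "T = (\<Sum>k\<in>{1..<N}. (c k)\<^sup>2)"
  have n: "(\<Sum>k<N. (x k)\<^sup>2) = n" unfolding x_def n_def by (rule parseval[OF e])
  have c2: "(\<Sum>k<N. (c k)\<^sup>2) = real N" unfolding c_def using parseval[OF e, of "\<lambda>_. 1"] by simp
  have cx: "(\<Sum>k<N. c k * x k) = 0"
  proof -
    have "(\<Sum>i<N. y i) = (\<Sum>i<N. \<Sum>k<N. x k * e k i)"
      unfolding x_def by (intro sum.cong refl) (simp add: basis_expand[OF e])
    also have "\<dots> = (\<Sum>k<N. \<Sum>i<N. x k * e k i)" by (rule sum.swap)
    also have "\<dots> = (\<Sum>k<N. c k * x k)"
      by (simp add: sum_distrib_left [symmetric] c_def mult.commute)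
    finally show ?thesis using y by simp
  qed
  \<comment> \<open>The deviations R_i - 1 are the entries of (a - 1) applied to the constant
    vector, so in the eigenbasis their squared norm is the sum of (l k - 1)^2 (c k)^2.\<close>
  have "(\<Sum>i<N. (mult_mv N a (\<lambda>_. 1) i - 1)\<^sup>2) = (\<Sum>i<N. (mult_mv N (spec_mat N e (\<lambda>k. l k - 1)) (\<lambda>_. 1) i)\<^sup>2)"
  proof (intro sum.cong refl)
    fix i assume "i \<in> {..<N}"
    then have i: "i < N" by simp
    have "mult_mv N a (\<lambda>_. 1) i = mult_mv N (spec_mat N e l) (\<lambda>_. 1) i"
      using sp i by (simp add: mult_mv_def)
    moreover have "mult_mv N (spec_mat N e (\<lambda>k. l k - 1)) (\<lambda>_. 1) i
        = mult_mv N (spec_mat N e l) (\<lambda>_. 1) i - (\<Sum>k<N. (\<Sum>j<N. e k j * 1) * e k i)"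
      unfolding mult_mv_spec[OF e] by (simp add: sum_subtractf [symmetric] algebra_simps)
    ultimately show "(mult_mv N a (\<lambda>_. 1) i - 1)\<^sup>2 = (mult_mv N (spec_mat N e (\<lambda>k. l k - 1)) (\<lambda>_. 1) i)\<^sup>2"
      using basis_expand[OF e i, of "\<lambda>_. 1"] by simp
  qed
  also have "\<dots> = (\<Sum>k<N. (l k - 1)\<^sup>2 * (c k)\<^sup>2)"
    unfolding norm_mult_mv_spec[OF e] by (simp add: c_def)
  finally have r2: "(\<Sum>k<N. (l k - 1)\<^sup>2 * (c k)\<^sup>2) \<le> \<delta> ^ 3 / 64 * real N" using r by simp
  \<comment> \<open>Origin of \<delta>^3 / 64: the gap |l k - 1| >= \<delta> / 2 uses up \<delta>^2
    / 4, and what is left bounds the mass T of the constants off the top eigenvector by \<delta> N /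
    16.\<close>
  have "\<delta>\<^sup>2 / 4 * T \<le> (\<Sum>k\<in>{1..<N}. (l k - 1)\<^sup>2 * (c k)\<^sup>2)"
    unfolding T_def sum_distrib_left
  proof (intro sum_mono mult_right_mono)
    fix k assume "k \<in> {1..<N}"
    then have "l k \<le> 1 - \<delta> / 2" using l[of k] by simp
    then have "\<delta> / 2 \<le> 1 - l k" by argo
    also have "\<dots> \<le> \<bar>l k - 1\<bar>" by simp
    finally have "\<delta> / 2 \<le> \<bar>l k - 1\<bar>" .
    then have "(\<delta> / 2)\<^sup>2 \<le> \<bar>l k - 1\<bar>\<^sup>2" using \<delta> by (intro power_mono) auto
    then show "\<delta>\<^sup>2 / 4 \<le> (l k - 1)\<^sup>2" by (simp add: power_divide)
  qed auto
  also have "\<dots> \<le> (\<Sum>k<N. (l k - 1)\<^sup>2 * (c k)\<^sup>2)" by (intro sum_mono2) auto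
  also have "\<dots> \<le> \<delta>\<^sup>2 / 4 * (\<delta> / 16 * real N)"
    using r2 by (simp add: power2_eq_square power3_eq_cube)
  finally have T: "T \<le> \<delta> / 16 * real N" using \<delta> by simp
  have c0: "real N / 2 \<le> (c 0)\<^sup>2"
  proof -
    have "\<delta> / 16 * real N \<le> real N / 2" using \<delta> mult_right_mono[of "\<delta> / 16" "1 / 2" "real N"] by simp
    then show ?thesis using c2 T sum_split_0[OF N, of "\<lambda>k. (c k)\<^sup>2"] unfolding T_def by linarith
  qed
  have n_split: "n = (x 0)\<^sup>2 + (\<Sum>k\<in>{1..<N}. (x k)\<^sup>2)"
    using n sum_split_0[OF N, of "\<lambda>k. (x k)\<^sup>2"] by simp
  have n0: "0 \<le> n" by (simp add: n_def sum_nonneg)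
  \<comment> \<open>Orthogonality to the constants expresses x 0 through the other coefficients, and
    c 0 is large; so y has little mass on the top eigenvector.\<close>
  have "(c 0)\<^sup>2 * (x 0)\<^sup>2 = (\<Sum>k\<in>{1..<N}. c k * x k)\<^sup>2"
  proof -
    have "c 0 * x 0 = - (\<Sum>k\<in>{1..<N}. c k * x k)" using cx sum_split_0[OF N, of "\<lambda>k. c k * x k"] by linarith
    then have "(c 0 * x 0)\<^sup>2 = (\<Sum>k\<in>{1..<N}. c k * x k)\<^sup>2" by (simp only: power2_minus)
    then show ?thesis by (simp only: power_mult_distrib)
  qed
  also have "\<dots> \<le> T * (\<Sum>k\<in>{1..<N}. (x k)\<^sup>2)"
    unfolding T_def by (rule Cauchy_Schwarz_ineq_sum)
  also have "\<dots> \<le> (\<delta> / 16 * real N) * n"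
    using T n_split \<delta> by (intro mult_mono) (auto intro!: sum_nonneg)
  finally have "(c 0)\<^sup>2 * (x 0)\<^sup>2 \<le> \<delta> / 16 * real N * n" .
  moreover have "real N / 2 * (x 0)\<^sup>2 \<le> (c 0)\<^sup>2 * (x 0)\<^sup>2" using c0 by (intro mult_right_mono) auto
  ultimately have "real N / 2 * (x 0)\<^sup>2 \<le> \<delta> / 16 * real N * n" by (rule order_trans[rotated])
  also have "\<dots> = real N / 2 * (\<delta> / 8 * n)" by simp
  finally have "real N / 2 * (x 0)\<^sup>2 \<le> real N / 2 * (\<delta> / 8 * n)" .
  then have x0: "(x 0)\<^sup>2 \<le> \<delta> / 8 * n" using N by simp
  have "quad N a y = quad N (spec_mat N e l) y" by (rule quad_cong) (rule sp)
  also have "\<dots> = (\<Sum>k<N. l k * (x k)\<^sup>2)" unfolding x_def by (rule quad_spec[OF e])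
  also have "\<dots> = l 0 * (x 0)\<^sup>2 + (\<Sum>k\<in>{1..<N}. l k * (x k)\<^sup>2)" by (rule sum_split_0[OF N])
  also have "\<dots> \<le> 2 * (x 0)\<^sup>2 + (\<Sum>k\<in>{1..<N}. (1 - \<delta> / 2) * (x k)\<^sup>2)"
    using l l0 by (intro add_mono sum_mono mult_right_mono) auto
  also have "\<dots> = 2 * (x 0)\<^sup>2 + (1 - \<delta> / 2) * (\<Sum>k\<in>{1..<N}. (x k)\<^sup>2)" by (simp add: sum_distrib_left)
  also have "\<dots> \<le> 2 * (\<delta> / 8 * n) + (1 - \<delta> / 2) * n"
    using x0 \<delta> n_split by (intro add_mono mult_left_mono) auto
  also have "\<dots> = (1 - \<delta> / 4) * n" by (simp add: algebra_simps)
  finally show ?thesis by (simp add: n_def)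
qed

section \<open>Projection off the constants and the compressed matrix\<close>

definition proj :: "nat \<Rightarrow> (nat \<Rightarrow> real) \<Rightarrow> nat \<Rightarrow> real" where
  "proj N y i = y i - (\<Sum>j<N. y j) / real N"

text \<open>For symmetric a, the entries of P a P with P the orthogonal projection off the
  constants.\<close>

definition proj_mat :: "nat \<Rightarrow> (nat \<Rightarrow> nat \<Rightarrow> real) \<Rightarrow> nat \<Rightarrow> nat \<Rightarrow> real" where
  "proj_mat N a i j = a i j - mult_mv N a (\<lambda>_. 1) i / real N - mult_mv N a (\<lambda>_. 1) j / real N
     + (\<Sum>k<N. mult_mv N a (\<lambda>_. 1) k) / (real N)\<^sup>2"

lemma proj_sum: "0 < N \<Longrightarrow> (\<Sum>i<N. proj N y i) = 0"
  by (simp add: proj_def sum_subtractf)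

lemma proj_shift: "0 < N \<Longrightarrow> proj N (\<lambda>i. y i - s) = proj N y"
  by (auto simp: proj_def sum_subtractf diff_divide_distrib)

lemma proj_adjoint: "(\<Sum>i<N. v i * proj N y i) = (\<Sum>i<N. proj N v i * y i)"
proof -
  have "(\<Sum>i<N. v i * proj N y i) = (\<Sum>i<N. v i * y i) - (\<Sum>i<N. v i) * ((\<Sum>j<N. y j) / real N)"
    by (simp only: proj_def right_diff_distrib sum_subtractf sum_distrib_right)
  moreover have "(\<Sum>i<N. proj N v i * y i) = (\<Sum>i<N. v i * y i) - (\<Sum>j<N. v j) / real N * (\<Sum>i<N. y i)"
    by (simp only: proj_def left_diff_distrib sum_subtractf sum_distrib_left)
  ultimately show ?thesis by simp
qed

lemma proj_norm_le:
  "(\<Sum>i<N. (proj N y i)\<^sup>2) \<le> (\<Sum>i<N. (y i)\<^sup>2)"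
proof (cases "N = 0")
  case False
  let ?s = "(\<Sum>j<N. y j) / real N"
  have "(\<Sum>i<N. (proj N y i)\<^sup>2) = (\<Sum>i<N. (y i)\<^sup>2 - 2 * ?s * y i + ?s\<^sup>2)"
    by (intro sum.cong refl) (simp add: proj_def power2_diff algebra_simps)
  also have "\<dots> = (\<Sum>i<N. (y i)\<^sup>2) - 2 * ?s * (\<Sum>i<N. y i) + real N * ?s\<^sup>2"
    by (simp add: sum.distrib sum_subtractf sum_distrib_left)
  also have "\<dots> = (\<Sum>i<N. (y i)\<^sup>2) - (\<Sum>i<N. y i)\<^sup>2 / real N"
    using False by (simp add: power2_eq_square field_simps)
  finally show ?thesis by simp
qed simp

context
  fixes N :: nat and a :: "nat \<Rightarrow> nat \<Rightarrow> real"
  assumes N: "0 < N" and a: "sym_on N a"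
begin

abbreviation rs :: "nat \<Rightarrow> real" where "rs \<equiv> mult_mv N a (\<lambda>_. 1)"

lemma mult_mv_proj_mat:
  "mult_mv N (proj_mat N a) y i = mult_mv N a y i - rs i * (\<Sum>j<N. y j) / real N
    - (\<Sum>j<N. rs j * y j) / real N + (\<Sum>k<N. rs k) * (\<Sum>j<N. y j) / (real N)\<^sup>2"
proof -
  have "mult_mv N (proj_mat N a) y i = (\<Sum>j<N. a i j * y j - rs i / real N * y j
      - 1 / real N * (rs j * y j) + (\<Sum>k<N. rs k) / (real N)\<^sup>2 * y j)"
    unfolding mult_mv_def[of N "proj_mat N a"] proj_mat_def
    by (intro sum.cong refl) (simp add: algebra_simps)
  also have "\<dots> = mult_mv N a y i - rs i / real N * (\<Sum>j<N. y j) - 1 / real N * (\<Sum>j<N. rs j * y j)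
      + (\<Sum>k<N. rs k) / (real N)\<^sup>2 * (\<Sum>j<N. y j)"
    by (simp only: sum.distrib sum_subtractf sum_distrib_left [symmetric] mult_mv_def[of N a y])
  finally show ?thesis by simp
qed

lemma quad_proj: "quad N a (proj N y) = quad N (proj_mat N a) y"
proof -
  let ?s = "(\<Sum>j<N. y j)" and ?w = "(\<Sum>j<N. rs j * y j)" and ?S = "(\<Sum>k<N. rs k)"
  have "quad N (proj_mat N a) y = (\<Sum>i<N. y i * mult_mv N a y i - ?s / real N * (rs i * y i)
      - ?w / real N * y i + ?S * ?s / (real N)\<^sup>2 * y i)"
    unfolding quad_def mult_mv_proj_mat by (intro sum.cong refl) (simp add: algebra_simps)
  also have "\<dots> = quad N a y - ?s / real N * ?w - ?w / real N * ?s + ?S * ?s / (real N)\<^sup>2 * ?s"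
    by (simp only: sum.distrib sum_subtractf sum_distrib_left [symmetric] quad_def)
  finally have "quad N (proj_mat N a) y = quad N a y - 2 * (?s / real N) * ?w + (?s / real N)\<^sup>2 * ?S"
    by (simp add: power2_eq_square algebra_simps)
  moreover have "proj N y = (\<lambda>i. y i + - (?s / real N))" by (auto simp: proj_def)
  ultimately show ?thesis using quad_shift[OF a, of y "- (?s / real N)"] by simp
qed

lemma sym_on_proj_mat: "sym_on N (proj_mat N a)"
  using a by (auto simp: sym_on_def proj_mat_def)

lemma proj_mat_const: "mult_mv N (proj_mat N a) (\<lambda>_. 1) i = 0"
  unfolding mult_mv_proj_mat using N by (simp add: power2_eq_square)

lemma row_sums_le_frob:
  "(\<Sum>i<N. (rs i)\<^sup>2) \<le> real N * frob N a" "(\<Sum>i<N. rs i)\<^sup>2 \<le> (real N)\<^sup>2 * frob N a"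
proof -
  have cs: "(\<Sum>j<N. f j)\<^sup>2 \<le> real N * (\<Sum>j<N. (f j)\<^sup>2)" for f :: "nat \<Rightarrow> real"
    using Cauchy_Schwarz_ineq_sum[of "\<lambda>_. 1" f "{..<N}"] by simp
  have "(\<Sum>i<N. (rs i)\<^sup>2) \<le> (\<Sum>i<N. real N * (\<Sum>j<N. (a i j)\<^sup>2))"
    unfolding mult_mv_def using cs by (intro sum_mono) simp
  then show 1: "(\<Sum>i<N. (rs i)\<^sup>2) \<le> real N * frob N a" by (simp add: frob_def sum_distrib_left)
  have "(\<Sum>i<N. rs i)\<^sup>2 \<le> real N * (\<Sum>i<N. (rs i)\<^sup>2)" by (rule cs)
  also have "\<dots> \<le> real N * (real N * frob N a)" using 1 by (intro mult_left_mono) auto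
  finally show "(\<Sum>i<N. rs i)\<^sup>2 \<le> (real N)\<^sup>2 * frob N a" by (simp add: power2_eq_square)
qed

lemma frob_proj_mat: "frob N (proj_mat N a) \<le> 16 * frob N a"
proof -
  let ?S = "\<Sum>k<N. rs k"
  have four: "(p - q - r + s)\<^sup>2 \<le> 4 * p\<^sup>2 + 4 * q\<^sup>2 + 4 * r\<^sup>2 + 4 * s\<^sup>2" for p q r s :: real
  proof -
    have "0 \<le> (p + q)\<^sup>2 + (p + r)\<^sup>2 + (p - s)\<^sup>2 + (q - r)\<^sup>2 + (q + s)\<^sup>2 + (r + s)\<^sup>2" by simp
    then show ?thesis by (simp add: power2_eq_square algebra_simps)
  qed
  have "frob N (proj_mat N a) \<le> (\<Sum>i<N. \<Sum>j<N. 4 * (a i j)\<^sup>2 + 4 * (rs i / real N)\<^sup>2 + 4 * (rs j / real N)\<^sup>2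
      + 4 * (?S / (real N)\<^sup>2)\<^sup>2)"
    unfolding frob_def proj_mat_def by (intro sum_mono four)
  also have "\<dots> = 4 * frob N a + 8 * ((\<Sum>i<N. (rs i)\<^sup>2) / real N) + 4 * (?S\<^sup>2 / (real N)\<^sup>2)"
  proof -
    have "(\<Sum>i<N. \<Sum>j<N. 4 * (rs i / real N)\<^sup>2) = 4 * ((\<Sum>i<N. (rs i)\<^sup>2) / real N)"
      using N by (simp add: power_divide sum_divide_distrib [symmetric] sum_distrib_left [symmetric] power2_eq_square field_simps)
    moreover have "(\<Sum>i<N. \<Sum>j<N. 4 * (rs j / real N)\<^sup>2) = 4 * ((\<Sum>i<N. (rs i)\<^sup>2) / real N)"
      using N by (simp add: power_divide sum_divide_distrib [symmetric] sum_distrib_left [symmetric] power2_eq_square field_simps)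
    moreover have "(\<Sum>i<N. \<Sum>j<N. 4 * (?S / (real N)\<^sup>2)\<^sup>2) = 4 * (?S\<^sup>2 / (real N)\<^sup>2)"
      using N by (simp add: power_divide power2_eq_square field_simps)
    moreover have "(\<Sum>i<N. \<Sum>j<N. 4 * (a i j)\<^sup>2) = 4 * frob N a" by (simp add: frob_def sum_distrib_left)
    ultimately show ?thesis by (simp add: sum.distrib)
  qed
  also have "\<dots> \<le> 4 * frob N a + 8 * frob N a + 4 * frob N a"
    using row_sums_le_frob N by (intro add_mono mult_left_mono) (auto simp: pos_divide_le_eq mult.commute)
  finally show ?thesis by simp
qed

lemma trace_proj_mat:
  assumes pos: "\<And>i. i < N \<Longrightarrow> 0 \<le> rs i" and diag: "\<And>i. i < N \<Longrightarrow> a i i = 0"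
  shows "(\<Sum>i<N. \<bar>proj_mat N a i i\<bar>) \<le> 3 * (\<Sum>i<N. rs i) / real N"
proof -
  let ?S = "\<Sum>k<N. rs k"
  have S: "0 \<le> ?S" using pos by (intro sum_nonneg) auto
  have "(\<Sum>i<N. \<bar>proj_mat N a i i\<bar>) \<le> (\<Sum>i<N. 2 / real N * rs i + ?S / (real N)\<^sup>2)"
  proof (intro sum_mono)
    fix i assume i: "i \<in> {..<N}"
    have "proj_mat N a i i = ?S / (real N)\<^sup>2 - 2 / real N * rs i" using diag i by (simp add: proj_mat_def)
    moreover have "0 \<le> 2 / real N * rs i" "0 \<le> ?S / (real N)\<^sup>2" using pos i S by auto
    ultimately show "\<bar>proj_mat N a i i\<bar> \<le> 2 / real N * rs i + ?S / (real N)\<^sup>2" by linarith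
  qed
  also have "\<dots> = 2 / real N * ?S + real N * (?S / (real N)\<^sup>2)"
    by (simp add: sum.distrib sum_distrib_left)
  also have "\<dots> = 3 * ?S / real N" using N by (simp add: power2_eq_square field_simps)
  finally show ?thesis .
qed

end

text \<open>The subcritical bound for P a P. Its eigenvectors with non-zero eigenvalue sum to zero,
  so the sub-Gaussian hypothesis is needed only for fields with sum zero, and its top eigenvalue
  obeys the gap. Compression creates a diagonal, but of trace norm at most 6, which the lower bound
  on the Frobenius norm absorbs.\<close>

lemma projected_quadratic_bound:
  fixes \<beta> q \<Lambda> :: real
  assumes pos: "0 < \<beta>" "0 \<le> q" "0 < \<Lambda>" and sub: "\<beta> * \<Lambda> * q < 1"
  obtains C where "0 \<le> C" "\<And>N a h M v.
    0 < N \<Longrightarrow> sym_on N a \<Longrightarrow> (\<And>i. i < N \<Longrightarrow> 0 \<le> mult_mv N a (\<lambda>_. 1) i) \<Longrightarrow>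
    (\<And>i. i < N \<Longrightarrow> a i i = 0) \<Longrightarrow> (\<And>y. quad N a y \<le> 2 * (\<Sum>i<N. (y i)\<^sup>2)) \<Longrightarrow> 1 / 4 \<le> frob N a \<Longrightarrow>
    (\<And>y. (\<Sum>i<N. y i) = 0 \<Longrightarrow> quad N a y \<le> \<Lambda> * (\<Sum>i<N. (y i)\<^sup>2)) \<Longrightarrow> 1 \<le> M \<Longrightarrow>
    (\<And>w. (\<Sum>i<N. w i) = 0 \<Longrightarrow>
      spin_expect h N (\<lambda>\<sigma>. exp (\<Sum>i<N. w i * (\<sigma> i - tanh h))) \<le> M * exp (q * (\<Sum>i<N. (w i)\<^sup>2) / 2)) \<Longrightarrow>
    spin_expect h N (\<lambda>\<sigma>. exp (\<beta> / 2 * quad N a (proj N \<sigma>) + (\<Sum>i<N. v i * (\<sigma> i - tanh h))))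
      \<le> M * exp (C * (frob N a + (\<Sum>i<N. (v i)\<^sup>2)))"
proof (rule tilted_quadratic_bound[OF assms])
  fix C :: real
  assume C: "0 \<le> C" "\<And>N e l D h M c v.
    orthobasis N e \<Longrightarrow> (\<And>i j. i < N \<Longrightarrow> j < N \<Longrightarrow> D i j = spec_mat N e l i j) \<Longrightarrow>
    (\<And>k. k < N \<Longrightarrow> l k \<le> \<Lambda>) \<Longrightarrow>
    (\<And>k. k < N \<Longrightarrow> l k \<noteq> 0 \<Longrightarrow> c * (\<Sum>i<N. e k i) = 0) \<Longrightarrow> 1 \<le> M \<Longrightarrow>
    (\<And>w. c * (\<Sum>i<N. w i) = 0 \<Longrightarrow>
      spin_expect h N (\<lambda>\<sigma>. exp (\<Sum>i<N. w i * (\<sigma> i - tanh h))) \<le> M * exp (q * (\<Sum>i<N. (w i)\<^sup>2) / 2)) \<Longrightarrow>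
    spin_expect h N (\<lambda>\<sigma>. exp (\<beta> / 2 * quad N D (\<lambda>i. \<sigma> i - tanh h) + (\<Sum>i<N. v i * (\<sigma> i - tanh h))))
      \<le> M * exp (C * (frob N D + (\<Sum>i<N. \<bar>D i i\<bar>) + (\<Sum>i<N. (v i)\<^sup>2)))"
  show ?thesis
  \<comment> \<open>40 = 16 + 24: the Frobenius norm of the compression, and its trace norm at most
    6 <= 24 \<open>frob N a\<close>.\<close>
  proof (rule that[of "40 * C"])
    fix N :: nat and a :: "nat \<Rightarrow> nat \<Rightarrow> real" and h M :: real and v :: "nat \<Rightarrow> real"
    assume N: "0 < N" and a: "sym_on N a" and rs: "\<And>i. i < N \<Longrightarrow> 0 \<le> mult_mv N a (\<lambda>_. 1) i"
      and diag: "\<And>i. i < N \<Longrightarrow> a i i = 0" and top: "\<And>y. quad N a y \<le> 2 * (\<Sum>i<N. (y i)\<^sup>2)"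
      and F: "1 / 4 \<le> frob N a"
      and gap: "\<And>y. (\<Sum>i<N. y i) = 0 \<Longrightarrow> quad N a y \<le> \<Lambda> * (\<Sum>i<N. (y i)\<^sup>2)" and M: "1 \<le> M"
      and H: "\<And>w. (\<Sum>i<N. w i) = 0 \<Longrightarrow>
        spin_expect h N (\<lambda>\<sigma>. exp (\<Sum>i<N. w i * (\<sigma> i - tanh h))) \<le> M * exp (q * (\<Sum>i<N. (w i)\<^sup>2) / 2)"
    let ?D = "proj_mat N a"
    obtain e l where e: "orthobasis N e" and sp: "\<And>i j. i < N \<Longrightarrow> j < N \<Longrightarrow> ?D i j = spec_mat N e l i j"
      by (rule symmetric_eigenbasis[OF sym_on_proj_mat[OF N a]]) (rule that; blast)
    have ev: "mult_mv N ?D (e k) i = l k * e k i" if "k < N" "i < N" for k i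
    proof -
      have "mult_mv N ?D (e k) i = mult_mv N (spec_mat N e l) (e k) i"
        using sp that by (simp add: mult_mv_def)
      also have "\<dots> = (\<Sum>j<N. l j * e j i * (\<Sum>n<N. e k n * e j n))"
        unfolding mult_mv_spec[OF e] by (simp add: mult_ac)
      also have "\<dots> = (\<Sum>j<N. l j * e j i * (if k = j then 1 else 0))"
        using that by (simp add: orthonormal[OF e])
      finally show ?thesis using that by (simp add: sum_delta_lessThan)
    qed
    have l: "l k \<le> \<Lambda>" if k: "k < N" for k
    proof -
      have "l k = l k * (\<Sum>i<N. (e k i)\<^sup>2)" using basis_vector_norm[OF e k] by simp
      also have "\<dots> = quad N ?D (e k)"
        using ev[OF k] by (simp add: quad_def power2_eq_square sum_distrib_left mult_ac)
      also have "\<dots> = quad N a (proj N (e k))" by (rule quad_proj[OF N a, symmetric])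
      also have "\<dots> \<le> \<Lambda> * (\<Sum>i<N. (proj N (e k) i)\<^sup>2)" by (rule gap[OF proj_sum[OF N]])
      also have "\<dots> \<le> \<Lambda> * (\<Sum>i<N. (e k i)\<^sup>2)" using pos by (intro mult_left_mono proj_norm_le) auto
      finally show ?thesis using basis_vector_norm[OF e k] by simp
    qed
    have z: "1 * (\<Sum>i<N. e k i) = 0" if k: "k < N" "l k \<noteq> 0" for k
    proof -
      have "(\<Sum>i<N. 1 * mult_mv N ?D (e k) i) = (\<Sum>i<N. mult_mv N ?D (\<lambda>_. 1) i * e k i)"
        by (rule mult_mv_adjoint[OF sym_on_proj_mat[OF N a]])
      also have "\<dots> = 0" by (simp add: proj_mat_const[OF N a])
      finally show ?thesis using ev[OF k(1)] k(2) by (simp add: sum_distrib_left [symmetric])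
    qed
    have S: "(\<Sum>i<N. mult_mv N a (\<lambda>_. 1) i) \<le> 2 * real N" using top[of "\<lambda>_. 1"] by (simp add: quad_def)
    have tr: "(\<Sum>i<N. \<bar>?D i i\<bar>) \<le> 24 * frob N a"
    proof -
      have "(\<Sum>i<N. \<bar>?D i i\<bar>) \<le> 3 * (\<Sum>i<N. mult_mv N a (\<lambda>_. 1) i) / real N"
        by (rule trace_proj_mat[OF N a rs diag])
      also have "\<dots> \<le> 6" using S N by (simp add: pos_divide_le_eq)
      finally show ?thesis using F by linarith
    qed
    have "spin_expect h N (\<lambda>\<sigma>. exp (\<beta> / 2 * quad N a (proj N \<sigma>) + (\<Sum>i<N. v i * (\<sigma> i - tanh h))))
        = spin_expect h N (\<lambda>\<sigma>. exp (\<beta> / 2 * quad N ?D (\<lambda>i. \<sigma> i - tanh h) + (\<Sum>i<N. v i * (\<sigma> i - tanh h))))"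
      unfolding quad_proj[OF N a, symmetric] proj_shift[OF N] ..
    also have "\<dots> \<le> M * exp (C * (frob N ?D + (\<Sum>i<N. \<bar>?D i i\<bar>) + (\<Sum>i<N. (v i)\<^sup>2)))"
      by (rule C(2)[OF e sp l, where c = 1]) (use z M H in auto)
    also have "\<dots> \<le> M * exp (40 * C * (frob N a + (\<Sum>i<N. (v i)\<^sup>2)))"
    proof -
      have "frob N ?D + (\<Sum>i<N. \<bar>?D i i\<bar>) + (\<Sum>i<N. (v i)\<^sup>2) \<le> 40 * (frob N a + (\<Sum>i<N. (v i)\<^sup>2))"
        using frob_proj_mat[OF N a] tr sum_nonneg[of "{..<N}" "\<lambda>i. (v i)\<^sup>2"] by simp
      then have "C * (frob N ?D + (\<Sum>i<N. \<bar>?D i i\<bar>) + (\<Sum>i<N. (v i)\<^sup>2)) \<le> C * (40 * (frob N a + (\<Sum>i<N. (v i)\<^sup>2)))"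
        using C(1) by (intro mult_left_mono)
      moreover have "C * (40 * (frob N a + (\<Sum>i<N. (v i)\<^sup>2))) = 40 * C * (frob N a + (\<Sum>i<N. (v i)\<^sup>2))"
        by (simp only: mult.assoc mult.left_commute)
      ultimately have "C * (frob N ?D + (\<Sum>i<N. \<bar>?D i i\<bar>) + (\<Sum>i<N. (v i)\<^sup>2))
          \<le> 40 * C * (frob N a + (\<Sum>i<N. (v i)\<^sup>2))" by (simp only:)
      then show ?thesis using M by (intro mult_left_mono) simp_all
    qed
    finally show "spin_expect h N (\<lambda>\<sigma>. exp (\<beta> / 2 * quad N a (proj N \<sigma>) + (\<Sum>i<N. v i * (\<sigma> i - tanh h))))
      \<le> M * exp (40 * C * (frob N a + (\<Sum>i<N. (v i)\<^sup>2)))" .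
  qed (use C in simp)
qed

section \<open>The subcritical regime\<close>

lemma spin_expect_pos:
  assumes "\<And>\<sigma>. 0 < f \<sigma>" shows "0 < spin_expect h N f"
  unfolding spin_expect_def
  by (intro sum_pos mult_pos_pos spin_weight_pos finite_spins assms)
    (simp add: spins_def PiE_eq_empty_iff)

lemma ln_spin_expect_le:
  assumes "spin_expect h N (\<lambda>\<sigma>. exp (f \<sigma>)) \<le> exp x"
  shows "ln (spin_expect h N (\<lambda>\<sigma>. exp (f \<sigma>))) \<le> x"
proof -
  have "ln (spin_expect h N (\<lambda>\<sigma>. exp (f \<sigma>))) \<le> ln (exp x)"
    using assms spin_expect_pos[of "\<lambda>\<sigma>. exp (f \<sigma>)" h N] by (intro ln_mono) auto
  then show ?thesis by simp
qed

definition entries :: "real mat \<Rightarrow> nat \<Rightarrow> nat \<Rightarrow> real" where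
  "entries A i j = A $$ (i, j)"

lemma coupling_matrixD:
  assumes "coupling_matrix N A"
  shows "A \<in> carrier_mat N N" "sym_on N (entries A)" "\<And>i. i < N \<Longrightarrow> entries A i i = 0"
    "\<And>i. i < N \<Longrightarrow> 0 \<le> mult_mv N (entries A) (\<lambda>_. 1) i"
    "\<And>i. i < N \<Longrightarrow> row_sum A i = mult_mv N (entries A) (\<lambda>_. 1) i"
    "(frob_norm A)\<^sup>2 = frob N (entries A)"
proof -
  have A: "A \<in> carrier_mat N N" "transpose_mat A = A" using assms by (auto simp: coupling_matrix_def)
  show "A \<in> carrier_mat N N" by (rule A)
  have "A $$ (i, j) = A $$ (j, i)" if "i < N" "j < N" for i j
    using that A index_transpose_mat(1)[of j A i] by auto
  then show "sym_on N (entries A)" by (simp add: sym_on_def entries_def)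
  show "entries A i i = 0" "0 \<le> mult_mv N (entries A) (\<lambda>_. 1) i"
    "row_sum A i = mult_mv N (entries A) (\<lambda>_. 1) i" if "i < N" for i
    using assms that A by (auto simp: coupling_matrix_def entries_def mult_mv_def row_sum_def intro!: sum_nonneg)
  show "(frob_norm A)\<^sup>2 = frob N (entries A)"
    using A by (simp add: frob_norm_def frob_def entries_def sum_nonneg)
qed

lemma coupling_spectral:
  assumes "coupling_matrix N A" "2 \<le> N"
  obtains e l where "orthobasis N e" "\<And>i j. i < N \<Longrightarrow> j < N \<Longrightarrow> entries A i j = spec_mat N e l i j"
    "\<And>k. k < N \<Longrightarrow> l k \<le> eigval 1 A" "l 0 = eigval 1 A" "\<And>k. 1 \<le> k \<Longrightarrow> k < N \<Longrightarrow> l k \<le> eigval 2 A"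
proof (rule symmetric_eigenbasis[OF coupling_matrixD(2)[OF assms(1)]])
  fix e l
  assume e: "orthobasis N e" and sp: "\<And>i j. i < N \<Longrightarrow> j < N \<Longrightarrow> entries A i j = spec_mat N e l i j"
    and mono: "\<And>j k. j \<le> k \<Longrightarrow> k < N \<Longrightarrow> l k \<le> l j"
  have eig: "eigval (Suc k) A = l k" if "k < N" for k
    using eigval_spectral[OF coupling_matrixD(1)[OF assms(1)] e _ mono that] sp by (simp add: entries_def)
  have l0: "l 0 = eigval 1 A" using eig[of 0] assms by simp
  have l1: "l 1 = eigval 2 A" using eig[of 1] assms by (simp add: numeral_2_eq_2)
  show thesis
  proof (rule that[OF e sp])
    show "l k \<le> eigval 1 A" if "k < N" for k using mono[of 0 k] that l0 by simp
    show "l k \<le> eigval 2 A" if "1 \<le> k" "k < N" for k using mono[OF that] l1 by simp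
  qed (use l0 in auto)
qed

lemma gap_eq:
  assumes "coupling_matrix N A" "h = \<beta> * tanh h + B" "mf_point \<beta> B = tanh h"
  shows "ln (partition_fun A \<beta> B) - mf_prediction A \<beta> B
    = ln (spin_expect h N (\<lambda>\<sigma>. exp (\<beta> / 2 * quad N (entries A) (\<lambda>i. \<sigma> i - tanh h)
        + (\<Sum>i<N. \<beta> * tanh h * (row_sum A i - 1) * (\<sigma> i - tanh h)))))"
  using ln_partition_fun_gap[OF coupling_matrixD(1)[OF assms(1)] _ assms(2,3)] coupling_matrixD(2)[OF assms(1)]
  by (simp add: entries_def [abs_def])

text \<open>If the right-hand side vanishes, then A = 0, all row sums are 0 and the sum of (R_i -
  1)^2 is N; hence t = 0 and the whole exponent vanishes. This settles the degenerate case of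
  \<open>lesssim_of_eventually\<close>.\<close>

lemma gap_nonpos_degenerate:
  assumes A: "coupling_matrix N A" and N: "2 \<le> N"
    and h: "h = \<beta> * tanh h + B" "mf_point \<beta> B = tanh h"
    and z: "(frob_norm A)\<^sup>2 + (mf_point \<beta> B)\<^sup>2 * (\<Sum>i<N. (row_sum A i - 1)\<^sup>2) = 0"
  shows "ln (partition_fun A \<beta> B) - mf_prediction A \<beta> B \<le> 0"
proof -
  have F: "frob N (entries A) = 0" and T: "(tanh h)\<^sup>2 * (\<Sum>i<N. (row_sum A i - 1)\<^sup>2) = 0"
    using z h(2) unfolding coupling_matrixD(6)[OF A]
    by (auto simp: add_nonneg_eq_0_iff frob_nonneg sum_nonneg)
  have a0: "entries A i j = 0" if "i < N" "j < N" for i j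
    using F that by (simp add: frob_def sum_nonneg_eq_0_iff sum_nonneg)
  then have "row_sum A i = 0" if "i < N" for i
    using that coupling_matrixD(5)[OF A that] by (simp add: mult_mv_def)
  then have "(\<Sum>i<N. (row_sum A i - 1)\<^sup>2) = real N" by simp
  then have "tanh h = 0" using T N by simp
  moreover have "quad N (entries A) y = 0" for y using a0 by (simp add: quad_def mult_mv_def)
  ultimately show ?thesis unfolding gap_eq[OF A h] by simp
qed

text \<open>With B non-zero, h = \<beta> t + B where t and B have the same sign, so \<beta> t / h <
  1 strictly, and s = t / h is the Kearns-Saul constant. On \<open>Theta11\<close>, h = 0 and s =
  1.\<close>

lemma Theta1_subcritical:
  assumes "(\<beta>, B) \<in> Theta1"
  obtains h s where "h = \<beta> * tanh h + B" "mf_point \<beta> B = tanh h" "0 \<le> s" "\<beta> * s < 1" "0 < \<beta>"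
    "\<And>x. psi h x \<le> s * x\<^sup>2 / 2"
proof (cases "(\<beta>, B) \<in> Theta12")
  case True
  define t where "t = mf_point \<beta> B"
  define h where "h = \<beta> * t + B"
  have t: "t = tanh h" "sgn t = sgn B" using mf_point_Theta12[OF True] by (auto simp: t_def h_def)
  have \<beta>: "0 < \<beta>" and B: "B \<noteq> 0" using True by (auto simp: Theta12_def)
  have *: "0 < t / h \<and> \<beta> * (t / h) < 1"
  proof (cases "0 < B")
    case True
    then have "0 < t" using t(2) by (simp add: sgn_1_pos)
    then have "0 < h" "\<beta> * t < h" using \<beta> True by (auto simp: h_def intro: add_pos_pos)
    then show ?thesis using \<open>0 < t\<close> by simp
  next
    case False
    then have "B < 0" using B by simp
    then have "t < 0" using t(2) by (simp add: sgn_1_neg)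
    then have "\<beta> * t < 0" using \<beta> by (simp add: mult_pos_neg)
    then have "h < 0" "h < \<beta> * t" using \<open>B < 0\<close> by (auto simp: h_def)
    then show ?thesis using \<open>t < 0\<close> by (simp add: divide_neg_neg neg_divide_less_eq)
  qed
  then have "h \<noteq> 0" by auto
  show ?thesis
  proof (rule that[of h "t / h"])
    show "psi h x \<le> t / h * x\<^sup>2 / 2" for x using psi_le_kearns_saul[OF \<open>h \<noteq> 0\<close>, of x] t by simp
  qed (use * \<beta> t in \<open>auto simp: t_def h_def\<close>)
next
  case False
  then have "(\<beta>, B) \<in> Theta11" using assms by (simp add: Theta1_def)
  then show ?thesis using mf_point_zero[of \<beta> B] psi_le_square
    by (intro that[of 0 1]) (auto simp: Theta11_def)
qed

lemma Theta1_bound: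
  fixes A :: "nat \<Rightarrow> real mat" and \<beta> B :: real
  assumes A: "\<And>N. N \<ge> 2 \<Longrightarrow> coupling_matrix N (A N)"
    and top: "(\<lambda>N. eigval 1 (A N)) \<longlonglongrightarrow> 1" and \<Theta>: "(\<beta>, B) \<in> Theta1"
  shows "lesssim (\<lambda>N. ln (partition_fun (A N) \<beta> B) - mf_prediction (A N) \<beta> B)
    (\<lambda>N. (frob_norm (A N))\<^sup>2 + (mf_point \<beta> B)\<^sup>2 * (\<Sum>i<N. (row_sum (A N) i - 1)\<^sup>2))"
proof (rule Theta1_subcritical[OF \<Theta>])
  fix h s
  assume h: "h = \<beta> * tanh h + B" "mf_point \<beta> B = tanh h" and s: "0 \<le> s" "\<beta> * s < 1" and \<beta>: "0 < \<beta>"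
    and psi: "\<And>x. psi h x \<le> s * x\<^sup>2 / 2"
  \<comment> \<open>\<Lambda> > 1 leaves room for a top eigenvalue tending to 1, while \<beta>
    \<Lambda> s = 2 \<beta> s / (1 + \<beta> s) is still below 1.\<close>
  define \<Lambda> where "\<Lambda> = 2 / (1 + \<beta> * s)"
  have bs: "0 \<le> \<beta> * s" using s \<beta> by simp
  have \<Lambda>: "1 < \<Lambda>" using s bs by (simp add: \<Lambda>_def)
  have sub: "\<beta> * \<Lambda> * s < 1"
  proof -
    have "\<beta> * \<Lambda> * s = 2 * (\<beta> * s) / (1 + \<beta> * s)" by (simp add: \<Lambda>_def)
    then show ?thesis using s bs by simp
  qed
  have "0 < \<Lambda>" using \<Lambda> by simp
  show ?thesis
  proof (rule tilted_quadratic_bound[OF \<beta> s(1) \<open>0 < \<Lambda>\<close> sub])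
    fix C :: real
    assume C0: "0 \<le> C" and C: "\<And>N e l D h M c v.
      orthobasis N e \<Longrightarrow> (\<And>i j. i < N \<Longrightarrow> j < N \<Longrightarrow> D i j = spec_mat N e l i j) \<Longrightarrow>
      (\<And>k. k < N \<Longrightarrow> l k \<le> \<Lambda>) \<Longrightarrow>
      (\<And>k. k < N \<Longrightarrow> l k \<noteq> 0 \<Longrightarrow> c * (\<Sum>i<N. e k i) = 0) \<Longrightarrow> 1 \<le> M \<Longrightarrow>
      (\<And>w. c * (\<Sum>i<N. w i) = 0 \<Longrightarrow>
        spin_expect h N (\<lambda>\<sigma>. exp (\<Sum>i<N. w i * (\<sigma> i - tanh h))) \<le> M * exp (s * (\<Sum>i<N. (w i)\<^sup>2) / 2)) \<Longrightarrow>
      spin_expect h N (\<lambda>\<sigma>. exp (\<beta> / 2 * quad N D (\<lambda>i. \<sigma> i - tanh h) + (\<Sum>i<N. v i * (\<sigma> i - tanh h))))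
        \<le> M * exp (C * (frob N D + (\<Sum>i<N. \<bar>D i i\<bar>) + (\<Sum>i<N. (v i)\<^sup>2)))"
    have "eventually (\<lambda>N. eigval 1 (A N) < \<Lambda>) sequentially" by (rule order_tendstoD(2)[OF top \<Lambda>])
    then obtain N0 where N0: "\<And>N. N \<ge> N0 \<Longrightarrow> eigval 1 (A N) < \<Lambda>" by (auto simp: eventually_sequentially)
    show ?thesis
    proof (rule lesssim_of_eventually[where C = "C * (1 + \<beta>\<^sup>2)" and ?N0.0 = N0])
      fix N :: nat assume N: "N \<ge> N0" "N \<ge> 2"
      let ?a = "entries (A N)" and ?t = "mf_point \<beta> B"
      let ?v = "\<lambda>i. \<beta> * tanh h * (row_sum (A N) i - 1)"
      define F where "F = frob N ?a"
      define r where "r = (\<Sum>i<N. (row_sum (A N) i - 1)\<^sup>2)"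
      note cm = A[OF N(2)]
      have r: "0 \<le> r" and F: "0 \<le> F" by (auto simp: r_def F_def sum_nonneg frob_nonneg)
      have "spin_expect h N (\<lambda>\<sigma>. exp (\<beta> / 2 * quad N ?a (\<lambda>i. \<sigma> i - tanh h) + (\<Sum>i<N. ?v i * (\<sigma> i - tanh h))))
          \<le> 1 * exp (C * (frob N ?a + (\<Sum>i<N. \<bar>?a i i\<bar>) + (\<Sum>i<N. (?v i)\<^sup>2)))"
      proof (rule coupling_spectral[OF cm N(2)])
        fix e l
        assume e: "orthobasis N e" and sp: "\<And>i j. i < N \<Longrightarrow> j < N \<Longrightarrow> ?a i j = spec_mat N e l i j"
          and l: "\<And>k. k < N \<Longrightarrow> l k \<le> eigval 1 (A N)"
        show ?thesis
        proof (rule C[OF e sp, where c = 0])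
          show "l k \<le> \<Lambda>" if "k < N" for k using l[OF that] N0[OF N(1)] by simp
          show "spin_expect h N (\<lambda>\<sigma>. exp (\<Sum>i<N. w i * (\<sigma> i - tanh h))) \<le> 1 * exp (s * (\<Sum>i<N. (w i)\<^sup>2) / 2)" for w
            unfolding spin_expect_exp_linear using psi
            by (auto simp: sum_distrib_left sum_divide_distrib intro!: sum_mono)
        qed auto
      qed
      moreover have "(\<Sum>i<N. \<bar>?a i i\<bar>) = 0" using coupling_matrixD(3)[OF cm] by simp
      moreover have "(\<Sum>i<N. (?v i)\<^sup>2) = \<beta>\<^sup>2 * (tanh h)\<^sup>2 * r"
        by (simp add: r_def power_mult_distrib sum_distrib_left mult.assoc)
      ultimately have "ln (partition_fun (A N) \<beta> B) - mf_prediction (A N) \<beta> B \<le> C * (F + \<beta>\<^sup>2 * (tanh h)\<^sup>2 * r)"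
        unfolding gap_eq[OF cm h] by (intro ln_spin_expect_le) (simp add: F_def)
      also have "\<dots> \<le> C * ((1 + \<beta>\<^sup>2) * (F + (tanh h)\<^sup>2 * r))"
        using F r C0 by (intro mult_left_mono) (auto simp: algebra_simps)
      finally show "ln (partition_fun (A N) \<beta> B) - mf_prediction (A N) \<beta> B
          \<le> C * (1 + \<beta>\<^sup>2) * ((frob_norm (A N))\<^sup>2 + ?t\<^sup>2 * (\<Sum>i<N. (row_sum (A N) i - 1)\<^sup>2))"
        unfolding coupling_matrixD(6)[OF cm] F_def r_def h(2) by (simp only: mult.assoc)
    next
      fix N :: nat assume N: "N \<ge> 2"
      show "0 \<le> (frob_norm (A N))\<^sup>2 + (mf_point \<beta> B)\<^sup>2 * (\<Sum>i<N. (row_sum (A N) i - 1)\<^sup>2)"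
        by (simp add: sum_nonneg)
      show "ln (partition_fun (A N) \<beta> B) - mf_prediction (A N) \<beta> B \<le> 0"
        if "(frob_norm (A N))\<^sup>2 + (mf_point \<beta> B)\<^sup>2 * (\<Sum>i<N. (row_sum (A N) i - 1)\<^sup>2) = 0"
        by (rule gap_nonpos_degenerate[OF A[OF N] N h that])
    qed
  qed
qed

text \<open>The spectral facts shared by \<open>Theta2\<close> and \<open>Theta3\<close>. The lower
  bound on the Frobenius norm, which comes from the top eigenvalue, allows additive constants to be
  absorbed.\<close>

lemma eventual_spectral_gap:
  fixes A :: "nat \<Rightarrow> real mat"
  assumes A: "\<And>N. N \<ge> 2 \<Longrightarrow> coupling_matrix N (A N)"
    and top: "(\<lambda>N. eigval 1 (A N)) \<longlonglongrightarrow> 1"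
    and gap: "limsup (\<lambda>N. ereal (eigval 2 (A N) / eigval 1 (A N))) < 1"
  obtains \<delta> N0 where "0 < \<delta>" "\<delta> \<le> 1"
    "\<And>N y. N \<ge> N0 \<Longrightarrow> N \<ge> 2 \<Longrightarrow> quad N (entries (A N)) y \<le> 2 * (\<Sum>i<N. (y i)\<^sup>2)"
    "\<And>N. N \<ge> N0 \<Longrightarrow> N \<ge> 2 \<Longrightarrow> 1 / 4 \<le> frob N (entries (A N))"
    "\<And>N y. N \<ge> N0 \<Longrightarrow> N \<ge> 2 \<Longrightarrow> (\<Sum>i<N. (row_sum (A N) i - 1)\<^sup>2) \<le> \<delta> ^ 3 / 64 * real N \<Longrightarrow>
      (\<Sum>i<N. y i) = 0 \<Longrightarrow> quad N (entries (A N)) y \<le> (1 - \<delta> / 4) * (\<Sum>i<N. (y i)\<^sup>2)"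
proof -
  obtain c where c: "limsup (\<lambda>N. ereal (eigval 2 (A N) / eigval 1 (A N))) < ereal c" "ereal c < 1"
    using ereal_dense2[OF gap] by blast
  define \<delta> where "\<delta> = min 1 (1 - c)"
  have \<delta>: "0 < \<delta>" "\<delta> \<le> 1" "c \<le> 1 - \<delta>" using c(2) by (auto simp: \<delta>_def)
  have "eventually (\<lambda>N. ereal (eigval 2 (A N) / eigval 1 (A N)) < ereal c) sequentially"
    by (rule Limsup_lessD[OF c(1)])
  moreover have "eventually (\<lambda>N. 1 / 2 < eigval 1 (A N)) sequentially"
    by (rule order_tendstoD(1)[OF top]) simp
  moreover have "eventually (\<lambda>N. eigval 1 (A N) < 1 + \<delta> / 2) sequentially"
    by (rule order_tendstoD(2)[OF top]) (use \<delta> in simp)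
  ultimately have "eventually (\<lambda>N. eigval 2 (A N) / eigval 1 (A N) < c \<and> 1 / 2 < eigval 1 (A N)
      \<and> eigval 1 (A N) < 1 + \<delta> / 2) sequentially"
    by eventually_elim auto
  then obtain N0 where N0: "\<And>N. N \<ge> N0 \<Longrightarrow> eigval 2 (A N) / eigval 1 (A N) < c"
    "\<And>N. N \<ge> N0 \<Longrightarrow> 1 / 2 < eigval 1 (A N)" "\<And>N. N \<ge> N0 \<Longrightarrow> eigval 1 (A N) < 1 + \<delta> / 2"
    unfolding eventually_sequentially by blast
  have main: "quad N (entries (A N)) y \<le> 2 * (\<Sum>i<N. (y i)\<^sup>2) \<and> 1 / 4 \<le> frob N (entries (A N)) \<and>
      ((\<Sum>i<N. (row_sum (A N) i - 1)\<^sup>2) \<le> \<delta> ^ 3 / 64 * real N \<longrightarrow>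
      (\<Sum>i<N. y i) = 0 \<longrightarrow> quad N (entries (A N)) y \<le> (1 - \<delta> / 4) * (\<Sum>i<N. (y i)\<^sup>2))"
    if N: "N \<ge> N0" "N \<ge> 2" for N y
  proof (rule coupling_spectral[OF A[OF N(2)] N(2)])
    fix e l
    assume e: "orthobasis N e" and sp: "\<And>i j. i < N \<Longrightarrow> j < N \<Longrightarrow> entries (A N) i j = spec_mat N e l i j"
      and l: "\<And>k. k < N \<Longrightarrow> l k \<le> eigval 1 (A N)" "l 0 = eigval 1 (A N)"
        "\<And>k. 1 \<le> k \<Longrightarrow> k < N \<Longrightarrow> l k \<le> eigval 2 (A N)"
    have N': "0 < N" using N by simp
    have b: "1 / 2 < eigval 1 (A N)" "eigval 1 (A N) < 1 + \<delta> / 2" using N0 N by auto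
    then have two: "eigval 1 (A N) \<le> 2" using \<delta> by linarith
    have "quad N (entries (A N)) y \<le> 2 * (\<Sum>i<N. (y i)\<^sup>2)"
    proof (rule quad_le_top[OF e sp])
      show "l k \<le> 2" if "k < N" for k using l(1)[OF that] two by simp
    qed
    moreover have "1 / 4 \<le> frob N (entries (A N))"
    proof -
      have "(1 / 2)\<^sup>2 \<le> (l 0)\<^sup>2" using b l(2) by (intro power_mono) auto
      also have "\<dots> \<le> (\<Sum>k<N. (l k)\<^sup>2)" using N' by (intro member_le_sum) auto
      also have "\<dots> = frob N (spec_mat N e l)" by (rule frob_spec[OF e, symmetric])
      also have "\<dots> = frob N (entries (A N))" using sp by (intro frob_cong) simp
      finally show ?thesis by (simp add: power_divide)
    qed
    moreover have "quad N (entries (A N)) y \<le> (1 - \<delta> / 4) * (\<Sum>i<N. (y i)\<^sup>2)"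
      if r: "(\<Sum>i<N. (row_sum (A N) i - 1)\<^sup>2) \<le> \<delta> ^ 3 / 64 * real N" and y: "(\<Sum>i<N. y i) = 0"
    proof (rule quad_le_off_constants[OF e sp N' \<delta>(1,2) _ _ _ y])
      show "l 0 \<le> 2" using l(2) two by simp
      show "(\<Sum>i<N. (mult_mv N (entries (A N)) (\<lambda>_. 1) i - 1)\<^sup>2) \<le> \<delta> ^ 3 / 64 * real N"
        using r coupling_matrixD(5)[OF A[OF N(2)]] by simp
      fix k assume k: "1 \<le> k" "k < N"
      \<comment> \<open>The ratio bound is turned into an absolute one: (1 - \<delta>) (1 + \<delta>
        / 2) <= 1 - \<delta> / 2.\<close>
      have "eigval 2 (A N) \<le> c * eigval 1 (A N)" using N0(1)[OF N(1)] b(1) by (simp add: pos_divide_less_eq)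
      also have "\<dots> \<le> (1 - \<delta>) * eigval 1 (A N)" using \<delta> b by (intro mult_right_mono) auto
      also have "\<dots> \<le> (1 - \<delta>) * (1 + \<delta> / 2)" using \<delta> b by (intro mult_left_mono) auto
      also have "\<dots> \<le> 1 - \<delta> / 2" by (simp add: algebra_simps)
      finally show "l k \<le> 1 - \<delta> / 2" using l(3)[OF k] by simp
    qed
    ultimately show ?thesis by blast
  qed
  show ?thesis by (rule that[OF \<delta>(1,2), of N0]) (use main in blast)+
qed

section \<open>The critical point\<close>

text \<open>Splits y into its mean and its fluctuation. The cross term involves only the deviations
  of the row sums, since their constant part is orthogonal to the fluctuation.\<close>

lemma quad_decompose:
  assumes N: "0 < N" and a: "sym_on N a"
  defines "r \<equiv> \<lambda>i. mult_mv N a (\<lambda>_. 1) i - 1" and "m \<equiv> \<lambda>y. (\<Sum>i<N. y i) / real N"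
  shows "quad N a y = (m y)\<^sup>2 * (real N + (\<Sum>i<N. r i)) + 2 * m y * (\<Sum>i<N. r i * proj N y i)
      + quad N a (proj N y)"
proof -
  have "y = (\<lambda>i. proj N y i + m y)" by (simp add: proj_def m_def)
  then have "quad N a y = quad N a (\<lambda>i. proj N y i + m y)" by simp
  also have "\<dots> = quad N a (proj N y) + 2 * m y * (\<Sum>i<N. mult_mv N a (\<lambda>_. 1) i * proj N y i)
      + (m y)\<^sup>2 * (\<Sum>i<N. mult_mv N a (\<lambda>_. 1) i)"
    by (rule quad_shift[OF a])
  also have "(\<Sum>i<N. mult_mv N a (\<lambda>_. 1) i * proj N y i) = (\<Sum>i<N. r i * proj N y i)"
    using proj_sum[OF N, of y] by (simp add: r_def left_diff_distrib sum_subtractf)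
  also have "(\<Sum>i<N. mult_mv N a (\<lambda>_. 1) i) = real N + (\<Sum>i<N. r i)"
    by (simp add: r_def sum_subtractf)
  finally show ?thesis by simp
qed

lemma spin_sum_int:
  assumes "\<sigma> \<in> spins N"
  obtains n :: int where "n \<in> {- int N..int N}" "(\<Sum>i<N. \<sigma> i) = of_int n"
proof -
  define k where "k i = (if \<sigma> i = 1 then 1 else - 1 :: int)" for i
  have s: "\<sigma> i = of_int (k i) \<and> \<bar>k i\<bar> \<le> 1" if "i < N" for i
    using spins_cases[OF assms that] by (auto simp: k_def)
  let ?n = "\<Sum>i<N. k i"
  have "\<bar>?n\<bar> \<le> (\<Sum>i<N. \<bar>k i\<bar>)" by (rule sum_abs)
  also have "\<dots> \<le> (\<Sum>i<N. 1)" using s by (intro sum_mono) auto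
  finally have "?n \<in> {- int N..int N}" by auto
  moreover have "(\<Sum>i<N. \<sigma> i) = of_int ?n" unfolding of_int_sum using s by (intro sum.cong) auto
  ultimately show ?thesis by (rule that)
qed

lemma spins_norm: "\<sigma> \<in> spins N \<Longrightarrow> (\<Sum>i<N. (\<sigma> i)\<^sup>2) = real N"
proof -
  assume "\<sigma> \<in> spins N"
  then have "(\<Sum>i<N. (\<sigma> i)\<^sup>2) = (\<Sum>i<N. 1)"
    using spins_cases by (intro sum.cong refl) fastforce
  then show ?thesis by simp
qed

text \<open>The maximum over \<open>u\<close> of \<open>u * b - N * u\<^sup>2 / 48\<close>, attained at \<open>u = 24 * b / N\<close>.\<close>

lemma quartic_absorb:
  fixes N u S c :: real
  assumes "0 < N"
  shows "u * S / 2 + u * c - N * u\<^sup>2 / 48 \<le> (6 * S\<^sup>2 + 24 * c\<^sup>2) / N"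
proof -
  have "N * (u * S / 2 + u * c - N * u\<^sup>2 / 48) \<le> 6 * S\<^sup>2 + 24 * c\<^sup>2"
    using zero_le_power2[of "S / 2 + c - N * u / 24"] zero_le_power2[of "S / 2 - c"]
    by (simp add: power2_eq_square field_simps)
  then show ?thesis using assms by (simp add: pos_le_divide_eq mult.commute)
qed

text \<open>The magnetisation takes at most 2 N + 1 values m. For each, the quadratic term in m
  becomes a tilt by m, and the fluctuations are subcritical by the gap under every tilt, since the
  sub-Gaussian constant 1 is valid for all fields.\<close>

lemma Theta3_magnetization_bound:
  fixes \<delta> :: real
  assumes \<delta>: "0 < \<delta>" "\<delta> \<le> 1"
  obtains C where "0 \<le> C" "\<And>N a. 2 \<le> N \<Longrightarrow> sym_on N a \<Longrightarrow>
    (\<And>i. i < N \<Longrightarrow> 0 \<le> mult_mv N a (\<lambda>_. 1) i) \<Longrightarrow> (\<And>i. i < N \<Longrightarrow> a i i = 0) \<Longrightarrow>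
    (\<And>y. quad N a y \<le> 2 * (\<Sum>i<N. (y i)\<^sup>2)) \<Longrightarrow> 1 / 4 \<le> frob N a \<Longrightarrow>
    (\<And>y. (\<Sum>i<N. y i) = 0 \<Longrightarrow> quad N a y \<le> (1 - \<delta> / 4) * (\<Sum>i<N. (y i)\<^sup>2)) \<Longrightarrow>
    ln (spin_expect 0 N (\<lambda>\<sigma>. exp (quad N a \<sigma> / 2))) \<le> C * (frob N a
      + (\<Sum>i<N. (mult_mv N a (\<lambda>_. 1) i - 1)\<^sup>2)\<^sup>2 / real N
      + (\<Sum>i<N. mult_mv N a (\<lambda>_. 1) i - 1)\<^sup>2 / real N + ln (real N))"
proof -
  have pos: "0 < (1::real)" "0 \<le> (1::real)" "0 < 1 - \<delta> / 4" "1 * (1 - \<delta> / 4) * 1 < 1" using \<delta> by auto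
  show ?thesis
  proof (rule projected_quadratic_bound[OF pos])
    fix C :: real
    assume C0: "0 \<le> C" and C: "\<And>N a h M v.
      0 < N \<Longrightarrow> sym_on N a \<Longrightarrow> (\<And>i. i < N \<Longrightarrow> 0 \<le> mult_mv N a (\<lambda>_. 1) i) \<Longrightarrow>
      (\<And>i. i < N \<Longrightarrow> a i i = 0) \<Longrightarrow> (\<And>y. quad N a y \<le> 2 * (\<Sum>i<N. (y i)\<^sup>2)) \<Longrightarrow> 1 / 4 \<le> frob N a \<Longrightarrow>
      (\<And>y. (\<Sum>i<N. y i) = 0 \<Longrightarrow> quad N a y \<le> (1 - \<delta> / 4) * (\<Sum>i<N. (y i)\<^sup>2)) \<Longrightarrow> 1 \<le> M \<Longrightarrow>
      (\<And>w. (\<Sum>i<N. w i) = 0 \<Longrightarrow>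
        spin_expect h N (\<lambda>\<sigma>. exp (\<Sum>i<N. w i * (\<sigma> i - tanh h))) \<le> M * exp (1 * (\<Sum>i<N. (w i)\<^sup>2) / 2)) \<Longrightarrow>
      spin_expect h N (\<lambda>\<sigma>. exp (1 / 2 * quad N a (proj N \<sigma>) + (\<Sum>i<N. v i * (\<sigma> i - tanh h))))
        \<le> M * exp (C * (frob N a + (\<Sum>i<N. (v i)\<^sup>2)))"
    show ?thesis
    proof (rule that[of "9 + C + 24 * C\<^sup>2"])
      show "0 \<le> 9 + C + 24 * C\<^sup>2" using C0 by simp
      fix N :: nat and a :: "nat \<Rightarrow> nat \<Rightarrow> real"
      assume N2: "2 \<le> N" and a: "sym_on N a" and rs: "\<And>i. i < N \<Longrightarrow> 0 \<le> mult_mv N a (\<lambda>_. 1) i"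
        and diag: "\<And>i. i < N \<Longrightarrow> a i i = 0" and top: "\<And>y. quad N a y \<le> 2 * (\<Sum>i<N. (y i)\<^sup>2)"
        and F4: "1 / 4 \<le> frob N a"
        and gap: "\<And>y. (\<Sum>i<N. y i) = 0 \<Longrightarrow> quad N a y \<le> (1 - \<delta> / 4) * (\<Sum>i<N. (y i)\<^sup>2)"
      have N: "0 < N" "0 < real N" using N2 by auto
      let ?r = "\<lambda>i. mult_mv N a (\<lambda>_. 1) i - 1"
      define S where "S = (\<Sum>i<N. ?r i)"
      define \<rho> where "\<rho> = (\<Sum>i<N. (?r i)\<^sup>2)"
      define F where "F = frob N a"
      define X where "X = C * F + (6 * S\<^sup>2 + 24 * (C * \<rho>)\<^sup>2) / real N"
      \<comment> \<open>For a configuration of magnetisation m this equals the integrand, elsewhere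
        it is merely positive. The exponent m^2 (N + S) / 2 is written as m^2 (S - N) / 2 plus m
        times the total spin; the latter is the tilt.\<close>
      define G where "G m \<sigma> = exp (m\<^sup>2 * (S - real N) / 2) * (exp (m * (\<Sum>i<N. \<sigma> i - tanh 0)) *
        exp (1 / 2 * quad N a (proj N \<sigma>) + (\<Sum>i<N. m * proj N ?r i * (\<sigma> i - tanh (0 + m)))))"
        for m :: real and \<sigma>
      define m where "m n = of_int n / real N" for n :: int
      have pt: "exp (quad N a \<sigma> / 2) \<le> (\<Sum>n\<in>{- int N..int N}. G (m n) \<sigma>)" if s: "\<sigma> \<in> spins N" for \<sigma>
      proof (rule spin_sum_int[OF s])
        fix n assume n: "n \<in> {- int N..int N}" "(\<Sum>i<N. \<sigma> i) = of_int n"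
        have sm: "(\<Sum>i<N. \<sigma> i) = m n * real N" using n N by (simp add: m_def)
        have L: "(\<Sum>i<N. m n * proj N ?r i * (\<sigma> i - tanh (0 + m n))) = m n * (\<Sum>i<N. ?r i * proj N \<sigma> i)"
        proof -
          have "(\<Sum>i<N. m n * proj N ?r i * (\<sigma> i - tanh (0 + m n)))
              = (\<Sum>i<N. m n * (proj N ?r i * \<sigma> i) - m n * tanh (m n) * proj N ?r i)"
            by (intro sum.cong refl) (simp add: algebra_simps)
          also have "\<dots> = m n * (\<Sum>i<N. proj N ?r i * \<sigma> i) - m n * tanh (m n) * (\<Sum>i<N. proj N ?r i)"
            by (simp only: sum_subtractf sum_distrib_left)
          finally show ?thesis using proj_sum[OF N(1), of ?r] proj_adjoint[of ?r N \<sigma>] by simp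
        qed
        have "quad N a \<sigma> = (m n)\<^sup>2 * (real N + S) + 2 * m n * (\<Sum>i<N. ?r i * proj N \<sigma> i) + quad N a (proj N \<sigma>)"
          using quad_decompose[OF N(1) a, of \<sigma>] n N by (simp add: S_def m_def)
        then have "quad N a \<sigma> / 2 = (m n)\<^sup>2 * (S - real N) / 2 + (m n * (\<Sum>i<N. \<sigma> i - tanh 0) +
            (1 / 2 * quad N a (proj N \<sigma>) + (\<Sum>i<N. m n * proj N ?r i * (\<sigma> i - tanh (0 + m n)))))"
          unfolding L by (simp add: sm power2_eq_square field_simps)
        then have "exp (quad N a \<sigma> / 2) = G (m n) \<sigma>" unfolding G_def exp_add [symmetric] by simp
        also have "\<dots> \<le> (\<Sum>n\<in>{- int N..int N}. G (m n) \<sigma>)"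
          using n by (intro member_le_sum) (auto simp: G_def)
        finally show ?thesis .
      qed
      have EG: "spin_expect 0 N (G (m n)) \<le> exp X" if n: "n \<in> {- int N..int N}" for n
      proof -
        have m1: "\<bar>m n\<bar> \<le> 1" using n N by (auto simp: m_def field_simps abs_le_iff)
        have "spin_expect 0 N (G (m n)) = exp ((m n)\<^sup>2 * (S - real N) / 2) * (exp (real N * psi 0 (m n)) *
          spin_expect (0 + m n) N (\<lambda>\<sigma>. exp (1 / 2 * quad N a (proj N \<sigma>)
            + (\<Sum>i<N. m n * proj N ?r i * (\<sigma> i - tanh (0 + m n))))))"
          unfolding G_def [abs_def] spin_expect_cmult spin_expect_tilt ..
        also have "\<dots> \<le> exp ((m n)\<^sup>2 * (S - real N) / 2) * (exp (real N * psi 0 (m n)) *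
            (1 * exp (C * (frob N a + (\<Sum>i<N. (m n * proj N ?r i)\<^sup>2)))))"
          using spin_expect_exp_linear_le
          by (intro mult_left_mono C[OF N(1) a rs diag top F4 gap]) auto
        also have "\<dots> = exp ((m n)\<^sup>2 * (S - real N) / 2 + (real N * psi 0 (m n) +
            C * (F + (\<Sum>i<N. (m n * proj N ?r i)\<^sup>2))))"
          unfolding exp_add F_def by simp
        also have "\<dots> \<le> exp X"
        proof -
          have "(\<Sum>i<N. (m n * proj N ?r i)\<^sup>2) \<le> (m n)\<^sup>2 * \<rho>"
            unfolding power_mult_distrib sum_distrib_left [symmetric] \<rho>_def
            by (intro mult_left_mono proj_norm_le) auto
          then have "C * (F + (\<Sum>i<N. (m n * proj N ?r i)\<^sup>2)) \<le> C * (F + (m n)\<^sup>2 * \<rho>)"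
            using C0 by (intro mult_left_mono add_left_mono)
          \<comment> \<open>The tilt returns N m^2 / 2, which cancels - N m^2 / 2 exactly. The
            quartic gain is then all that is available against the terms m^2 S / 2 and C m^2
            \<rho>.\<close>
          moreover have "psi 0 (m n) \<le> (m n)\<^sup>2 / 2 - (m n) ^ 4 / 48"
            using ln_cosh_quartic[OF m1] by (simp add: psi_def)
          then have "real N * psi 0 (m n) \<le> real N * ((m n)\<^sup>2 / 2 - (m n) ^ 4 / 48)"
            by (intro mult_left_mono) auto
          moreover have "(m n)\<^sup>2 * S / 2 + (m n)\<^sup>2 * (C * \<rho>) - real N * ((m n)\<^sup>2)\<^sup>2 / 48
              \<le> (6 * S\<^sup>2 + 24 * (C * \<rho>)\<^sup>2) / real N"
            by (rule quartic_absorb[OF N(2)])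
          moreover have "(m n)\<^sup>2 * (S - real N) / 2 + (real N * ((m n)\<^sup>2 / 2 - (m n) ^ 4 / 48) + C * (F + (m n)\<^sup>2 * \<rho>))
              = C * F + ((m n)\<^sup>2 * S / 2 + (m n)\<^sup>2 * (C * \<rho>) - real N * ((m n)\<^sup>2)\<^sup>2 / 48)"
            by (simp add: field_simps power2_eq_square power4_eq_xxxx)
          ultimately show ?thesis unfolding X_def exp_le_cancel_iff by linarith
        qed
        finally show ?thesis .
      qed
      have "spin_expect 0 N (\<lambda>\<sigma>. exp (quad N a \<sigma> / 2)) \<le> (\<Sum>n\<in>{- int N..int N}. spin_expect 0 N (G (m n)))"
        unfolding spin_expect_sum [symmetric] by (rule spin_expect_mono) (rule pt)
      also have "\<dots> \<le> (\<Sum>n\<in>{- int N..int N}. exp X)" by (intro sum_mono EG)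
      also have "\<dots> = real (2 * N + 1) * exp X" by simp
      also have "\<dots> \<le> real (N ^ 3) * exp X"
      proof -
        have "2 * N + 1 \<le> 4 * N" using N2 by simp
        also have "\<dots> \<le> N ^ 3" using mult_mono[of 2 N 2 N] N2 by (simp add: power3_eq_cube)
        finally show ?thesis by (intro mult_right_mono) (auto simp only: of_nat_le_iff exp_ge_zero)
      qed
      also have "\<dots> = exp (3 * ln (real N) + X)"
        using N by (simp add: exp_add exp_of_nat_mult[of 3, simplified])
      finally have "ln (spin_expect 0 N (\<lambda>\<sigma>. exp (quad N a \<sigma> / 2))) \<le> 3 * ln (real N) + X"
        by (rule ln_spin_expect_le)
      also have "\<dots> \<le> (9 + C + 24 * C\<^sup>2) * (F + \<rho>\<^sup>2 / real N + S\<^sup>2 / real N + ln (real N))"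
      proof -
        have nn: "0 \<le> F" "0 \<le> \<rho>\<^sup>2 / real N" "0 \<le> S\<^sup>2 / real N" "0 \<le> ln (real N)" "0 \<le> C\<^sup>2"
          using N2 by (auto simp: F_def frob_nonneg)
        have "X = C * F + 6 * (S\<^sup>2 / real N) + 24 * C\<^sup>2 * (\<rho>\<^sup>2 / real N)"
          by (simp add: X_def power_mult_distrib add_divide_distrib)
        moreover have "C * F \<le> (9 + C + 24 * C\<^sup>2) * F" "6 * (S\<^sup>2 / real N) \<le> (9 + C + 24 * C\<^sup>2) * (S\<^sup>2 / real N)"
          "24 * C\<^sup>2 * (\<rho>\<^sup>2 / real N) \<le> (9 + C + 24 * C\<^sup>2) * (\<rho>\<^sup>2 / real N)"
          "3 * ln (real N) \<le> (9 + C + 24 * C\<^sup>2) * ln (real N)"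
          using nn C0 by (intro mult_right_mono; simp)+
        ultimately show ?thesis unfolding distrib_left[of "9 + C + 24 * C\<^sup>2"] by linarith
      qed
      finally show "ln (spin_expect 0 N (\<lambda>\<sigma>. exp (quad N a \<sigma> / 2))) \<le> (9 + C + 24 * C\<^sup>2) * (frob N a
        + (\<Sum>i<N. (?r i)\<^sup>2)\<^sup>2 / real N + (\<Sum>i<N. ?r i)\<^sup>2 / real N + ln (real N))"
        by (simp add: F_def \<rho>_def S_def)
    qed
  qed
qed

lemma Theta3_bound:
  fixes A :: "nat \<Rightarrow> real mat"
  assumes A: "\<And>N. N \<ge> 2 \<Longrightarrow> coupling_matrix N (A N)"
    and top: "(\<lambda>N. eigval 1 (A N)) \<longlonglongrightarrow> 1"
    and gap: "limsup (\<lambda>N. ereal (eigval 2 (A N) / eigval 1 (A N))) < 1"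
  shows "lesssim (\<lambda>N. ln (partition_fun (A N) 1 0) - mf_prediction (A N) 1 0)
    (\<lambda>N. (frob_norm (A N))\<^sup>2 + 1 / real N * (\<Sum>i<N. (row_sum (A N) i - 1)\<^sup>2)\<^sup>2
      + 1 / real N * (\<Sum>i<N. (row_sum (A N) i - 1))\<^sup>2 + ln (real N))"
    (is "lesssim ?x ?y")
proof (rule eventual_spectral_gap[OF A top gap])
  fix \<delta> N0
  assume \<delta>: "0 < \<delta>" "\<delta> \<le> 1"
    and two: "\<And>N y. N \<ge> N0 \<Longrightarrow> N \<ge> 2 \<Longrightarrow> quad N (entries (A N)) y \<le> 2 * (\<Sum>i<N. (y i)\<^sup>2)"
    and F4: "\<And>N. N \<ge> N0 \<Longrightarrow> N \<ge> 2 \<Longrightarrow> 1 / 4 \<le> frob N (entries (A N))"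
    and off: "\<And>N y. N \<ge> N0 \<Longrightarrow> N \<ge> 2 \<Longrightarrow> (\<Sum>i<N. (row_sum (A N) i - 1)\<^sup>2) \<le> \<delta> ^ 3 / 64 * real N \<Longrightarrow>
      (\<Sum>i<N. y i) = 0 \<Longrightarrow> quad N (entries (A N)) y \<le> (1 - \<delta> / 4) * (\<Sum>i<N. (y i)\<^sup>2)"
  have mf0: "mf_point 1 0 = tanh (0::real)" using mf_point_zero[of 1 0] by (simp add: Theta3_def)
  have gap0: "?x N = ln (spin_expect 0 N (\<lambda>\<sigma>. exp (quad N (entries (A N)) \<sigma> / 2)))" if "N \<ge> 2" for N
    using gap_eq[OF A[OF that] _ mf0] by simp
  show ?thesis
  proof (rule Theta3_magnetization_bound[OF \<delta>])
    fix C :: real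
    assume C0: "0 \<le> C" and C: "\<And>N a. 2 \<le> N \<Longrightarrow> sym_on N a \<Longrightarrow>
      (\<And>i. i < N \<Longrightarrow> 0 \<le> mult_mv N a (\<lambda>_. 1) i) \<Longrightarrow> (\<And>i. i < N \<Longrightarrow> a i i = 0) \<Longrightarrow>
      (\<And>y. quad N a y \<le> 2 * (\<Sum>i<N. (y i)\<^sup>2)) \<Longrightarrow> 1 / 4 \<le> frob N a \<Longrightarrow>
      (\<And>y. (\<Sum>i<N. y i) = 0 \<Longrightarrow> quad N a y \<le> (1 - \<delta> / 4) * (\<Sum>i<N. (y i)\<^sup>2)) \<Longrightarrow>
      ln (spin_expect 0 N (\<lambda>\<sigma>. exp (quad N a \<sigma> / 2))) \<le> C * (frob N a
        + (\<Sum>i<N. (mult_mv N a (\<lambda>_. 1) i - 1)\<^sup>2)\<^sup>2 / real N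
        + (\<Sum>i<N. mult_mv N a (\<lambda>_. 1) i - 1)\<^sup>2 / real N + ln (real N))"
    define K where "K = C + (64 / \<delta> ^ 3)\<^sup>2"
    have yp: "0 < ?y N" if "N \<ge> 2" for N
      using that by (intro add_nonneg_pos add_nonneg_nonneg) auto
    show ?thesis
    proof (rule lesssim_of_eventually[where C = K and ?N0.0 = N0])
      fix N :: nat assume N: "N \<ge> N0" "N \<ge> 2"
      let ?\<rho> = "\<Sum>i<N. (row_sum (A N) i - 1)\<^sup>2"
      note cm = A[OF N(2)]
      show "?x N \<le> K * ?y N"
      proof (cases "?\<rho> \<le> \<delta> ^ 3 / 64 * real N")
        case True
        have "?x N \<le> C * ?y N" unfolding gap0[OF N(2)]
          using C[OF N(2) coupling_matrixD(2,4,3)[OF cm] two[OF N] F4[OF N] off[OF N True]]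
          by (simp add: coupling_matrixD(5,6)[OF cm])
        also have "\<dots> \<le> K * ?y N" using yp[OF N(2)] by (intro mult_right_mono) (auto simp: K_def)
        finally show ?thesis .
      next
        \<comment> \<open>Here \<rho> is at least of order N, so \<rho>^2 / N dominates the trivial
          bound N.\<close>
        case False
        have "spin_expect 0 N (\<lambda>\<sigma>. exp (quad N (entries (A N)) \<sigma> / 2)) \<le> spin_expect 0 N (\<lambda>\<sigma>. exp (real N))"
        proof (rule spin_expect_mono)
          fix \<sigma> assume "\<sigma> \<in> spins N"
          then show "exp (quad N (entries (A N)) \<sigma> / 2) \<le> exp (real N)"
            using two[OF N, of \<sigma>] by (simp add: spins_norm)
        qed
        then have "?x N \<le> real N" unfolding gap0[OF N(2)] by (intro ln_spin_expect_le) simp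
        also have "real N = (real N)\<^sup>2 / real N" using N by (simp add: power2_eq_square)
        also have "\<dots> \<le> (64 / \<delta> ^ 3 * ?\<rho>)\<^sup>2 / real N"
          using False \<delta> by (intro divide_right_mono power_mono) (auto simp: field_simps)
        also have "\<dots> = (64 / \<delta> ^ 3)\<^sup>2 * (1 / real N * ?\<rho>\<^sup>2)" by (simp only: power_mult_distrib) simp
        also have "\<dots> \<le> (64 / \<delta> ^ 3)\<^sup>2 * ?y N"
          using N by (intro mult_left_mono) auto
        also have "\<dots> \<le> K * ?y N" using yp[OF N(2)] C0 by (intro mult_right_mono) (auto simp: K_def)
        finally show ?thesis .
      qed
    next
      fix N :: nat assume "N \<ge> 2"
      from yp[OF this] show "0 \<le> ?y N" "?y N = 0 \<Longrightarrow> ?x N \<le> 0" by linarith+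
    qed
  qed
qed

section \<open>The low-temperature regime\<close>

lemma spins_neg_sum:
  "(\<Sum>\<sigma>\<in>spins N. F (restrict (\<lambda>i. - \<sigma> i) {..<N})) = (\<Sum>\<sigma>\<in>spins N. F \<sigma>)"
  by (rule sum.reindex_bij_witness[where i = "\<lambda>\<sigma>. restrict (\<lambda>i. - \<sigma> i) {..<N}"
        and j = "\<lambda>\<sigma>. restrict (\<lambda>i. - \<sigma> i) {..<N}"])
    (auto simp: spins_def PiE_iff extensional_def fun_eq_iff restrict_def)

lemma sum_even_le_half_space:
  fixes W :: "(nat \<Rightarrow> real) \<Rightarrow> real"
  assumes even: "\<And>\<sigma>. W (restrict (\<lambda>i. - \<sigma> i) {..<N}) = W \<sigma>" and pos: "\<And>\<sigma>. 0 \<le> W \<sigma>"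
  shows "(\<Sum>\<sigma>\<in>spins N. W \<sigma>) \<le> 2 * (\<Sum>\<sigma>\<in>spins N. if 0 \<le> (\<Sum>i<N. \<sigma> i) then W \<sigma> else 0)"
proof -
  let ?P = "\<lambda>\<sigma>. if 0 \<le> (\<Sum>i<N. \<sigma> i) then W \<sigma> else 0"
  let ?neg = "\<lambda>\<sigma>. restrict (\<lambda>i. - \<sigma> i) {..<N}"
  have "W \<sigma> \<le> ?P \<sigma> + ?P (?neg \<sigma>)" for \<sigma>
    unfolding even using pos[of \<sigma>] by (auto simp: sum_negf)
  then have "(\<Sum>\<sigma>\<in>spins N. W \<sigma>) \<le> (\<Sum>\<sigma>\<in>spins N. ?P \<sigma> + ?P (?neg \<sigma>))" by (rule sum_mono)
  also have "\<dots> = (\<Sum>\<sigma>\<in>spins N. ?P \<sigma>) + (\<Sum>\<sigma>\<in>spins N. ?P (?neg \<sigma>))" by (rule sum.distrib)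
  also have "(\<Sum>\<sigma>\<in>spins N. ?P (?neg \<sigma>)) = (\<Sum>\<sigma>\<in>spins N. ?P \<sigma>)" by (rule spins_neg_sum)
  finally show ?thesis by simp
qed

text \<open>Neither the product weight nor g is even, but since B = 0 their combination is a
  constant times exp (\<beta> / 2 * quad N a \<sigma>), which is invariant under a global
  flip.\<close>

lemma spin_expect_half_space:
  fixes \<beta> h :: real
  assumes a: "sym_on N a" and h: "h = \<beta> * tanh h"
  defines "g \<equiv> \<lambda>\<sigma>. \<beta> / 2 * quad N a (\<lambda>i. \<sigma> i - tanh h)
    + (\<Sum>i<N. \<beta> * tanh h * (mult_mv N a (\<lambda>_. 1) i - 1) * (\<sigma> i - tanh h))"
  shows "spin_expect h N (\<lambda>\<sigma>. exp (g \<sigma>))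
    \<le> 2 * spin_expect h N (\<lambda>\<sigma>. if 0 \<le> (\<Sum>i<N. \<sigma> i) then exp (g \<sigma>) else 0)"
proof -
  define K where "K = \<beta> * (tanh h)\<^sup>2 / 2 * ((\<Sum>i<N. mult_mv N a (\<lambda>_. 1) i - 1) - real N)"
  define W where "W \<sigma> = (\<Prod>i<N. exp (h * \<sigma> i) / (2 * cosh h)) * exp (g \<sigma>)" for \<sigma>
  have W: "W \<sigma> = exp (- K) * exp (\<beta> / 2 * quad N a \<sigma>) / (2 * cosh h) ^ N" for \<sigma>
  proof -
    have "\<beta> / 2 * quad N a \<sigma> = h * (\<Sum>i<N. \<sigma> i) + g \<sigma> + K"
      using energy_centered[OF a, of h \<beta> 0 \<sigma>] h by (simp add: g_def K_def)
    then have "h * (\<Sum>i<N. \<sigma> i) + g \<sigma> = - K + \<beta> / 2 * quad N a \<sigma>" by linarith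
    then show ?thesis unfolding W_def exp_spin_weight by (simp add: exp_add [symmetric])
  qed
  have "(\<Sum>\<sigma>\<in>spins N. W \<sigma>) \<le> 2 * (\<Sum>\<sigma>\<in>spins N. if 0 \<le> (\<Sum>i<N. \<sigma> i) then W \<sigma> else 0)"
  proof (rule sum_even_le_half_space)
    fix \<sigma>
    have "quad N a (restrict (\<lambda>i. - \<sigma> i) {..<N}) = quad N a (\<lambda>i. (- 1) * \<sigma> i)"
      by (rule quad_arg_cong) simp
    also have "\<dots> = quad N a \<sigma>" by (subst quad_scale_arg) simp
    finally show "W (restrict (\<lambda>i. - \<sigma> i) {..<N}) = W \<sigma>" unfolding W by simp
    show "0 \<le> W \<sigma>" unfolding W using cosh_real_pos[of h] by simp
  qed
  also have "(\<Sum>\<sigma>\<in>spins N. if 0 \<le> (\<Sum>i<N. \<sigma> i) then W \<sigma> else 0)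
      = spin_expect h N (\<lambda>\<sigma>. if 0 \<le> (\<Sum>i<N. \<sigma> i) then exp (g \<sigma>) else 0)"
    unfolding spin_expect_def W_def by (intro sum.cong) auto
  finally show ?thesis by (simp add: spin_expect_def W_def)
qed

text \<open>The magnetisation will be known only up to a window, and it multiplies a linear function
  L of the spins of unknown sign. The two endpoints replace it by deterministic
  coefficients.\<close>

lemma exp_le_exp_endpoints:
  fixes p z q L :: real
  assumes "p \<le> z" "z \<le> q" shows "exp (z * L) \<le> exp (p * L) + exp (q * L)"
proof (cases "0 \<le> L")
  case True
  then have "exp (z * L) \<le> exp (q * L)" using assms by (simp add: mult_right_mono)
  then show ?thesis using exp_gt_zero[of "p * L"] by linarith
next
  case False
  then have "exp (z * L) \<le> exp (p * L)" using assms by (simp add: mult_right_mono_neg)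
  then show ?thesis using exp_gt_zero[of "q * L"] by linarith
qed

lemma psi_tilt: "psi (h + b) w = psi h (b + w) - psi h b - w * (tanh (h + b) - tanh h)"
  by (simp add: psi_def algebra_simps)

text \<open>The tilted transform equals psi h (b + w) - psi h b up to a linear term. With sum zero,
  all linear terms and the cross term of (b + w)^2 vanish. The prefactor may be exponentially large,
  but it contains exp (- N psi h b), which cancels the normalisation of the tilt and leaves the
  improved quadratic bound in b.\<close>

lemma Theta2_field_bound:
  fixes \<beta> h c b :: real
  assumes pt: "\<And>w. psi h (b + w) \<le> (b + w)\<^sup>2 / (2 * \<beta>) - c * b\<^sup>2 + 25 * c * w\<^sup>2"
    and w: "(\<Sum>i<N. w i) = 0"
  shows "spin_expect (h + b) N (\<lambda>\<sigma>. exp (\<Sum>i<N. w i * (\<sigma> i - tanh (h + b))))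
    \<le> exp (real N * (b\<^sup>2 / (2 * \<beta>) - c * b\<^sup>2 - psi h b)) * exp ((1 / \<beta> + 50 * c) * (\<Sum>i<N. (w i)\<^sup>2) / 2)"
proof -
  let ?n = "\<Sum>i<N. (w i)\<^sup>2"
  have "(\<Sum>i<N. psi (h + b) (w i)) = (\<Sum>i<N. psi h (b + w i) - psi h b - (tanh (h + b) - tanh h) * w i)"
    by (intro sum.cong refl) (simp add: psi_tilt mult.commute)
  also have "\<dots> = (\<Sum>i<N. psi h (b + w i)) - real N * psi h b - (tanh (h + b) - tanh h) * (\<Sum>i<N. w i)"
    by (simp add: sum_subtractf sum_distrib_left)
  also have "\<dots> = (\<Sum>i<N. psi h (b + w i)) - real N * psi h b" using w by simp
  also have "(\<Sum>i<N. psi h (b + w i)) \<le> (\<Sum>i<N. (b\<^sup>2 / (2 * \<beta>) - c * b\<^sup>2) + b / \<beta> * w i + (1 / (2 * \<beta>) + 25 * c) * (w i)\<^sup>2)"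
  proof (rule sum_mono)
    fix i
    have "(b + w i)\<^sup>2 / (2 * \<beta>) = b\<^sup>2 / (2 * \<beta>) + b / \<beta> * w i + 1 / (2 * \<beta>) * (w i)\<^sup>2"
      by (simp add: power2_sum add_divide_distrib)
    then show "psi h (b + w i) \<le> (b\<^sup>2 / (2 * \<beta>) - c * b\<^sup>2) + b / \<beta> * w i + (1 / (2 * \<beta>) + 25 * c) * (w i)\<^sup>2"
      using pt[of "w i"] by (simp add: distrib_right)
  qed
  also have "\<dots> = real N * (b\<^sup>2 / (2 * \<beta>) - c * b\<^sup>2) + b / \<beta> * (\<Sum>i<N. w i) + (1 / (2 * \<beta>) + 25 * c) * ?n"
    by (simp add: sum.distrib sum_distrib_left)
  finally have "(\<Sum>i<N. psi (h + b) (w i))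
      \<le> real N * (b\<^sup>2 / (2 * \<beta>) - c * b\<^sup>2) + (1 / (2 * \<beta>) + 25 * c) * ?n - real N * psi h b"
    using w by simp
  also have "\<dots> = real N * (b\<^sup>2 / (2 * \<beta>) - c * b\<^sup>2 - psi h b) + (1 / \<beta> + 50 * c) * ?n / 2"
    by (simp add: algebra_simps add_divide_distrib)
  finally show ?thesis unfolding spin_expect_exp_linear exp_add [symmetric] by simp
qed

text \<open>\<open>y\<close> is the centred magnetisation; the cross term \<open>t * y * S\<close> is split by AM-GM.\<close>

lemma Theta2_top_direction:
  fixes \<beta> \<kappa> N S t y \<rho> :: real
  assumes "0 < \<beta>" "0 < \<kappa>" "0 < N" and S: "\<bar>S\<bar> \<le> \<kappa> / 2 * N" "S\<^sup>2 \<le> N * \<rho>"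
  shows "\<beta> / 2 * (y\<^sup>2 * (N + S)) + \<beta> * t * (y * S) \<le> \<beta> * (1 + \<kappa>) * (y\<^sup>2 * N) / 2 + \<beta> * t\<^sup>2 * \<rho> / \<kappa>"
proof -
  have "y\<^sup>2 * S \<le> y\<^sup>2 * (\<kappa> / 2 * N)" using S(1) by (intro mult_left_mono) auto
  moreover have "t * (y * S) \<le> \<kappa> / 4 * (y\<^sup>2 * N) + t\<^sup>2 * \<rho> / \<kappa>"
  proof -
    have "0 \<le> (\<kappa> * N * y / 2 - t * S)\<^sup>2" by simp
    then have "\<kappa> * N * (t * (y * S)) \<le> \<kappa> * N * (\<kappa> / 4 * (y\<^sup>2 * N)) + t\<^sup>2 * S\<^sup>2"
      by (simp add: power2_eq_square field_simps)
    also have "t\<^sup>2 * S\<^sup>2 \<le> t\<^sup>2 * (N * \<rho>)" using S(2) by (intro mult_left_mono) auto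
    also have "t\<^sup>2 * (N * \<rho>) = \<kappa> * N * (t\<^sup>2 * \<rho> / \<kappa>)" using assms by simp
    finally have "\<kappa> * N * (t * (y * S)) \<le> \<kappa> * N * (\<kappa> / 4 * (y\<^sup>2 * N) + t\<^sup>2 * \<rho> / \<kappa>)"
      by (simp only: distrib_left)
    then show ?thesis using assms by (simp add: mult_le_cancel_left_pos)
  qed
  ultimately have "1 / 2 * (y\<^sup>2 * N) + 1 / 2 * (y\<^sup>2 * S) + t * (y * S)
      \<le> (1 + \<kappa>) * (y\<^sup>2 * N) / 2 + t\<^sup>2 * \<rho> / \<kappa>"
    by (simp add: algebra_simps add_divide_distrib)
  then have "\<beta> * (1 / 2 * (y\<^sup>2 * N) + 1 / 2 * (y\<^sup>2 * S) + t * (y * S))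
      \<le> \<beta> * ((1 + \<kappa>) * (y\<^sup>2 * N) / 2 + t\<^sup>2 * \<rho> / \<kappa>)"
    using assms(1) by (intro mult_left_mono) auto
  then show ?thesis by (simp add: algebra_simps add_divide_distrib)
qed

text \<open>The exponent is separated into the centred magnetisation y, a linear field in the
  fluctuations, and the compressed form. The coefficient y + t of the linear field is the
  magnetisation itself.\<close>

lemma Theta2_energy:
  fixes \<beta> t :: real
  assumes N: "0 < N" and a: "sym_on N a"
  defines "r \<equiv> \<lambda>i. mult_mv N a (\<lambda>_. 1) i - 1" and "y \<equiv> \<lambda>\<sigma>. (\<Sum>i<N. \<sigma> i - t) / real N"
  shows "\<beta> / 2 * quad N a (\<lambda>i. \<sigma> i - t) + (\<Sum>i<N. \<beta> * t * r i * (\<sigma> i - t))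
    = \<beta> / 2 * ((y \<sigma>)\<^sup>2 * (real N + (\<Sum>i<N. r i))) + \<beta> * t * (y \<sigma> * (\<Sum>i<N. r i))
      + \<beta> * (y \<sigma> + t) * (\<Sum>i<N. proj N r i * \<sigma> i) + \<beta> / 2 * quad N a (proj N \<sigma>)"
proof -
  let ?Y = "\<lambda>i. \<sigma> i - t"
  define L where "L = (\<Sum>i<N. proj N r i * \<sigma> i)"
  define Q where "Q = quad N a (proj N \<sigma>)"
  define S where "S = (\<Sum>i<N. r i)"
  have L: "(\<Sum>i<N. r i * proj N ?Y i) = L" unfolding proj_shift[OF N] proj_adjoint L_def ..
  have q: "quad N a ?Y = (y \<sigma>)\<^sup>2 * (real N + S) + 2 * y \<sigma> * L + Q"
    using quad_decompose[OF N a, of ?Y] unfolding proj_shift[OF N]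
    using L unfolding proj_shift[OF N] by (simp add: r_def y_def S_def Q_def)
  have "(\<Sum>i<N. r i * ?Y i) = (\<Sum>i<N. r i * proj N ?Y i + y \<sigma> * r i)"
    by (intro sum.cong refl) (simp add: proj_def y_def algebra_simps)
  also have "\<dots> = L + y \<sigma> * S" unfolding sum.distrib L by (simp add: S_def sum_distrib_left)
  finally have "(\<Sum>i<N. \<beta> * t * r i * ?Y i) = \<beta> * t * (L + y \<sigma> * S)"
    by (simp add: sum_distrib_left [symmetric] mult.assoc)
  then show ?thesis unfolding q L_def [symmetric] S_def [symmetric] Q_def [symmetric]
    by (simp add: algebra_simps add_divide_distrib)
qed


lemma Theta2_half_space_bound:
  fixes \<beta> \<delta> h :: real
  assumes \<beta>: "1 < \<beta>" and h: "0 < h" "h = \<beta> * tanh h" and \<delta>: "0 < \<delta>" "\<delta> \<le> 1"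
  obtains C \<epsilon> where "0 \<le> C" "0 < \<epsilon>" "\<And>N a. 2 \<le> N \<Longrightarrow> sym_on N a \<Longrightarrow>
    (\<And>i. i < N \<Longrightarrow> 0 \<le> mult_mv N a (\<lambda>_. 1) i) \<Longrightarrow> (\<And>i. i < N \<Longrightarrow> a i i = 0) \<Longrightarrow>
    (\<And>y. quad N a y \<le> 2 * (\<Sum>i<N. (y i)\<^sup>2)) \<Longrightarrow> 1 / 4 \<le> frob N a \<Longrightarrow>
    (\<And>y. (\<Sum>i<N. y i) = 0 \<Longrightarrow> quad N a y \<le> (1 - \<delta> / 4) * (\<Sum>i<N. (y i)\<^sup>2)) \<Longrightarrow>
    (\<Sum>i<N. (mult_mv N a (\<lambda>_. 1) i - 1)\<^sup>2) \<le> \<epsilon> * real N \<Longrightarrow>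
    spin_expect h N (\<lambda>\<sigma>. exp (\<beta> / 2 * quad N a (\<lambda>i. \<sigma> i - tanh h)
      + (\<Sum>i<N. \<beta> * tanh h * (mult_mv N a (\<lambda>_. 1) i - 1) * (\<sigma> i - tanh h))))
    \<le> exp (C * (frob N a + (\<Sum>i<N. (mult_mv N a (\<lambda>_. 1) i - 1)\<^sup>2)))"
proof (rule psi_shift_gain[OF h(1)])
  fix c0 :: real
  assume c0: "0 < c0" and gain: "\<And>c b w. 0 < c \<Longrightarrow> c \<le> c0 \<Longrightarrow> - (5 / 4) * h \<le> b \<Longrightarrow>
      psi h (b + w) \<le> tanh h / h * (b + w)\<^sup>2 / 2 - c * b\<^sup>2 + 25 * c * w\<^sup>2"
  define t where "t = tanh h"
  have t: "0 < t" "t < 1" "h = \<beta> * t" using h tanh_real_lt_1[of h] by (auto simp: t_def)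
  have "t / h = 1 / \<beta>" by (subst t(3)) (use t(1) \<beta> in simp)
  then have th: "tanh h / h = 1 / \<beta>" by (simp only: t_def)
  have \<beta>0: "0 < \<beta>" using \<beta> by simp
  \<comment> \<open>The second bound gives \<kappa> <= 1/4, so tilts down to - (1 + \<kappa>) h stay
    in the range - 5/4 h of \<open>psi_shift_gain\<close>; the third gives 50 \<kappa> <= \<delta> /
    4, so the worsened constant q stays subcritical against the gap.\<close>
  define c where "c = min c0 (min (1 / (4 * \<beta>)) (\<delta> / (200 * \<beta>)))"
  have c: "0 < c" "c \<le> c0" "c \<le> 1 / (4 * \<beta>)" "c \<le> \<delta> / (200 * \<beta>)"
    using c0 \<beta> \<delta> by (auto simp: c_def)
  define \<kappa> where "\<kappa> = c * \<beta>"
  have \<kappa>: "0 < \<kappa>" "\<kappa> \<le> 1 / 4" "50 * \<kappa> \<le> \<delta> / 4"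
    using c \<beta>0 by (auto simp: \<kappa>_def field_simps)
  define \<alpha> where "\<alpha> = \<beta> * (1 + \<kappa>)"
  have \<alpha>: "0 < \<alpha>" using \<beta>0 \<kappa> by (simp add: \<alpha>_def)
  define d where "d = \<alpha> * \<kappa> * (1 / 2 + \<kappa>)"
  have d: "0 < d" using \<alpha> \<kappa> by (simp add: d_def)
  \<comment> \<open>The excess \<kappa> in \<alpha> pays for S and for the cross term. The gain c
    \<alpha>^2 is worth twice that excess to leading order, so the net exponent stays
    negative.\<close>
  have d_eq: "\<alpha>\<^sup>2 / (2 * \<beta>) - c * \<alpha>\<^sup>2 - \<alpha> / 2 = - d"
    using \<beta>0 by (simp add: d_def \<alpha>_def \<kappa>_def field_simps power2_eq_square)
  define q where "q = 1 / \<beta> + 50 * c"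
  have q: "0 \<le> q" using \<beta>0 c by (simp add: q_def)
  have \<Lambda>: "0 < 1 - \<delta> / 4" using \<delta> by simp
  have sub: "\<beta> * (1 - \<delta> / 4) * q < 1"
  proof -
    have "\<beta> * (1 - \<delta> / 4) * q = (1 - \<delta> / 4) * (1 + 50 * \<kappa>)"
      using \<beta>0 by (simp add: q_def \<kappa>_def field_simps)
    also have "\<dots> \<le> (1 - \<delta> / 4) * (1 + \<delta> / 4)" using \<kappa>(3) \<Lambda> by (intro mult_left_mono) auto
    also have "\<dots> = 1 - (\<delta> / 4)\<^sup>2" by (simp add: power2_eq_square algebra_simps)
    also have "\<dots> < 1" using \<delta> by simp
    finally show ?thesis .
  qed
  show ?thesis
  proof (rule projected_quadratic_bound[OF \<beta>0 q \<Lambda> sub])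
    fix C :: real
    assume C0: "0 \<le> C" and C: "\<And>N a h M v.
      0 < N \<Longrightarrow> sym_on N a \<Longrightarrow> (\<And>i. i < N \<Longrightarrow> 0 \<le> mult_mv N a (\<lambda>_. 1) i) \<Longrightarrow>
      (\<And>i. i < N \<Longrightarrow> a i i = 0) \<Longrightarrow> (\<And>y. quad N a y \<le> 2 * (\<Sum>i<N. (y i)\<^sup>2)) \<Longrightarrow> 1 / 4 \<le> frob N a \<Longrightarrow>
      (\<And>y. (\<Sum>i<N. y i) = 0 \<Longrightarrow> quad N a y \<le> (1 - \<delta> / 4) * (\<Sum>i<N. (y i)\<^sup>2)) \<Longrightarrow> 1 \<le> M \<Longrightarrow>
      (\<And>w. (\<Sum>i<N. w i) = 0 \<Longrightarrow>
        spin_expect h N (\<lambda>\<sigma>. exp (\<Sum>i<N. w i * (\<sigma> i - tanh h))) \<le> M * exp (q * (\<Sum>i<N. (w i)\<^sup>2) / 2)) \<Longrightarrow>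
      spin_expect h N (\<lambda>\<sigma>. exp (\<beta> / 2 * quad N a (proj N \<sigma>) + (\<Sum>i<N. v i * (\<sigma> i - tanh h))))
        \<le> M * exp (C * (frob N a + (\<Sum>i<N. (v i)\<^sup>2)))"
    define G where "G = gauss_const \<alpha> d"
    have G: "1 \<le> G" unfolding G_def using \<alpha> d by (intro gauss_const_ge_1) auto
    define K where "K = 4 * ln (4 * G) + (\<beta> * t\<^sup>2 / \<kappa> + 25 * C * \<beta>\<^sup>2) + C"
    have K0: "0 \<le> ln (4 * G)" "0 \<le> \<beta> * t\<^sup>2 / \<kappa> + 25 * C * \<beta>\<^sup>2" using G \<beta>0 \<kappa> C0 by auto
    show ?thesis
    \<comment> \<open>\<epsilon> = \<kappa>^2 / 4 forces |S| <= \<kappa> N / 2 by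
      Cauchy-Schwarz.\<close>
    proof (rule that[of K "\<kappa>\<^sup>2 / 4"])
      show "0 \<le> K" unfolding K_def using K0 C0 by linarith
      show "0 < \<kappa>\<^sup>2 / 4" using \<kappa> by simp
      fix N :: nat and a :: "nat \<Rightarrow> nat \<Rightarrow> real"
      assume N2: "2 \<le> N" and a: "sym_on N a" and rs: "\<And>i. i < N \<Longrightarrow> 0 \<le> mult_mv N a (\<lambda>_. 1) i"
        and diag: "\<And>i. i < N \<Longrightarrow> a i i = 0" and top: "\<And>y. quad N a y \<le> 2 * (\<Sum>i<N. (y i)\<^sup>2)"
        and F4: "1 / 4 \<le> frob N a"
        and gap: "\<And>y. (\<Sum>i<N. y i) = 0 \<Longrightarrow> quad N a y \<le> (1 - \<delta> / 4) * (\<Sum>i<N. (y i)\<^sup>2)"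
        and small: "(\<Sum>i<N. (mult_mv N a (\<lambda>_. 1) i - 1)\<^sup>2) \<le> \<kappa>\<^sup>2 / 4 * real N"
      have N: "0 < N" "0 < real N" using N2 by auto
      define r where "r = (\<lambda>i. mult_mv N a (\<lambda>_. 1) i - 1)"
      define S where "S = (\<Sum>i<N. r i)"
      define \<rho> where "\<rho> = (\<Sum>i<N. (r i)\<^sup>2)"
      define F where "F = frob N a"
      have \<rho>: "0 \<le> \<rho>" by (simp add: \<rho>_def sum_nonneg)
      have S2: "S\<^sup>2 \<le> real N * \<rho>"
        using Cauchy_Schwarz_ineq_sum[of "\<lambda>_. 1" r "{..<N}"] by (simp add: S_def \<rho>_def)
      have S1: "\<bar>S\<bar> \<le> \<kappa> / 2 * real N"
      proof -
        have "S\<^sup>2 \<le> real N * (\<kappa>\<^sup>2 / 4 * real N)"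
          using S2 mult_left_mono[OF small, of "real N"] by (simp add: \<rho>_def r_def)
        also have "\<dots> = (\<kappa> / 2 * real N)\<^sup>2" by (simp add: power2_eq_square)
        finally have "\<bar>S\<bar> \<le> \<bar>\<kappa> / 2 * real N\<bar>" by (rule iffD2[OF abs_le_square_iff])
        then show ?thesis using \<kappa> by simp
      qed
      define g where "g \<sigma> = \<beta> / 2 * quad N a (\<lambda>i. \<sigma> i - t) + (\<Sum>i<N. \<beta> * t * r i * (\<sigma> i - t))" for \<sigma>
      define s where "s = sqrt (real N)"
      have s: "1 \<le> s" "s * s = real N" using N2 by (auto simp: s_def)
      have s0: "0 < s" using s by simp
      \<comment> \<open>j = 0 and j = 1 give the two ends of the window for the
        magnetisation.\<close>
      define v where "v n j i = \<beta> * ((of_int n - j) / s + t) * proj N r i" for n :: int and j :: real and i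
      define b where "b n = \<alpha> * of_int n / s" for n :: int
      define T where "T n j \<sigma> = exp (\<alpha> / 2 - \<alpha> * (of_int n)\<^sup>2 / 2 + \<beta> * t\<^sup>2 * \<rho> / \<kappa>) *
          (exp (b n * (\<Sum>i<N. \<sigma> i - tanh h)) *
           exp (\<beta> / 2 * quad N a (proj N \<sigma>) + (\<Sum>i<N. v n j i * (\<sigma> i - tanh (h + b n)))))"
        for n :: int and j :: real and \<sigma>
      define k where "k = nat \<lceil>2 * s\<rceil>"
      define I where "I = {n \<in> {- int k..int k}. - t * s \<le> of_int n}"
      have "I \<subseteq> {- int k..int k}" by (auto simp: I_def)
      then have I: "finite I" "I \<subseteq> {- int k..int k}" by (auto intro: finite_subset)
      have pt: "(if 0 \<le> (\<Sum>i<N. \<sigma> i) then exp (g \<sigma>) else 0) \<le> (\<Sum>n\<in>I. T n 1 \<sigma> + T n 0 \<sigma>)"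
        if \<sigma>: "\<sigma> \<in> spins N" for \<sigma>
      proof (cases "0 \<le> (\<Sum>i<N. \<sigma> i)")
        case False
        then show ?thesis by (auto intro!: sum_nonneg add_nonneg_nonneg simp: T_def)
      next
        case True
        define Y where "Y = (\<Sum>i<N. \<sigma> i - t)"
        define y where "y = Y / real N"
        define x where "x = Y / s"
        \<comment> \<open>The ceiling, not the floor: n >= x >= - t s on the half space, so the tilt
          b n is at least - \<alpha> t = - (1 + \<kappa>) h and the strict inequality for psi
          applies.\<close>
        define n where "n = \<lceil>x\<rceil>"
        define L where "L = (\<Sum>i<N. proj N r i * \<sigma> i)"
        have y_x: "y = x / s" using s s0 by (simp add: y_def x_def divide_divide_eq_left)
        have x2: "x\<^sup>2 = y\<^sup>2 * real N" unfolding y_x using s s0 N by (simp add: power2_eq_square)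
        have Y_eq: "Y = (\<Sum>i<N. \<sigma> i) - real N * t" by (simp add: Y_def sum_subtractf)
        have "(\<Sum>i<N. \<sigma> i) \<le> (\<Sum>i<N. 1)" using spins_abs[OF \<sigma>] by (intro sum_mono) fastforce
        then have sle: "(\<Sum>i<N. \<sigma> i) \<le> real N" by simp
        have "- t * s \<le> x" using True s0 s by (simp add: x_def Y_eq pos_le_divide_eq mult.assoc)
        then have n_low: "- t * s \<le> of_int n" unfolding n_def by linarith
        have "0 \<le> real N * t" using t by simp
        then have "Y \<le> real N" using sle unfolding Y_eq by linarith
        then have "x \<le> s" using s0 s by (simp add: x_def pos_divide_le_eq)
        then have "\<lceil>x\<rceil> \<le> \<lceil>2 * s\<rceil>" using s by (intro ceiling_mono) simp
        then have n_up: "n \<le> int k" unfolding n_def k_def by linarith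
        have "- of_int (int k) \<le> - (2 * s)" unfolding k_def using s by simp
        also have "\<dots> \<le> - t * s" using t s by (simp add: mult_right_mono)
        also note n_low
        finally have "of_int (- int k) \<le> (of_int n :: real)" by simp
        then have "- int k \<le> n" by (simp only: of_int_le_iff)
        then have nI: "n \<in> I" using n_low n_up by (simp add: I_def)
        have n1: "\<bar>x - of_int n\<bar> \<le> 1" "of_int n - 1 \<le> x" "x \<le> of_int n" unfolding n_def by linarith+
        have lin: "(\<Sum>i<N. v n j i * (\<sigma> i - tanh (h + b n))) = \<beta> * ((of_int n - j) / s + t) * L" for j
        proof -
          have "(\<Sum>i<N. v n j i * (\<sigma> i - tanh (h + b n))) = \<beta> * ((of_int n - j) / s + t) *
              ((\<Sum>i<N. proj N r i * \<sigma> i) - tanh (h + b n) * (\<Sum>i<N. proj N r i))"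
            unfolding v_def sum_distrib_left sum_subtractf [symmetric] right_diff_distrib
            by (intro sum.cong refl) (simp add: mult_ac)
          then show ?thesis by (simp add: proj_sum[OF N(1)] L_def)
        qed
        have g_eq: "g \<sigma> = (\<beta> / 2 * (y\<^sup>2 * (real N + S)) + \<beta> * t * (y * S)) + \<beta> * (y + t) * L + \<beta> / 2 * quad N a (proj N \<sigma>)"
          using Theta2_energy[OF N(1) a, of \<beta> \<sigma> t] by (simp add: g_def r_def y_def Y_def S_def L_def)
        have "\<beta> / 2 * (y\<^sup>2 * (real N + S)) + \<beta> * t * (y * S) \<le> \<alpha> * x\<^sup>2 / 2 + \<beta> * t\<^sup>2 * \<rho> / \<kappa>"
          using Theta2_top_direction[OF \<beta>0 \<kappa>(1) N(2) S1 S2, of y t] by (simp add: \<alpha>_def x2)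
        also have "\<alpha> * x\<^sup>2 / 2 \<le> \<alpha> * of_int n * x - \<alpha> * (of_int n)\<^sup>2 / 2 + \<alpha> / 2"
          using \<alpha> n1(1) by (intro square_le_tangent) auto
        also have "\<alpha> * of_int n * x = b n * (\<Sum>i<N. \<sigma> i - tanh h)"
          by (simp add: b_def x_def Y_def t_def)
        finally have g_le: "g \<sigma> \<le> (b n * (\<Sum>i<N. \<sigma> i - tanh h) - \<alpha> * (of_int n)\<^sup>2 / 2 + \<alpha> / 2 + \<beta> * t\<^sup>2 * \<rho> / \<kappa>
            + \<beta> / 2 * quad N a (proj N \<sigma>)) + (y + t) * (\<beta> * L)"
          unfolding g_eq by (simp add: mult_ac)
        let ?A = "b n * (\<Sum>i<N. \<sigma> i - tanh h) - \<alpha> * (of_int n)\<^sup>2 / 2 + \<alpha> / 2 + \<beta> * t\<^sup>2 * \<rho> / \<kappa>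
            + \<beta> / 2 * quad N a (proj N \<sigma>)"
        have "exp ((y + t) * (\<beta> * L)) \<le> exp (((of_int n - 1) / s + t) * (\<beta> * L)) + exp (((of_int n - 0) / s + t) * (\<beta> * L))"
          unfolding y_x using n1 s0 by (intro exp_le_exp_endpoints) (auto intro!: divide_right_mono)
        then have "exp ?A * exp ((y + t) * (\<beta> * L))
            \<le> exp ?A * (exp (((of_int n - 1) / s + t) * (\<beta> * L)) + exp (((of_int n - 0) / s + t) * (\<beta> * L)))"
          by (intro mult_left_mono) auto
        also have "\<dots> = T n 1 \<sigma> + T n 0 \<sigma>"
          unfolding T_def lin distrib_left exp_add [symmetric] by (simp add: algebra_simps)
        finally have "exp (g \<sigma>) \<le> T n 1 \<sigma> + T n 0 \<sigma>"
          using g_le unfolding exp_add [symmetric] by (meson exp_le_cancel_iff order_trans)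
        also have "\<dots> \<le> (\<Sum>n\<in>I. T n 1 \<sigma> + T n 0 \<sigma>)"
          using nI I by (intro member_le_sum[where f = "\<lambda>n. T n 1 \<sigma> + T n 0 \<sigma>"]) (auto simp: T_def)
        finally show ?thesis using True by simp
      qed
      define X where "X = \<beta> * t\<^sup>2 * \<rho> / \<kappa> + C * (F + 25 * \<beta>\<^sup>2 * \<rho>)"
      have ET: "spin_expect h N (T n j) \<le> exp (\<alpha> / 2) * exp X * exp (- d * (of_int n)\<^sup>2)"
        if n: "n \<in> I" and j: "0 \<le> j" "j \<le> 1" for n j
      proof -
        \<comment> \<open>Combined with exp (N psi h (b n)) from the tilt, this replaces psi by its
          improved upper bound; M >= 1 is that bound with w = 0.\<close>
        define M where "M = exp (real N * ((b n)\<^sup>2 / (2 * \<beta>) - c * (b n)\<^sup>2 - psi h (b n)))"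
        have "- (1 + \<kappa>) * h \<le> b n"
        proof -
          have "\<alpha> * (- t * s) \<le> \<alpha> * of_int n" using n \<alpha> by (intro mult_left_mono) (auto simp: I_def)
          then have "\<alpha> * (- t * s) / s \<le> b n" unfolding b_def using s0 by (intro divide_right_mono) auto
          moreover have "\<alpha> * (- t * s) / s = - (\<alpha> * t)" using s0 by simp
          moreover have "- (\<alpha> * t) = - (1 + \<kappa>) * h" by (simp add: \<alpha>_def t(3) algebra_simps)
          ultimately show ?thesis by (simp only:)
        qed
        moreover have "- (5 / 4) * h \<le> - (1 + \<kappa>) * h" using \<kappa> h by (intro mult_right_mono) auto
        ultimately have bl: "- (5 / 4) * h \<le> b n" by linarith
        have gain': "psi h (b n + w) \<le> (b n + w)\<^sup>2 / (2 * \<beta>) - c * (b n)\<^sup>2 + 25 * c * w\<^sup>2" for w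
          using gain[OF c(1,2) bl, of w] by (simp add: th)
        have M: "1 \<le> M" using gain'[of 0] N by (simp add: M_def)
        have "spin_expect h N (T n j) = exp (\<alpha> / 2 - \<alpha> * (of_int n)\<^sup>2 / 2 + \<beta> * t\<^sup>2 * \<rho> / \<kappa>) *
            (exp (real N * psi h (b n)) * spin_expect (h + b n) N (\<lambda>\<sigma>. exp (\<beta> / 2 * quad N a (proj N \<sigma>)
              + (\<Sum>i<N. v n j i * (\<sigma> i - tanh (h + b n))))))"
          unfolding T_def [abs_def] spin_expect_cmult spin_expect_tilt ..
        also have "\<dots> \<le> exp (\<alpha> / 2 - \<alpha> * (of_int n)\<^sup>2 / 2 + \<beta> * t\<^sup>2 * \<rho> / \<kappa>) *
            (exp (real N * psi h (b n)) * (M * exp (C * (frob N a + (\<Sum>i<N. (v n j i)\<^sup>2)))))"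
        proof (intro mult_left_mono C[OF N(1) a rs diag top F4 gap M])
          fix w :: "nat \<Rightarrow> real" assume "(\<Sum>i<N. w i) = 0"
          then show "spin_expect (h + b n) N (\<lambda>\<sigma>. exp (\<Sum>i<N. w i * (\<sigma> i - tanh (h + b n))))
              \<le> M * exp (q * (\<Sum>i<N. (w i)\<^sup>2) / 2)"
            unfolding M_def q_def by (intro Theta2_field_bound gain')
        qed auto
        also have "\<dots> = exp (\<alpha> / 2 + (real N * ((b n)\<^sup>2 / (2 * \<beta>) - c * (b n)\<^sup>2) - \<alpha> * (of_int n)\<^sup>2 / 2)
            + \<beta> * t\<^sup>2 * \<rho> / \<kappa> + C * (F + (\<Sum>i<N. (v n j i)\<^sup>2)))"
          unfolding M_def F_def exp_add [symmetric] by (simp add: algebra_simps)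
        also have "real N * ((b n)\<^sup>2 / (2 * \<beta>) - c * (b n)\<^sup>2) - \<alpha> * (of_int n)\<^sup>2 / 2 = - d * (of_int n)\<^sup>2"
        proof -
          have "real N * (b n)\<^sup>2 = \<alpha>\<^sup>2 * (of_int n)\<^sup>2"
            unfolding b_def s(2) [symmetric] using s0 by (simp add: power2_eq_square)
          then have "real N * ((b n)\<^sup>2 / (2 * \<beta>) - c * (b n)\<^sup>2)
              = \<alpha>\<^sup>2 * (of_int n)\<^sup>2 / (2 * \<beta>) - c * (\<alpha>\<^sup>2 * (of_int n)\<^sup>2)"
            by (simp add: right_diff_distrib mult.left_commute)
          also have "\<dots> - \<alpha> * (of_int n)\<^sup>2 / 2 = (\<alpha>\<^sup>2 / (2 * \<beta>) - c * \<alpha>\<^sup>2 - \<alpha> / 2) * (of_int n)\<^sup>2"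
            by (simp add: left_diff_distrib)
          finally show ?thesis unfolding d_eq .
        qed
        also have "exp (\<alpha> / 2 + - d * (of_int n)\<^sup>2 + \<beta> * t\<^sup>2 * \<rho> / \<kappa> + C * (F + (\<Sum>i<N. (v n j i)\<^sup>2)))
            \<le> exp (\<alpha> / 2 + - d * (of_int n)\<^sup>2 + \<beta> * t\<^sup>2 * \<rho> / \<kappa> + C * (F + 25 * \<beta>\<^sup>2 * \<rho>))"
        proof -
          have "\<bar>of_int n - j\<bar> \<le> 4 * s"
          proof -
            have "\<bar>of_int n\<bar> \<le> real k" using n by (auto simp: I_def)
            moreover have "real k \<le> 2 * s + 1" unfolding k_def using s by linarith
            ultimately show ?thesis using j s by linarith
          qed
          then have "\<bar>(of_int n - j) / s\<bar> \<le> 4" using s0 by (simp add: pos_divide_le_eq)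
          then have "\<bar>(of_int n - j) / s + t\<bar> \<le> 5" using t by linarith
          then have "((of_int n - j) / s + t)\<^sup>2 \<le> 5\<^sup>2" by (intro power2_le_iff_abs_le[THEN iffD2]) auto
          then have 1: "((of_int n - j) / s + t)\<^sup>2 \<le> 25" by simp
          have "(\<Sum>i<N. (v n j i)\<^sup>2) = \<beta>\<^sup>2 * ((of_int n - j) / s + t)\<^sup>2 * (\<Sum>i<N. (proj N r i)\<^sup>2)"
            by (simp add: v_def power_mult_distrib sum_distrib_left)
          also have "\<dots> \<le> \<beta>\<^sup>2 * 25 * \<rho>"
            unfolding \<rho>_def using 1 by (intro mult_mono proj_norm_le) (auto intro: sum_nonneg)
          finally have "(\<Sum>i<N. (v n j i)\<^sup>2) \<le> 25 * \<beta>\<^sup>2 * \<rho>" by (simp add: mult_ac)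
          then show ?thesis using C0 by (simp add: mult_left_mono)
        qed
        also have "\<dots> = exp (\<alpha> / 2) * exp X * exp (- d * (of_int n)\<^sup>2)"
          unfolding X_def exp_add [symmetric] by (simp add: algebra_simps)
        finally show ?thesis .
      qed
      have "spin_expect h N (\<lambda>\<sigma>. exp (g \<sigma>)) \<le> 2 * spin_expect h N (\<lambda>\<sigma>. if 0 \<le> (\<Sum>i<N. \<sigma> i) then exp (g \<sigma>) else 0)"
        unfolding g_def r_def t_def by (rule spin_expect_half_space[OF a h(2)])
      also have "\<dots> \<le> 2 * (\<Sum>n\<in>I. spin_expect h N (T n 1) + spin_expect h N (T n 0))"
        unfolding spin_expect_sum [symmetric] spin_expect_add [symmetric]
        by (intro mult_left_mono spin_expect_mono pt) auto
      also have "\<dots> \<le> 2 * (\<Sum>n\<in>I. 2 * (exp (\<alpha> / 2) * exp X * exp (- d * (of_int n)\<^sup>2)))"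
      proof (intro mult_left_mono sum_mono)
        fix n assume "n \<in> I"
        from ET[OF this, of 1] ET[OF this, of 0]
        show "spin_expect h N (T n 1) + spin_expect h N (T n 0) \<le> 2 * (exp (\<alpha> / 2) * exp X * exp (- d * (of_int n)\<^sup>2))"
          by simp
      qed auto
      also have "\<dots> = 4 * exp (\<alpha> / 2) * exp X * (\<Sum>n\<in>I. exp (- d * (of_int n)\<^sup>2))"
        by (simp add: sum_distrib_left mult.assoc)
      also have "\<dots> \<le> 4 * exp (\<alpha> / 2) * exp X * (2 / (1 - exp (- d)))"
      proof (intro mult_left_mono)
        have "(\<Sum>n\<in>I. exp (- d * (of_int n)\<^sup>2)) \<le> (\<Sum>n\<in>{- int k..int k}. exp (- d * (of_int n)\<^sup>2))"
          using I by (intro sum_mono2) auto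
        also have "\<dots> \<le> 2 / (1 - exp (- d))" by (rule discrete_gaussian_sum[OF d])
        finally show "(\<Sum>n\<in>I. exp (- d * (of_int n)\<^sup>2)) \<le> 2 / (1 - exp (- d))" .
      qed auto
      also have "\<dots> = exp (ln (4 * G) + X)" using G by (simp add: exp_add G_def gauss_const_def)
      also have "\<dots> \<le> exp (K * (F + \<rho>))"
      proof -
        have F: "1 / 4 \<le> F" using F4 by (simp add: F_def)
        \<comment> \<open>The 4 in 4 G is 2 for the half space times 2 for the endpoints; the
          constant is absorbed through F >= 1/4.\<close>
        have "ln (4 * G) * 1 \<le> ln (4 * G) * (4 * (F + \<rho>))"
          using K0(1) F \<rho> by (intro mult_left_mono) auto
        moreover have "(\<beta> * t\<^sup>2 / \<kappa> + 25 * C * \<beta>\<^sup>2) * \<rho> \<le> (\<beta> * t\<^sup>2 / \<kappa> + 25 * C * \<beta>\<^sup>2) * (F + \<rho>)"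
          using K0(2) F by (intro mult_left_mono) auto
        moreover have "C * F \<le> C * (F + \<rho>)" using C0 \<rho> by (intro mult_left_mono) auto
        moreover have "X = (\<beta> * t\<^sup>2 / \<kappa> + 25 * C * \<beta>\<^sup>2) * \<rho> + C * F"
          by (simp add: X_def algebra_simps)
        moreover have "K * (F + \<rho>) = ln (4 * G) * (4 * (F + \<rho>)) + (\<beta> * t\<^sup>2 / \<kappa> + 25 * C * \<beta>\<^sup>2) * (F + \<rho>) + C * (F + \<rho>)"
          by (simp add: K_def algebra_simps)
        ultimately show ?thesis unfolding exp_le_cancel_iff by linarith
      qed
      finally show "spin_expect h N (\<lambda>\<sigma>. exp (\<beta> / 2 * quad N a (\<lambda>i. \<sigma> i - tanh h)
          + (\<Sum>i<N. \<beta> * tanh h * (mult_mv N a (\<lambda>_. 1) i - 1) * (\<sigma> i - tanh h))))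
        \<le> exp (K * (frob N a + (\<Sum>i<N. (mult_mv N a (\<lambda>_. 1) i - 1)\<^sup>2)))"
        by (simp add: g_def F_def \<rho>_def r_def t_def)
    qed
  qed
qed


lemma Theta2_bound:
  fixes A :: "nat \<Rightarrow> real mat" and \<beta> B :: real
  assumes A: "\<And>N. N \<ge> 2 \<Longrightarrow> coupling_matrix N (A N)"
    and top: "(\<lambda>N. eigval 1 (A N)) \<longlonglongrightarrow> 1"
    and gap: "limsup (\<lambda>N. ereal (eigval 2 (A N) / eigval 1 (A N))) < 1" and \<Theta>: "(\<beta>, B) \<in> Theta2"
  shows "lesssim (\<lambda>N. ln (partition_fun (A N) \<beta> B) - mf_prediction (A N) \<beta> B)
    (\<lambda>N. (frob_norm (A N))\<^sup>2 + (mf_point \<beta> B)\<^sup>2 * (\<Sum>i<N. (row_sum (A N) i - 1)\<^sup>2))"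
proof (rule eventual_spectral_gap[OF A top gap])
  fix \<delta> N0
  assume \<delta>: "0 < \<delta>" "\<delta> \<le> 1"
    and two: "\<And>N y. N \<ge> N0 \<Longrightarrow> N \<ge> 2 \<Longrightarrow> quad N (entries (A N)) y \<le> 2 * (\<Sum>i<N. (y i)\<^sup>2)"
    and F4: "\<And>N. N \<ge> N0 \<Longrightarrow> N \<ge> 2 \<Longrightarrow> 1 / 4 \<le> frob N (entries (A N))"
    and off: "\<And>N y. N \<ge> N0 \<Longrightarrow> N \<ge> 2 \<Longrightarrow> (\<Sum>i<N. (row_sum (A N) i - 1)\<^sup>2) \<le> \<delta> ^ 3 / 64 * real N \<Longrightarrow>
      (\<Sum>i<N. y i) = 0 \<Longrightarrow> quad N (entries (A N)) y \<le> (1 - \<delta> / 4) * (\<Sum>i<N. (y i)\<^sup>2)"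
  have \<beta>: "1 < \<beta>" and B: "B = 0" using \<Theta> by (auto simp: Theta2_def)
  define t where "t = mf_point \<beta> B"
  define h where "h = \<beta> * t"
  have t: "0 < t" "t = tanh h" using mf_point_Theta2[OF \<Theta>] by (auto simp: t_def h_def)
  have h0: "0 < h" using t(1) \<beta> by (simp add: h_def)
  have h: "h = \<beta> * tanh h" unfolding t(2) [symmetric] by (rule h_def)
  have hB: "h = \<beta> * tanh h + B" using h B by simp
  have mf: "mf_point \<beta> B = tanh h" unfolding t(2) [symmetric] by (simp add: t_def)
  have t1: "t \<le> 1" unfolding t(2) using tanh_real_lt_1[of h] by simp
  show ?thesis
  proof (rule Theta2_half_space_bound[OF \<beta> h0 h \<delta>])
    fix C \<epsilon> :: real
    assume C0: "0 \<le> C" and \<epsilon>: "0 < \<epsilon>" and C: "\<And>N a. 2 \<le> N \<Longrightarrow> sym_on N a \<Longrightarrow>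
      (\<And>i. i < N \<Longrightarrow> 0 \<le> mult_mv N a (\<lambda>_. 1) i) \<Longrightarrow> (\<And>i. i < N \<Longrightarrow> a i i = 0) \<Longrightarrow>
      (\<And>y. quad N a y \<le> 2 * (\<Sum>i<N. (y i)\<^sup>2)) \<Longrightarrow> 1 / 4 \<le> frob N a \<Longrightarrow>
      (\<And>y. (\<Sum>i<N. y i) = 0 \<Longrightarrow> quad N a y \<le> (1 - \<delta> / 4) * (\<Sum>i<N. (y i)\<^sup>2)) \<Longrightarrow>
      (\<Sum>i<N. (mult_mv N a (\<lambda>_. 1) i - 1)\<^sup>2) \<le> \<epsilon> * real N \<Longrightarrow>
      spin_expect h N (\<lambda>\<sigma>. exp (\<beta> / 2 * quad N a (\<lambda>i. \<sigma> i - tanh h)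
        + (\<Sum>i<N. \<beta> * tanh h * (mult_mv N a (\<lambda>_. 1) i - 1) * (\<sigma> i - tanh h))))
      \<le> exp (C * (frob N a + (\<Sum>i<N. (mult_mv N a (\<lambda>_. 1) i - 1)\<^sup>2)))"
    define \<epsilon>' where "\<epsilon>' = min \<epsilon> (\<delta> ^ 3 / 64)"
    have \<epsilon>': "0 < \<epsilon>'" using \<epsilon> \<delta> by (simp add: \<epsilon>'_def)
    define K1 where "K1 = (4 * \<beta> + \<beta>) / \<epsilon>' + \<beta>"
    have K1: "0 \<le> K1" using \<beta> \<epsilon>' by (simp add: K1_def)
    \<comment> \<open>t is a fixed positive number here, so \<rho> and t^2 \<rho> differ by a
      constant factor.\<close>
    define K where "K = C * (1 + 1 / t\<^sup>2) + K1 / t\<^sup>2"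
    show ?thesis
    proof (rule lesssim_of_eventually[where C = K and ?N0.0 = N0])
      fix N :: nat assume N: "N \<ge> N0" "N \<ge> 2"
      note cm = A[OF N(2)]
      let ?a = "entries (A N)"
      define F where "F = frob N ?a"
      define \<rho> where "\<rho> = (\<Sum>i<N. (row_sum (A N) i - 1)\<^sup>2)"
      have F: "0 \<le> F" and \<rho>: "0 \<le> \<rho>" by (auto simp: F_def \<rho>_def frob_nonneg sum_nonneg)
      define E where "E = ln (partition_fun (A N) \<beta> B) - mf_prediction (A N) \<beta> B"
      have E: "E = ln (spin_expect h N (\<lambda>\<sigma>. exp (\<beta> / 2 * quad N ?a (\<lambda>i. \<sigma> i - tanh h)
          + (\<Sum>i<N. \<beta> * tanh h * (row_sum (A N) i - 1) * (\<sigma> i - tanh h)))))"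
        unfolding E_def by (rule gap_eq[OF cm hB mf])
      have "E \<le> C * (F + \<rho>) + K1 * \<rho>"
      proof (cases "\<rho> \<le> \<epsilon>' * real N")
        case True
        have "\<epsilon>' * real N \<le> \<epsilon> * real N" "\<epsilon>' * real N \<le> \<delta> ^ 3 / 64 * real N"
          by (intro mult_right_mono; simp add: \<epsilon>'_def)+
        then have r: "\<rho> \<le> \<epsilon> * real N" "\<rho> \<le> \<delta> ^ 3 / 64 * real N" using True by linarith+
        have rs: "(\<Sum>i<N. (mult_mv N ?a (\<lambda>_. 1) i - 1)\<^sup>2) = \<rho>"
          unfolding \<rho>_def using coupling_matrixD(5)[OF cm] by simp
        have "E \<le> C * (frob N ?a + (\<Sum>i<N. (mult_mv N ?a (\<lambda>_. 1) i - 1)\<^sup>2))"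
        proof -
          have "spin_expect h N (\<lambda>\<sigma>. exp (\<beta> / 2 * quad N ?a (\<lambda>i. \<sigma> i - tanh h)
              + (\<Sum>i<N. \<beta> * tanh h * (mult_mv N ?a (\<lambda>_. 1) i - 1) * (\<sigma> i - tanh h))))
            \<le> exp (C * (frob N ?a + (\<Sum>i<N. (mult_mv N ?a (\<lambda>_. 1) i - 1)\<^sup>2)))"
          proof (rule C[OF N(2) coupling_matrixD(2,4,3)[OF cm] two[OF N] F4[OF N]])
            show "quad N ?a y \<le> (1 - \<delta> / 4) * (\<Sum>i<N. (y i)\<^sup>2)" if "(\<Sum>i<N. y i) = 0" for y
              using off[OF N _ that] r(2) by (simp add: \<rho>_def)
            show "(\<Sum>i<N. (mult_mv N ?a (\<lambda>_. 1) i - 1)\<^sup>2) \<le> \<epsilon> * real N" unfolding rs by (rule r(1))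
          qed
          then show ?thesis unfolding E
            by (intro ln_spin_expect_le) (simp add: coupling_matrixD(5)[OF cm])
        qed
        then have "E \<le> C * (F + \<rho>)" by (simp only: rs F_def)
        then show ?thesis using K1 \<rho> by (simp add: add_increasing2)
      next
        \<comment> \<open>If \<rho> exceeds \<epsilon>' N, then bounding the exponent pointwise by
          O(N + \<rho>) is enough.\<close>
        case False
        have Y2: "\<bar>\<sigma> i - tanh h\<bar> \<le> 2" if "\<sigma> \<in> spins N" "i < N" for \<sigma> i
          using spins_abs[OF that] abs_tanh_le_1[of h] by linarith
        have "\<beta> / 2 * quad N ?a (\<lambda>i. \<sigma> i - tanh h) + (\<Sum>i<N. \<beta> * tanh h * (row_sum (A N) i - 1) * (\<sigma> i - tanh h))
            \<le> 4 * \<beta> * real N + \<beta> * (\<rho> + real N)" if \<sigma>: "\<sigma> \<in> spins N" for \<sigma>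
        proof -
          have "(\<Sum>i<N. (\<sigma> i - tanh h)\<^sup>2) \<le> (\<Sum>i<N. 2\<^sup>2)"
            using Y2[OF \<sigma>] by (intro sum_mono power2_le_iff_abs_le[THEN iffD2]) auto
          then have "quad N ?a (\<lambda>i. \<sigma> i - tanh h) \<le> 8 * real N" using two[OF N, of "\<lambda>i. \<sigma> i - tanh h"] by simp
          then have "\<beta> / 2 * quad N ?a (\<lambda>i. \<sigma> i - tanh h) \<le> \<beta> / 2 * (8 * real N)"
            using \<beta> by (intro mult_left_mono) auto
          moreover have "(\<Sum>i<N. \<beta> * tanh h * (row_sum (A N) i - 1) * (\<sigma> i - tanh h))
              \<le> (\<Sum>i<N. \<beta> * ((row_sum (A N) i - 1)\<^sup>2 + 1))"
          proof (rule sum_mono)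
            fix i assume i: "i \<in> {..<N}"
            let ?r = "row_sum (A N) i - 1" and ?y = "\<sigma> i - tanh h"
            have "tanh h * (?r * ?y) \<le> \<bar>tanh h * (?r * ?y)\<bar>" by simp
            also have "\<dots> \<le> 1 * (\<bar>?r\<bar> * 2)" unfolding abs_mult
              using Y2[OF \<sigma>, of i] i abs_tanh_le_1[of h] by (intro mult_mono) auto
            also have "\<dots> \<le> ?r\<^sup>2 + 1" using zero_le_power2[of "\<bar>?r\<bar> - 1"] by (simp add: power2_diff)
            finally have "\<beta> * (tanh h * (?r * ?y)) \<le> \<beta> * (?r\<^sup>2 + 1)" using \<beta> by (intro mult_left_mono) auto
            then show "\<beta> * tanh h * ?r * ?y \<le> \<beta> * (?r\<^sup>2 + 1)" by (simp only: mult.assoc)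
          qed
          moreover have "(\<Sum>i<N. \<beta> * ((row_sum (A N) i - 1)\<^sup>2 + 1)) = \<beta> * (\<rho> + real N)"
            unfolding sum_distrib_left [symmetric] sum.distrib \<rho>_def by simp
          ultimately show ?thesis by simp
        qed
        then have "E \<le> 4 * \<beta> * real N + \<beta> * (\<rho> + real N)" unfolding E
          using spin_expect_mono[of N _ "\<lambda>_. exp (4 * \<beta> * real N + \<beta> * (\<rho> + real N))" h]
          by (intro ln_spin_expect_le) simp
        also have "\<dots> = (4 * \<beta> + \<beta>) * real N + \<beta> * \<rho>" by (simp add: algebra_simps)
        also have "\<dots> \<le> (4 * \<beta> + \<beta>) * (\<rho> / \<epsilon>') + \<beta> * \<rho>"
          using False \<epsilon>' \<beta> by (intro add_right_mono mult_left_mono) (auto simp: pos_le_divide_eq mult.commute)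
        also have "\<dots> = K1 * \<rho>" by (simp add: K1_def distrib_right)
        finally show ?thesis using C0 F \<rho> by (simp add: add_increasing)
      qed
      also have "C * (F + \<rho>) + K1 * \<rho> \<le> K * (F + t\<^sup>2 * \<rho>)"
      proof -
        have t2: "0 < t\<^sup>2" using t(1) by simp
        have "F + \<rho> \<le> (1 + 1 / t\<^sup>2) * (F + t\<^sup>2 * \<rho>)"
          using t2 F \<rho> by (simp add: distrib_right distrib_left add_divide_distrib)
        then have "C * (F + \<rho>) \<le> C * ((1 + 1 / t\<^sup>2) * (F + t\<^sup>2 * \<rho>))" using C0 by (intro mult_left_mono)
        moreover have "K1 * \<rho> \<le> K1 / t\<^sup>2 * (F + t\<^sup>2 * \<rho>)"
          using t2 F K1 by (simp add: distrib_left)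
        ultimately show ?thesis unfolding K_def distrib_right[of _ "K1 / t\<^sup>2"] mult.assoc[of C] by (rule add_mono)
      qed
      finally show "ln (partition_fun (A N) \<beta> B) - mf_prediction (A N) \<beta> B
          \<le> K * ((frob_norm (A N))\<^sup>2 + (mf_point \<beta> B)\<^sup>2 * (\<Sum>i<N. (row_sum (A N) i - 1)\<^sup>2))"
        unfolding coupling_matrixD(6)[OF cm] E_def F_def \<rho>_def t_def .
    next
      fix N :: nat assume N: "N \<ge> 2"
      show "0 \<le> (frob_norm (A N))\<^sup>2 + (mf_point \<beta> B)\<^sup>2 * (\<Sum>i<N. (row_sum (A N) i - 1)\<^sup>2)"
        by (simp add: sum_nonneg)
      show "ln (partition_fun (A N) \<beta> B) - mf_prediction (A N) \<beta> B \<le> 0"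
        if "(frob_norm (A N))\<^sup>2 + (mf_point \<beta> B)\<^sup>2 * (\<Sum>i<N. (row_sum (A N) i - 1)\<^sup>2) = 0"
        by (rule gap_nonpos_degenerate[OF A[OF N] N hB mf that])
    qed
  qed
qed

theorem theorem1p5:
  fixes A :: "nat \<Rightarrow> real mat" and \<beta> B :: real
  assumes "\<And>N. N \<ge> 2 \<Longrightarrow> coupling_matrix N (A N)"
    and "lesssim (\<lambda>N. Max (row_sum (A N) ` {..<N})) (\<lambda>N. 1)"
    and "(\<lambda>N. eigval 1 (A N)) \<longlonglongrightarrow> 1"
  shows
    "((\<beta>, B) \<in> Theta1 \<longrightarrow>
        lesssim (\<lambda>N. ln (partition_fun (A N) \<beta> B) - mf_prediction (A N) \<beta> B)
          (\<lambda>N. (frob_norm (A N))\<^sup>2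
                + (mf_point \<beta> B)\<^sup>2 * (\<Sum>i<N. (row_sum (A N) i - 1)\<^sup>2)))
     \<and> ((\<beta>, B) \<in> Theta2 \<longrightarrow>
        limsup (\<lambda>N. ereal (eigval 2 (A N) / eigval 1 (A N))) < 1 \<longrightarrow>
        lesssim (\<lambda>N. ln (partition_fun (A N) \<beta> B) - mf_prediction (A N) \<beta> B)
          (\<lambda>N. (frob_norm (A N))\<^sup>2
                + (mf_point \<beta> B)\<^sup>2 * (\<Sum>i<N. (row_sum (A N) i - 1)\<^sup>2)))
     \<and> ((\<beta>, B) \<in> Theta3 \<longrightarrow>
        limsup (\<lambda>N. ereal (eigval 2 (A N) / eigval 1 (A N))) < 1 \<longrightarrow>
        lesssim (\<lambda>N. ln (partition_fun (A N) \<beta> B) - mf_prediction (A N) \<beta> B)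
          (\<lambda>N. (frob_norm (A N))\<^sup>2
                + 1 / real N * (\<Sum>i<N. (row_sum (A N) i - 1)\<^sup>2)\<^sup>2
                + 1 / real N * (\<Sum>i<N. (row_sum (A N) i - 1))\<^sup>2
                + ln (real N)))"
proof (intro conjI impI)
  show "lesssim (\<lambda>N. ln (partition_fun (A N) \<beta> B) - mf_prediction (A N) \<beta> B)
      (\<lambda>N. (frob_norm (A N))\<^sup>2 + (mf_point \<beta> B)\<^sup>2 * (\<Sum>i<N. (row_sum (A N) i - 1)\<^sup>2))"
    if "(\<beta>, B) \<in> Theta1"
    using assms(1,3) that by (rule Theta1_bound)
  show "lesssim (\<lambda>N. ln (partition_fun (A N) \<beta> B) - mf_prediction (A N) \<beta> B)
      (\<lambda>N. (frob_norm (A N))\<^sup>2 + (mf_point \<beta> B)\<^sup>2 * (\<Sum>i<N. (row_sum (A N) i - 1)\<^sup>2))"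
    if "(\<beta>, B) \<in> Theta2" "limsup (\<lambda>N. ereal (eigval 2 (A N) / eigval 1 (A N))) < 1"
    using assms(1,3) that(2,1) by (rule Theta2_bound)
  show "lesssim (\<lambda>N. ln (partition_fun (A N) \<beta> B) - mf_prediction (A N) \<beta> B)
      (\<lambda>N. (frob_norm (A N))\<^sup>2 + 1 / real N * (\<Sum>i<N. (row_sum (A N) i - 1)\<^sup>2)\<^sup>2
        + 1 / real N * (\<Sum>i<N. (row_sum (A N) i - 1))\<^sup>2 + ln (real N))"
    if "(\<beta>, B) \<in> Theta3" "limsup (\<lambda>N. ereal (eigval 2 (A N) / eigval 1 (A N))) < 1"
  proof -
    have "\<beta> = 1" "B = 0" using that(1) by (auto simp: Theta3_def)
    then show ?thesis using Theta3_bound[OF assms(1,3) that(2)] by simp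
  qed
qed

end
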